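(* Let $0<\alpha<1$, $\mu>0$, $\delta=2(1-\alpha)$ and $\theta=\frac{\delta\mu}{2}$. Let $X=X_{-\alpha,\mu;\theta\downarrow}$ be a diffusion on $\mathbb{R}_+$ with infinitesimal generator $$\mathcal{L}_{-\alpha,\mu}^{\theta\downarrow}=\frac12\frac{d^2}{dx^2}+\left[\frac{\delta-1}{2x}+\mu x\,\frac{\widehat{K}'_{\frac{\alpha}{2}}}{\widehat{K}_{\frac{\alpha}{2}}}\left(\mu\frac{x^2}{2}\right)\right]\frac{d}{dx}.$$ Then there exists a diffusion $X_{-\frac{\alpha}{2};\left(\frac{\mu^2}{8}\right)\downarrow}=\left(X_{-\frac{\alpha}{2};\left(\frac{\mu^2}{8}\right)\downarrow}(u),\,u\ge0\right)$ on $\mathbb{R}_+$, with infinitesimal generator $$\mathcal{L}_{-\frac{\alpha}{2}}^{\left(\frac{\mu^2}{8}\right)\downarrow}=\frac12\frac{d^2}{dx^2}+\left[\frac{1-\alpha}{2x}+\frac{\mu}{2}\,\frac{\widehat{K}'_{\frac{\alpha}{2}}}{\widehat{K}_{\frac{\alpha}{2}}}\left(\frac{\mu}{2}x\right)\right]\frac{d}{dx},$$ such that, for all $t\ge 0$, $$X^2_{-\alpha,\mu;\theta\downarrow}(t)=X_{-\frac{\alpha}{2};\left(\frac{\mu^2}{8}\right)\downarrow}\left(4\int_0^t X^2_{-\alpha,\mu;\theta\downarrow}(u)\,du\right).$$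
   Context: For $\beta>0$, $\widehat{K}_\beta(y)=y^\beta K_\beta(y)$, $y>0$, where $K_\beta$ is the modified Bessel (McDonald) function of the second kind, and $\frac{\widehat K'_\beta}{\widehat K_\beta}(y)=\widehat K_\beta'(y)/\widehat K_\beta(y)$. A diffusion "with infinitesimal generator $\frac12\frac{d^2}{dx^2}+b(x)\frac{d}{dx}$" means a diffusion on $\mathbb{R}_+=[0,\infty)$ governed by this operator on $(0,\infty)$ and instantaneously reflected at the boundary point $0$. The notation reflects the following. For $0<\beta<1$ and $\nu>0$, $\mathcal{L}_{-\beta}=\frac12\frac{d^2}{dx^2}+\frac{1-2\beta}{2x}\frac{d}{dx}$ is the generator of the Bessel process of dimension $2(1-\beta)$, and $\mathcal{L}_{-\beta}^{\nu\downarrow}=\mathcal{L}_{-\beta}+\sqrt{2\nu}\,\frac{\widehat K'_\beta}{\widehat K_\beta}(\sqrt{2\nu}\,x)\frac{d}{dx}$ is the generator of this Bessel process pushed downwards with parameter $\nu$ (here used with $\beta=\alpha/2$, $\nu=\mu^2/8$, so that $\sqrt{2\nu}=\mu/2$). The operator $\mathcal{L}_{-\alpha,\mu}^{\theta\downarrow}$ is the generator of the radial Ornstein-Uhlenbeck process with generator $\frac12\frac{d^2}{dx^2}+\left(\frac{\delta-1}{2x}-\mu x\right)\frac{d}{dx}$, pushed downwards with parameter $\theta=\frac{\delta\mu}{2}$. *)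

theory Defs
  imports "HOL-Probability.Probability"
begin

(* K_beta(y) for y > 0 and every real order beta, through the classical representation
   K_beta(y) = int_0^oo exp (- y cosh t) cosh (beta t) dt. *)
definition bessel_K :: "real \<Rightarrow> real \<Rightarrow> real" where
  "bessel_K \<beta> y = (LBINT t:{0..}. exp (- y * cosh t) * cosh (\<beta> * t))"

definition bessel_K_hat :: "real \<Rightarrow> real \<Rightarrow> real" where
  "bessel_K_hat \<beta> y = y powr \<beta> * bessel_K \<beta> y"

definition bessel_K_hat_logderiv :: "real \<Rightarrow> real \<Rightarrow> real" where
  "bessel_K_hat_logderiv \<beta> y = deriv (bessel_K_hat \<beta>) y / bessel_K_hat \<beta> y"

(* C([0,oo), [0,oo)) with the sigma-algebra generated by the coordinates. Being elements of a
   PiM space, paths are extensional: w t = undefined for t < 0. *)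
definition path_space :: "(real \<Rightarrow> real) measure" where
  "path_space = restrict_space (PiM {0..} (\<lambda>_. borel))
     {w. continuous_on {0..} w \<and> (\<forall>t\<ge>0. 0 \<le> w t)}"

definition shift_path :: "real \<Rightarrow> (real \<Rightarrow> real) \<Rightarrow> (real \<Rightarrow> real)" where
  "shift_path s w = (\<lambda>t\<in>{0..}. w (s + t))"

definition path_past :: "real \<Rightarrow> (real \<Rightarrow> real) measure" where
  "path_past t = sigma (space path_space)
     {(\<lambda>w. w s) -` B \<inter> space path_space | s B. 0 \<le> s \<and> s \<le> t \<and> B \<in> sets borel}"

(* The right-continuous canonical filtration, so that its stopping times are
   the optional times of path_past. *)
definition path_filtration :: "real \<Rightarrow> (real \<Rightarrow> real) measure" where
  "path_filtration t = sigma (space path_space) (\<Inter>s\<in>{t<..}. sets (path_past s))"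

lemma filtration_path_filtration: "filtration (space path_space) path_filtration"
proof
  show "space (path_filtration t) = space path_space" for t
    by (simp add: path_filtration_def space_measure_of_conv)
next
  fix s t :: real
  assume st: "s \<le> t"
  have sub: "(\<Inter>r\<in>{u<..}. sets (path_past r)) \<subseteq> Pow (space path_space)" for u :: real
    using sets.space_closed[of "path_past (u + 1)"]
    by (force simp: path_past_def space_measure_of_conv)
  show "sets (path_filtration s) \<subseteq> sets (path_filtration t)"
    unfolding path_filtration_def sets_measure_of[OF sub]
    by (rule sigma_sets_mono') (use st in auto)
qed

(* P x is the law of the path started at x. Restricting to finite stopping times loses nothing:
   a stopping time T with values in [0,oo] is covered by the times min T n. *)
definition strong_markov_laws :: "(real \<Rightarrow> (real \<Rightarrow> real) measure) \<Rightarrow> bool" where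
  "strong_markov_laws P \<longleftrightarrow>
     P \<in> restrict_space borel {0..} \<rightarrow>\<^sub>M prob_algebra path_space \<and>
     (\<forall>x\<ge>0. AE w in P x. w 0 = x) \<and>
     (\<forall>x\<ge>0. \<forall>T. stopping_time path_filtration T \<and> (\<forall>w\<in>space path_space. 0 \<le> T w) \<longrightarrow>
        (\<forall>A\<in>sets (filtration.pre_sigma (space path_space) path_filtration T).
         \<forall>B\<in>sets path_space.
           measure (P x) {w \<in> A. shift_path (T w) w \<in> B} =
           (LINT w:A|P x. measure (P (w (T w))) B)))"

(* C^2 functions with compact support in the open half-line (0,oo). *)
definition C2_compact_support_pos :: "(real \<Rightarrow> real) \<Rightarrow> bool" where
  "C2_compact_support_pos f \<longleftrightarrow>
     (\<forall>x. f differentiable (at x)) \<and> (\<forall>x. deriv f differentiable (at x)) \<and>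
     continuous_on UNIV (deriv (deriv f)) \<and>
     (\<exists>a b. 0 < a \<and> (\<forall>x. x \<notin> {a..b} \<longrightarrow> f x = 0))"

(* On (0,oo) the infinitesimal generator lim (P_t f - f) / t (in the supremum norm) of the
   semigroup P_t f x = E_x f(w t) is f''/2 + b f'. *)
definition generated_on_pos :: "(real \<Rightarrow> real) \<Rightarrow> (real \<Rightarrow> (real \<Rightarrow> real) measure) \<Rightarrow> bool" where
  "generated_on_pos b P \<longleftrightarrow>
     (\<forall>f. C2_compact_support_pos f \<longrightarrow>
        uniform_limit {0..} (\<lambda>t x. ((LINT w|P x. f (w t)) - f x) / t)
          (\<lambda>x. 1/2 * deriv (deriv f) x + b x * deriv f x) (at_right 0))"

(* Instantaneous reflection at 0: the set of times spent at 0 is Lebesgue-null. Since the paths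
   have infinite lifetime, this excludes absorption and stickiness (0 has zero speed measure). *)
definition instantaneous_at_0 :: "(real \<Rightarrow> (real \<Rightarrow> real) measure) \<Rightarrow> bool" where
  "instantaneous_at_0 P \<longleftrightarrow> (\<forall>x\<ge>0. AE w in P x. {t. 0 \<le> t \<and> w t = 0} \<in> null_sets lborel)"

(* X is a diffusion on [0,oo), with generator f''/2 + b f' on (0,oo) and instantaneously reflected
   at 0: it has continuous nonnegative paths, and its law is that of the strong Markov family P
   started from the (arbitrary) distribution of X 0. *)
definition reflected_diffusion ::
    "(real \<Rightarrow> real) \<Rightarrow> 'a measure \<Rightarrow> (real \<Rightarrow> 'a \<Rightarrow> real) \<Rightarrow> bool" where
  "reflected_diffusion b M X \<longleftrightarrow>
     prob_space M \<and>
     (\<lambda>\<omega>. \<lambda>t\<in>{0..}. X t \<omega>) \<in> M \<rightarrow>\<^sub>M path_space \<and>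
     (\<exists>P. strong_markov_laws P \<and> generated_on_pos b P \<and> instantaneous_at_0 P \<and>
        distr M path_space (\<lambda>\<omega>. \<lambda>t\<in>{0..}. X t \<omega>) =
        distr M (restrict_space borel {0..}) (X 0) \<bind> P)"

end

(* Put A(t) = 4 int_0^t X(u)^2 du and let Y be the path with Y(A(t)) = X(t)^2; this determines Y and
   makes it continuous as soon as A is unbounded, since X vanishes wherever A is flat.

   A is unbounded almost surely: started at 0, X leaves 0 at once because it spends no time there, so
   A(1) is large with positive probability; by path continuity this forces X through every small level,
   so the strong Markov property bounds the probability of an increment of A of a given size below,
   uniformly in the starting point.

   The law of Y inherits the strong Markov property because T(Y), read in the time scale of X, is an
   optional time of X. Dynkin's formula for x -> f(x^2) at the inverse of A becomes Dynkin's formula for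
   f and Y, since L(f(x^2)) = 4 x^2 (L'f)(x^2). It yields the convergence of the difference quotients
   of E f(Y(u)) uniformly in the starting point, because E h(Y(u)) -> h uniformly for test functions h,
   and L'f is a uniform limit of such functions. *)

theory Submission imports Defs begin

text \<open>The factor 4 comes from Ito's formula: squaring multiplies the second-order coefficient
  by 4 x^2, and running time at that speed restores 1/2. The same division turns a drift b into b'
  with b'(x^2) = (1 + 2 x b(x)) / (4 x^2). All steps are carried out for an arbitrary drift that is
  continuous on (0,oo) and a b' satisfying this identity; the Bessel functions enter through the
  continuity of their logarithmic derivative and the final identification of b'.

  Two obstacles shape the argument. Paths with bounded clock are a null set for each law, but the
  filtration contains no null sets, so an optional time cannot be carried along a time change that
  is defined only almost surely. Therefore paths are altered after a deterministic time n so that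
  their clocks become unbounded, and n tends to infinity. Also, the generator is given only as a
  uniform limit on functions supported away from 0. Dynkin's formula has to be built from it by
  differentiating the expectation in time, and since the inverse clock has no deterministic bound,
  optional stopping is applied to truncations whose error is controlled in the new time
  scale.\<close>

abbreviation paths :: "(real \<Rightarrow> real) set" where
  "paths \<equiv> space path_space"

section \<open>Path space: joint measurability of evaluation and shift\<close>

lemma space_path_space:
  "paths = {w \<in> extensional {0..}. continuous_on {0..} w \<and> (\<forall>t\<ge>0. 0 \<le> w t)}"
  by (auto simp: path_space_def space_restrict_space space_PiM PiE_def)

lemma path_spaceD:
  assumes "w \<in> paths"
  shows "continuous_on {0..} w" "0 \<le> t \<Longrightarrow> 0 \<le> w t" "w \<in> extensional {0..}"
  using assms by (auto simp: space_path_space)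

lemma path_eqI:
  assumes "w \<in> paths" "v \<in> paths" "\<And>t. 0 \<le> t \<Longrightarrow> w t = v t"
  shows "w = v"
  using assms by (auto simp: space_path_space intro!: extensionalityI[of w "{0..}" v])

lemma measurable_path_spaceI:
  assumes "\<And>x. x \<in> space N \<Longrightarrow> f x \<in> paths"
    and "\<And>t. 0 \<le> t \<Longrightarrow> (\<lambda>x. f x t) \<in> borel_measurable N"
  shows "f \<in> N \<rightarrow>\<^sub>M path_space"
  unfolding path_space_def
proof (rule measurable_restrict_space2)
  show "f \<in> space N \<rightarrow> {w. continuous_on {0..} w \<and> (\<forall>t\<ge>0. 0 \<le> w t)}"
    using assms(1) by (auto simp: space_path_space)
  have "(\<lambda>x t. f x t) \<in> N \<rightarrow>\<^sub>M Pi\<^sub>M {0..} (\<lambda>_. borel)"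
    by (rule measurable_PiM_single') (use assms in \<open>auto simp: space_path_space PiE_def\<close>)
  then show "f \<in> N \<rightarrow>\<^sub>M Pi\<^sub>M {0..} (\<lambda>_. borel)" by simp
qed

lemma measurable_coord: "0 \<le> t \<Longrightarrow> (\<lambda>w. w t) \<in> borel_measurable path_space"
  unfolding path_space_def
  by (intro measurable_restrict_space1 measurable_component_singleton) auto

text \<open>A continuous path is the limit of its values at the grid times \<open>d n t\<close>, and
  a grid evaluation is a countable patchwork of coordinates. \<open>max 0\<close> gives a total
  function of time, since coordinates are controlled only on \<open>{0..}\<close>.\<close>

lemma measurable_eval_max:
  "(\<lambda>(t, w). w (max 0 t)) \<in> borel_measurable (borel \<Otimes>\<^sub>M path_space)"
proof -
  define d where "d n t = real (nat \<lfloor>real (Suc n) * max 0 t\<rfloor>) / real (Suc n)" for n :: nat and t :: real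
  have meas: "(\<lambda>(t, w). w (d n t)) \<in> borel_measurable (borel \<Otimes>\<^sub>M path_space)" for n
  proof -
    have "(\<lambda>p. (\<lambda>i p. (snd p) (real i / real (Suc n))) (nat \<lfloor>real (Suc n) * max 0 (fst p)\<rfloor>) p)
            \<in> borel_measurable (borel \<Otimes>\<^sub>M path_space)"
    proof (rule measurable_compose_countable[where f="\<lambda>i p. (snd p) (real i / real (Suc n))"])
      fix i :: nat
      show "(\<lambda>p. (snd p) (real i / real (Suc n))) \<in> borel_measurable (borel \<Otimes>\<^sub>M path_space)"
        by (rule measurable_compose[OF measurable_snd measurable_coord]) simp
    qed measurable
    then show ?thesis by (simp add: case_prod_beta' d_def)
  qed
  have lim: "(\<lambda>n. w (d n t)) \<longlonglongrightarrow> w (max 0 t)" if w: "continuous_on {0..} w" for t and w :: "real \<Rightarrow> real"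
  proof -
    define m where "m = max 0 t"
    have d: "\<bar>d n t - m\<bar> \<le> 1 / real (Suc n)" for n
    proof -
      have "real (nat \<lfloor>real (Suc n) * m\<rfloor>) = real_of_int \<lfloor>real (Suc n) * m\<rfloor>"
        by (simp add: m_def)
      moreover have "\<bar>real_of_int \<lfloor>real (Suc n) * m\<rfloor> - real (Suc n) * m\<bar> \<le> 1" by linarith
      moreover have "d n t * real (Suc n) = real (nat \<lfloor>real (Suc n) * m\<rfloor>)"
        by (simp add: d_def m_def del: of_nat_Suc)
      ultimately have "\<bar>(d n t - m) * real (Suc n)\<bar> \<le> 1"
        by (simp add: algebra_simps del: of_nat_Suc)
      then have "\<bar>d n t - m\<bar> * real (Suc n) \<le> 1" by (simp only: abs_mult abs_of_nat)
      then show ?thesis by (subst pos_le_divide_eq) simp_all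
    qed
    have "(\<lambda>n. d n t - m) \<longlonglongrightarrow> 0"
    proof (rule Lim_null_comparison)
      show "(\<lambda>n. 1 / real (Suc n)) \<longlonglongrightarrow> 0"
        using LIMSEQ_inverse_real_of_nat by (simp add: inverse_eq_divide)
      show "\<forall>\<^sub>F n in sequentially. norm (d n t - m) \<le> 1 / real (Suc n)"
        using d by (intro always_eventually) (simp del: of_nat_Suc)
    qed
    then have "(\<lambda>n. d n t) \<longlonglongrightarrow> m" by (rule LIM_zero_cancel)
    then show ?thesis
      unfolding m_def[symmetric]
      by (intro continuous_on_tendsto_compose[OF w]) (auto simp: m_def d_def)
  qed
  show ?thesis
    by (rule borel_measurable_LIMSEQ_real[OF _ meas])
       (auto simp: space_pair_measure space_path_space intro!: lim)
qed

lemma measurable_eval: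
  assumes "f \<in> borel_measurable N" "g \<in> N \<rightarrow>\<^sub>M path_space" "\<And>x. x \<in> space N \<Longrightarrow> 0 \<le> f x"
  shows "(\<lambda>x. g x (f x)) \<in> borel_measurable N"
proof -
  have "(\<lambda>x. (\<lambda>(t, w). w (max 0 t)) (f x, g x)) \<in> borel_measurable N"
    by (rule measurable_compose[OF _ measurable_eval_max]) (use assms in measurable)
  then show ?thesis
    by (rule measurable_cong[THEN iffD1, rotated]) (use assms(3) in \<open>auto simp: max_def\<close>)
qed

lemma shift_path_in_space:
  assumes "w \<in> paths" "0 \<le> s"
  shows "shift_path s w \<in> paths"
proof -
  have "continuous_on {0..} (\<lambda>t. w (s + t))"
    by (rule continuous_on_compose2[OF path_spaceD(1)[OF assms(1)]])
       (use assms in \<open>auto intro!: continuous_intros\<close>)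
  then have "continuous_on {0..} (shift_path s w)"
    by (subst continuous_on_cong[OF refl, of _ _ "\<lambda>t. w (s + t)"]) (auto simp: shift_path_def)
  with assms show ?thesis by (auto simp: space_path_space shift_path_def)
qed

lemma measurable_shift:
  assumes "f \<in> borel_measurable N" "g \<in> N \<rightarrow>\<^sub>M path_space" "\<And>x. x \<in> space N \<Longrightarrow> 0 \<le> f x"
  shows "(\<lambda>x. shift_path (f x) (g x)) \<in> N \<rightarrow>\<^sub>M path_space"
proof (rule measurable_path_spaceI)
  fix x assume "x \<in> space N"
  then show "shift_path (f x) (g x) \<in> paths"
    using assms measurable_space[OF assms(2)] by (intro shift_path_in_space) auto
next
  fix t :: real assume "0 \<le> t"
  then show "(\<lambda>x. shift_path (f x) (g x) t) \<in> borel_measurable N"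
    using measurable_eval[of "\<lambda>x. f x + t", OF _ assms(2)] assms(1,3)
    by (simp add: shift_path_def)
qed

subsection \<open>Paths frozen after a given time\<close>

text \<open>Letting the path grow linearly instead of stopping it keeps the additive functional
  of the time change unbounded.\<close>

definition freeze :: "real \<Rightarrow> (real \<Rightarrow> real) \<Rightarrow> (real \<Rightarrow> real)" where
  "freeze t w = (\<lambda>s\<in>{0..}. w (min s t) + max 0 (s - t))"

lemma freeze_in_space:
  assumes "w \<in> paths" "0 \<le> t"
  shows "freeze t w \<in> paths"
proof -
  have "continuous_on {0..} (\<lambda>s. w (min s t) + max 0 (s - t))"
    by (intro continuous_intros continuous_on_compose2[OF path_spaceD(1)[OF assms(1)]])
       (use assms in auto)
  then have "continuous_on {0..} (freeze t w)"
    by (subst continuous_on_cong[OF refl, of _ _ "\<lambda>s. w (min s t) + max 0 (s - t)"]) (auto simp: freeze_def)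
  with assms show ?thesis by (auto simp: space_path_space freeze_def)
qed

lemma freeze_eq: "0 \<le> s \<Longrightarrow> s \<le> t \<Longrightarrow> freeze t w s = w s"
  by (simp add: freeze_def)

lemma freeze_cong: "(\<And>s. 0 \<le> s \<Longrightarrow> s \<le> t \<Longrightarrow> w s = v s) \<Longrightarrow> 0 \<le> t \<Longrightarrow> freeze t w = freeze t v"
  by (auto simp: freeze_def fun_eq_iff)

section \<open>The right-continuous path filtration and its stopping times\<close>

lemma space_path_past [simp]: "space (path_past t) = paths"
  unfolding path_past_def by (auto simp: space_measure_of_conv)

lemma path_past_generator_subset:
  "{(\<lambda>w. w s) -` B \<inter> paths | s B. 0 \<le> s \<and> s \<le> t \<and> B \<in> sets borel} \<subseteq> Pow (paths)"
  by auto

lemma measurable_coord_past: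
  assumes "0 \<le> s" "s \<le> t"
  shows "(\<lambda>w. w s) \<in> borel_measurable (path_past t)"
proof (rule measurableI)
  fix B :: "real set" assume B: "B \<in> sets borel"
  show "(\<lambda>w. w s) -` B \<inter> space (path_past t) \<in> sets (path_past t)"
    unfolding space_path_past unfolding path_past_def sets_measure_of[OF path_past_generator_subset]
    by (rule sigma_sets.Basic) (use assms B in blast)
qed simp

text \<open>\<open>freeze t w\<close> is built from the values of \<open>w\<close> on [0,t] alone;
  Galmarino's test rests on this measurability.\<close>

lemma measurable_freeze_past: "0 \<le> t \<Longrightarrow> freeze t \<in> path_past t \<rightarrow>\<^sub>M path_space"
proof (rule measurable_path_spaceI)
  fix s :: real assume t: "0 \<le> t" "0 \<le> s"
  have "(\<lambda>w. w (min s t) + max 0 (s - t)) \<in> borel_measurable (path_past t)"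
    by (intro borel_measurable_add measurable_coord_past) (use t in auto)
  then show "(\<lambda>w. freeze t w s) \<in> borel_measurable (path_past t)"
    using t by (simp add: freeze_def)
qed (simp add: freeze_in_space)

lemma sets_path_past_le: "sets (path_past t) \<subseteq> sets path_space"
  unfolding path_past_def sets_measure_of[OF path_past_generator_subset]
  by (rule sets.sigma_sets_subset) (auto intro!: measurable_sets[OF measurable_coord])

lemma measurable_freeze: "0 \<le> t \<Longrightarrow> freeze t \<in> path_space \<rightarrow>\<^sub>M path_space"
  by (rule measurable_mono[of path_space "path_space" "path_past t" path_space, THEN subsetD])
     (auto simp: sets_path_past_le intro!: measurable_freeze_past)

text \<open>Induction over \<open>sigma_sets\<close>: coordinate events up to t cannot separate the
  two paths, and complements and countable unions inherit this.\<close>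

lemma path_past_agree:
  assumes "E \<in> sets (path_past t)" "w \<in> paths" "v \<in> paths"
    and agree: "\<And>s. 0 \<le> s \<Longrightarrow> s \<le> t \<Longrightarrow> w s = v s"
  shows "w \<in> E \<longleftrightarrow> v \<in> E"
proof -
  have "E \<in> sigma_sets (paths) {(\<lambda>w. w s) -` B \<inter> paths | s B. 0 \<le> s \<and> s \<le> t \<and> B \<in> sets borel}"
    using assms(1) unfolding path_past_def sets_measure_of[OF path_past_generator_subset] .
  then show ?thesis
    by induction (use assms(2,3) agree in auto)
qed

text \<open>Galmarino's test.\<close>

lemma path_pastI:
  assumes E: "E \<in> sets path_space" and t: "0 \<le> t"
    and agree: "\<And>w v. \<lbrakk>w \<in> E; v \<in> paths; \<And>s. 0 \<le> s \<Longrightarrow> s \<le> t \<Longrightarrow> w s = v s\<rbrakk> \<Longrightarrow> v \<in> E"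
  shows "E \<in> sets (path_past t)"
proof -
  \<comment> \<open>Invariance under agreement up to t makes \<open>E\<close> its own preimage under
    freezing, and that preimage lies in the past of t.\<close>
  have "freeze t -` E \<inter> space (path_past t) = E"
  proof (intro set_eqI iffI)
    fix w assume "w \<in> freeze t -` E \<inter> space (path_past t)"
    then show "w \<in> E" using agree[of "freeze t w" w] by (auto simp: freeze_eq)
  next
    fix w assume w: "w \<in> E"
    then have "w \<in> paths" using sets.sets_into_space[OF E] by auto
    then show "w \<in> freeze t -` E \<inter> space (path_past t)"
      using agree[OF w, of "freeze t w"] t by (auto simp: freeze_eq freeze_in_space)
  qed
  then show ?thesis
    using measurable_sets[OF measurable_freeze_past[OF t] E] by simp
qed

text \<open>An intersection of sigma-algebras is already one, so \<open>sigma\<close> in the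
  definition adds no sets.\<close>

lemma sets_path_filtration: "sets (path_filtration t) = (\<Inter>s\<in>{t<..}. sets (path_past s))"
proof -
  have sub: "(\<Inter>s\<in>{t<..}. sets (path_past s)) \<subseteq> Pow (paths)"
    using sets.space_closed[of "path_past (t + 1)"] by force
  have "sigma_algebra (paths) (\<Inter>s\<in>{t<..}. sets (path_past s))"
  proof (intro sigma_algebra_iff2[THEN iffD2] conjI ballI allI impI sub)
    fix A assume A: "A \<in> (\<Inter>s\<in>{t<..}. sets (path_past s))"
    have "space (path_past s) - A \<in> sets (path_past s)" if "s > t" for s
      using A that by (intro sets.compl_sets) auto
    then show "paths - A \<in> (\<Inter>s\<in>{t<..}. sets (path_past s))" by simp
  next
    fix A :: "nat \<Rightarrow> _" assume A: "range A \<subseteq> (\<Inter>s\<in>{t<..}. sets (path_past s))"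
    have "\<Union> (range A) \<in> sets (path_past s)" if "s > t" for s
      using A that by (intro sets.countable_UN) auto
    then show "\<Union> (range A) \<in> (\<Inter>s\<in>{t<..}. sets (path_past s))" by simp
  qed auto
  then show ?thesis
    unfolding path_filtration_def by (rule sigma_algebra.sets_measure_of_eq)
qed

lemma space_path_filtration [simp]: "space (path_filtration t) = paths"
  unfolding path_filtration_def by (auto simp: space_measure_of_conv)

lemma sets_path_past_mono: "s \<le> t \<Longrightarrow> sets (path_past s) \<subseteq> sets (path_past t)"
  unfolding path_past_def sets_measure_of[OF path_past_generator_subset]
  by (rule sigma_sets_mono') (use order_trans in blast)

text \<open>By monotonicity every tail of the intersection equals the whole, and for s > t a
  suitable tail involves only events from the past of s.\<close>

lemma path_filtrationI:
  assumes "t \<ge> 0" "\<And>r. r > t \<Longrightarrow> E r \<in> sets (path_past r)" "E0 = (\<Inter>n. E (t + 1 / real (Suc n)))"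
    and mono: "\<And>r s. t < r \<Longrightarrow> r \<le> s \<Longrightarrow> E r \<subseteq> E s"
  shows "E0 \<in> sets (path_filtration t)"
  unfolding sets_path_filtration
proof (rule INT_I)
  fix s assume s: "s \<in> {t<..}"
  then obtain m :: nat where m: "1 / real (Suc m) < s - t"
    using reals_Archimedean[of "s - t"] by (auto simp: inverse_eq_divide)
  have "E0 = (\<Inter>n\<in>{m..}. E (t + 1 / real (Suc n)))" unfolding assms(3)
  proof (intro antisym INT_greatest)
    fix n :: nat
    have "E (t + 1 / real (Suc (max n m))) \<subseteq> E (t + 1 / real (Suc n))"
      by (rule mono) (auto simp: field_simps)
    then show "(\<Inter>n\<in>{m..}. E (t + 1 / real (Suc n))) \<subseteq> E (t + 1 / real (Suc n))"
      by (meson INF_lower2 atLeast_iff max.cobounded2)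
  qed auto
  also have "\<dots> \<in> sets (path_past s)"
  proof (intro sets.countable_INT')
    show "(\<lambda>n. E (t + 1 / real (Suc n))) ` {m..} \<subseteq> sets (path_past s)"
    proof safe
      fix n assume "m \<le> n"
      then have "t + 1 / real (Suc n) \<le> s"
        using m frac_le[of 1 1 "real (Suc m)" "real (Suc n)"] by auto
      then show "E (t + 1 / real (Suc n)) \<in> sets (path_past s)"
        using assms(2)[of "t + 1 / real (Suc n)"] sets_path_past_mono by auto
    qed
  qed auto
  finally show "E0 \<in> sets (path_past s)" .
qed

text \<open>Right-continuity enters here: {T <= t} is the decreasing limit of the events {T < t +
  1/(n+1)}, so the strict events in the raw past suffice.\<close>

lemma le_in_path_filtration:
  assumes A: "A \<subseteq> paths" and pos: "\<And>w. w \<in> A \<Longrightarrow> 0 \<le> (T w :: real)"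
    and past: "\<And>r. 0 < r \<Longrightarrow> {w \<in> A. T w < r} \<in> sets (path_past r)"
  shows "{w \<in> A. T w \<le> t} \<in> sets (path_filtration t)"
proof (cases "t < 0")
  case True
  have "{w \<in> A. T w \<le> t} = {}" using pos True by force
  then show ?thesis by (simp only: sets.empty_sets)
next
  case False
  show ?thesis
  proof (rule path_filtrationI[where E="\<lambda>r. {w \<in> A. T w < r}"])
    show "{w \<in> A. T w \<le> t} = (\<Inter>n. {w \<in> A. T w < t + 1 / real (Suc n)})"
    proof (intro set_eqI iffI)
      fix w assume "w \<in> (\<Inter>n. {w \<in> A. T w < t + 1 / real (Suc n)})"
      then have w: "w \<in> A" "\<And>n. T w < t + 1 / real (Suc n)" by auto
      have "T w \<le> t"
      proof (rule ccontr)
        assume "\<not> T w \<le> t"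
        then obtain m :: nat where m: "1 / real (Suc m) < T w - t"
          using reals_Archimedean[of "T w - t"] by (auto simp: inverse_eq_divide)
        with w(2)[of m] show False by simp
      qed
      with w show "w \<in> {w \<in> A. T w \<le> t}" by auto
    qed (auto intro: add_strict_increasing2 le_less_trans)
  qed (use False past in auto)
qed

text \<open>Galmarino's test for optional times: thanks to right-continuity only the strict events
  \<open>T w < t\<close> have to be determined by the path up to t.\<close>

lemma stopping_timeI_agree:
  assumes T: "T \<in> borel_measurable path_space" and pos: "\<And>w. w \<in> paths \<Longrightarrow> 0 \<le> T w"
    and agree: "\<And>w v t. \<lbrakk>w \<in> paths; v \<in> paths; \<And>s. 0 \<le> s \<Longrightarrow> s \<le> t \<Longrightarrow> w s = v s; T w < t\<rbrakk>
      \<Longrightarrow> T v < t"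
  shows "stopping_time path_filtration T"
proof
  fix t :: real
  have "{w \<in> paths. T w < r} \<in> sets (path_past r)" if "0 < r" for r
    using that agree by (intro path_pastI) (use T in measurable, auto)
  then have "{w \<in> paths. T w \<le> t} \<in> sets (path_filtration t)"
    by (intro le_in_path_filtration pos) auto
  then show "Measurable.pred (path_filtration t) (\<lambda>w. T w \<le> t)"
    unfolding pred_def by (simp only: space_path_filtration)
qed

abbreviation path_pre_sigma :: "((real \<Rightarrow> real) \<Rightarrow> real) \<Rightarrow> (real \<Rightarrow> real) measure" where
  "path_pre_sigma \<equiv> filtration.pre_sigma (paths) path_filtration"

lemma measurable_stopping:
  assumes "stopping_time path_filtration T"
  shows "T \<in> borel_measurable path_space"
proof (rule measurable_stopping_time[OF assms])
  fix t :: real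
  show "sets (path_filtration t) \<subseteq> sets path_space"
    using sets_path_past_le[of "t + 1"] by (auto simp: sets_path_filtration)
qed simp

text \<open>The gap \<open>r < t\<close> is the price of right-continuity: an event of the
  filtration at r is known to lie only in the raw pasts of later times.\<close>

lemma stopping_le_past:
  assumes "stopping_time path_filtration T" "A \<in> sets (path_pre_sigma T)" "r < t"
  shows "{w \<in> A. T w \<le> r} \<in> sets (path_past t)"
  using filtration.sets_pre_sigmaD[OF filtration_path_filtration assms(1,2), of r] assms(3)
  by (auto simp: sets_path_filtration)

lemma space_in_pre_sigma: "paths \<in> sets (path_pre_sigma T)"
  using sets.top[of "path_pre_sigma T"]
  by (simp add: filtration.space_pre_sigma[OF filtration_path_filtration])

text \<open>A converse to Galmarino's test: for r < t the events that compare \<open>T\<close> with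
  r lie in the raw past of t, which cannot separate \<open>w\<close> from \<open>v\<close>. The
  strict inequality \<open>T w < t\<close> again pays for right-continuity.\<close>

lemma pre_sigma_agree:
  assumes "stopping_time path_filtration T" "A \<in> sets (path_pre_sigma T)"
    and "v \<in> paths" "\<And>s. 0 \<le> s \<Longrightarrow> s \<le> t \<Longrightarrow> w s = v s"
    and "w \<in> A" "T w < t"
  shows "v \<in> A" "T v = T w"
proof -
  have w: "w \<in> paths"
    using assms(2,5) sets.sets_into_space filtration.space_pre_sigma[OF filtration_path_filtration] by blast
  note agree = path_past_agree[OF stopping_le_past[OF assms(1)] w assms(3,4), of _ _ t]
  have T: "T w \<le> r \<longleftrightarrow> T v \<le> r" if "r < t" for r
    using agree[OF space_in_pre_sigma that] w assms(3) by auto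
  \<comment> \<open>The level \<open>T w\<close> gives \<open>T v \<le> T w\<close>; this puts
    \<open>T v\<close> below t, so it may serve as a level for the reverse inequality.\<close>
  show "T v = T w" using T[of "T w"] T[of "T v"] assms(6) by auto
  show "v \<in> A" using agree[OF assms(2,6)] assms(5) by auto
qed

lemma sets_pre_sigma_le:
  assumes "stopping_time path_filtration T"
  shows "sets (path_pre_sigma T) \<subseteq> sets path_space"
proof
  fix A assume A: "A \<in> sets (path_pre_sigma T)"
  have "A = (\<Union>n::nat. {w \<in> A. T w \<le> real n})"
    using real_arch_simple by auto
  also have "\<dots> \<in> sets path_space"
  proof (rule sets.countable_UN)
    show "range (\<lambda>n::nat. {w \<in> A. T w \<le> real n}) \<subseteq> sets path_space"
      using stopping_le_past[OF assms A less_add_one] sets_path_past_le by auto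
  qed
  finally show "A \<in> sets path_space" .
qed

text \<open>Agreement up to a time beyond \<open>T\<close> also fixes the value of \<open>T\<close>,
  so the events \<open>{w \<in> A. T w < r}\<close> pass Galmarino's test.\<close>

lemma pre_sigmaI_agree:
  assumes T: "stopping_time path_filtration T" and A: "A \<in> sets path_space"
    and pos: "\<And>w. w \<in> paths \<Longrightarrow> 0 \<le> T w"
    and agree: "\<And>w v t. \<lbrakk>w \<in> A; v \<in> paths; \<And>s. 0 \<le> s \<Longrightarrow> s \<le> t \<Longrightarrow> w s = v s; T w < t\<rbrakk>
      \<Longrightarrow> v \<in> A"
  shows "A \<in> sets (path_pre_sigma T)"
proof (rule filtration.sets_pre_sigmaI[OF filtration_path_filtration T])
  fix t
  have Asp: "A \<subseteq> paths" using A by (rule sets.sets_into_space)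
  note [measurable] = A measurable_stopping[OF T]
  have "{w \<in> A. T w < r} \<in> sets (path_past r)" if r: "0 < r" for r
  proof (rule path_pastI)
    have "{w \<in> A. T w < r} = A \<inter> {w \<in> paths. T w < r}" using Asp by auto
    then show "{w \<in> A. T w < r} \<in> sets path_space" by simp
  next
    fix w v assume h: "w \<in> {w \<in> A. T w < r}" "v \<in> paths" "\<And>s. 0 \<le> s \<Longrightarrow> s \<le> r \<Longrightarrow> w s = v s"
    then have "T v = T w"
      using pre_sigma_agree(2)[OF T space_in_pre_sigma h(2,3), of r] Asp by auto
    with h agree[of w v r] show "v \<in> {w \<in> A. T w < r}" by auto
  qed (use r in simp)
  then show "{w \<in> A. T w \<le> t} \<in> sets (path_filtration t)"
    by (intro le_in_path_filtration[of A T]) (use Asp pos in auto)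
qed

section \<open>The strong Markov property for bounded functionals\<close>

locale strong_markov_family =
  fixes P :: "real \<Rightarrow> (real \<Rightarrow> real) measure"
  assumes laws: "strong_markov_laws P"
begin

lemma kernel: "P \<in> restrict_space borel {0..} \<rightarrow>\<^sub>M prob_algebra path_space"
  using laws by (simp add: strong_markov_laws_def)

lemma kernel': "P \<in> restrict_space borel {0..} \<rightarrow>\<^sub>M subprob_algebra path_space"
  by (rule measurable_prob_algebraD[OF kernel])

lemma prob_P: "0 \<le> x \<Longrightarrow> prob_space (P x)"
  using measurable_space[OF kernel, of x] by (auto simp: space_restrict_space space_prob_algebra)

lemma sets_P [simp]: "0 \<le> x \<Longrightarrow> sets (P x) = sets path_space"
  using measurable_space[OF kernel, of x] by (auto simp: space_restrict_space space_prob_algebra)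

lemma space_P [simp]: "0 \<le> x \<Longrightarrow> space (P x) = paths"
  using sets_eq_imp_space_eq[OF sets_P] .

lemma measurable_P [simp]: "0 \<le> x \<Longrightarrow> measurable (P x) N = measurable path_space N"
  by (rule measurable_cong_sets) auto

lemma AE_start: "0 \<le> x \<Longrightarrow> AE w in P x. w 0 = x"
  using laws by (simp add: strong_markov_laws_def)

lemma strong_markov:
  assumes "0 \<le> x" "stopping_time path_filtration T" "\<And>w. w \<in> paths \<Longrightarrow> 0 \<le> T w"
    "A \<in> sets (path_pre_sigma T)" "B \<in> sets path_space"
  shows "measure (P x) {w \<in> A. shift_path (T w) w \<in> B} = (LINT w:A|P x. measure (P (w (T w))) B)"
  using laws assms by (simp add: strong_markov_laws_def)

lemma measurable_kernel_comp:
  assumes "f \<in> borel_measurable N" "\<And>x. x \<in> space N \<Longrightarrow> 0 \<le> f x"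
  shows "(\<lambda>x. P (f x)) \<in> N \<rightarrow>\<^sub>M subprob_algebra path_space"
  by (rule measurable_compose[OF measurable_restrict_space2 kernel']) (use assms in auto)

lemma measurable_kernel_integral:
  fixes h :: "(real \<Rightarrow> real) \<Rightarrow> real"
  assumes "f \<in> borel_measurable N" "\<And>x. x \<in> space N \<Longrightarrow> 0 \<le> f x" "h \<in> borel_measurable path_space"
  shows "(\<lambda>x. LINT w|P (f x). h w) \<in> borel_measurable N"
  by (rule measurable_compose[OF measurable_kernel_comp integral_measurable_subprob_algebra])
     (use assms in auto)

lemma integrable_bounded:
  fixes h :: "(real \<Rightarrow> real) \<Rightarrow> real"
  assumes "0 \<le> x" "h \<in> borel_measurable path_space" "\<And>w. w \<in> paths \<Longrightarrow> \<bar>h w\<bar> \<le> C"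
  shows "integrable (P x) h"
proof -
  interpret prob_space "P x" using assms(1) by (rule prob_P)
  show ?thesis by (rule integrable_const_bound[of _ C]) (use assms in auto)
qed

lemma abs_integral_le:
  fixes h :: "(real \<Rightarrow> real) \<Rightarrow> real"
  assumes "0 \<le> x" "h \<in> borel_measurable path_space" "\<And>w. w \<in> paths \<Longrightarrow> \<bar>h w\<bar> \<le> C"
  shows "\<bar>LINT w|P x. h w\<bar> \<le> C"
proof -
  interpret prob_space "P x" using assms(1) by (rule prob_P)
  have "\<bar>LINT w|P x. h w\<bar> \<le> (LINT w|P x. \<bar>h w\<bar>)" by (rule integral_abs_bound)
  also have "\<dots> \<le> (LINT w|P x. C)"
    by (rule integral_mono) (use assms integrable_bounded[OF assms] in auto)
  finally show ?thesis by (simp add: prob_space)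
qed

text \<open>The set form of the property says that two finite measures coincide: the law of the
  shifted path on \<open>A\<close> and the mixture of the laws \<open>P (w (T w))\<close> over
  \<open>A\<close>. Integrating \<open>h\<close> against both gives the claim.
  \<open>density\<close> with an indicator restricts \<open>P x\<close> to \<open>A\<close>, and
  nonnegativity lets the computation run in \<open>nn_integral\<close>.\<close>

lemma strong_markov_nonneg:
  fixes h :: "(real \<Rightarrow> real) \<Rightarrow> real"
  assumes x: "0 \<le> x" and T: "stopping_time path_filtration T"
    and pos: "\<And>w. w \<in> paths \<Longrightarrow> 0 \<le> T w"
    and A: "A \<in> sets (path_pre_sigma T)"
    and h[measurable]: "h \<in> borel_measurable path_space"
    and bd: "\<And>w. w \<in> paths \<Longrightarrow> 0 \<le> h w \<and> h w \<le> C"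
  shows "(LINT w:A|P x. h (shift_path (T w) w)) = (LINT w:A|P x. (LINT v|P (w (T w)). h v))"
proof -
  interpret P: prob_space "P x" using x by (rule prob_P)
  have Am: "A \<in> sets path_space" using sets_pre_sigma_le[OF T] A by auto
  then have Asp: "A \<subseteq> paths" by (rule sets.sets_into_space)
  note [measurable] = Am measurable_stopping[OF T]
  have sh[measurable]: "(\<lambda>w. shift_path (T w) w) \<in> path_space \<rightarrow>\<^sub>M path_space"
    by (rule measurable_shift) (use pos in auto)
  have ev[measurable]: "(\<lambda>w. w (T w)) \<in> borel_measurable path_space"
    by (rule measurable_eval[where g="\<lambda>w. w"]) (use pos in auto)
  have evpos: "0 \<le> w (T w)" if "w \<in> paths" for w
    using that pos path_spaceD(2) by auto
  have K[measurable]: "(\<lambda>w. P (w (T w))) \<in> path_space \<rightarrow>\<^sub>M subprob_algebra path_space"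
    by (rule measurable_kernel_comp) (use evpos in auto)
  have K': "(\<lambda>w. P (w (T w))) \<in> density (P x) (indicator A) \<rightarrow>\<^sub>M subprob_algebra path_space"
    using K x by simp
  have msp[simp]: "measurable (density (P x) (indicator A)) N = measurable path_space N" for N
    by (rule measurable_cong_sets) (use x in auto)
  have ne: "paths \<noteq> {}" using P.not_empty x by simp
  have C0: "0 \<le> C" using ne bd by (meson ex_in_conv order_trans)
  have eq: "distr (density (P x) (indicator A)) path_space (\<lambda>w. shift_path (T w) w)
      = density (P x) (indicator A) \<bind> (\<lambda>w. P (w (T w)))" (is "?L = ?R")
  proof (rule measure_eqI)
    show "sets ?L = sets ?R"
      using sets_bind[of "density (P x) (indicator A)" "\<lambda>w. P (w (T w))" path_space] evpos ne x by auto
  next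
    fix B assume "B \<in> sets ?L"
    then have B[measurable]: "B \<in> sets path_space" by simp
    have m[measurable]: "(\<lambda>w. measure (P (w (T w))) B) \<in> borel_measurable path_space"
      by (rule measurable_compose[OF K]) simp
    have bdm: "\<bar>measure (P (w (T w))) B\<bar> \<le> 1" if "w \<in> paths" for w
      using prob_space.prob_le_1[OF prob_P[OF evpos[OF that]]] by simp
    have "emeasure ?L B = emeasure (P x) {w \<in> A. shift_path (T w) w \<in> B}"
    proof -
      define S where "S = (\<lambda>w. shift_path (T w) w) -` B \<inter> paths"
      have S[measurable]: "S \<in> sets path_space"
        unfolding S_def using measurable_sets[OF sh B] .
      have "emeasure ?L B = emeasure (density (P x) (indicator A)) S"
        by (subst emeasure_distr) (use x in \<open>auto simp: S_def\<close>)
      also have "\<dots> = (\<integral>\<^sup>+w. indicator (A \<inter> S) w \<partial>P x)"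
        by (subst emeasure_density) (use x in \<open>auto simp: indicator_inter_arith simp del: nn_integral_indicator intro!: nn_integral_cong\<close>)
      also have "\<dots> = emeasure (P x) (A \<inter> S)"
        using x by (intro nn_integral_indicator) simp
      also have "A \<inter> S = {w \<in> A. shift_path (T w) w \<in> B}"
        using Asp by (auto simp: S_def)
      finally show ?thesis .
    qed
    also have "\<dots> = ennreal (LINT w:A|P x. measure (P (w (T w))) B)"
      using strong_markov[OF x T pos A B] by (simp add: P.emeasure_eq_measure)
    also have "\<dots> = (\<integral>\<^sup>+w. indicator A w * ennreal (measure (P (w (T w))) B) \<partial>P x)"
      unfolding set_lebesgue_integral_def
      by (subst nn_integral_eq_integral[symmetric])
         (use x bdm in \<open>auto intro!: nn_integral_cong integrable_bounded[of x _ 1] split: split_indicator\<close>)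
    also have "\<dots> = (\<integral>\<^sup>+w. indicator A w * emeasure (P (w (T w))) B \<partial>P x)"
    proof (intro nn_integral_cong)
      fix w assume "w \<in> space (P x)"
      then interpret Q: prob_space "P (w (T w))" using prob_P[OF evpos] x by auto
      show "indicator A w * ennreal (measure (P (w (T w))) B) = indicator A w * emeasure (P (w (T w))) B"
        by (simp add: Q.emeasure_eq_measure)
    qed
    also have "\<dots> = (\<integral>\<^sup>+w. emeasure (P (w (T w))) B \<partial>density (P x) (indicator A))"
      by (subst nn_integral_density) (use x in auto)
    also have "\<dots> = emeasure ?R B"
      by (subst emeasure_bind[OF _ K']) (use x ne in auto)
    finally show "emeasure ?L B = emeasure ?R B" .
  qed
  have h0: "0 \<le> (LINT v|P (w (T w)). h v)" if "w \<in> paths" for w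
    using evpos[OF that] bd by (intro integral_nonneg_AE AE_I2) auto
  have hC: "(LINT v|P (w (T w)). h v) \<le> C" if "w \<in> paths" for w
    using abs_integral_le[of "w (T w)" h C] evpos[OF that] bd by force
  have mI[measurable]: "(\<lambda>w. LINT v|P (w (T w)). h v) \<in> borel_measurable path_space"
    by (rule measurable_kernel_integral) (use evpos in auto)
  have shs: "shift_path (T w) w \<in> paths" if "w \<in> paths" for w
    using measurable_space[OF sh that] .
  have "ennreal (LINT w:A|P x. h (shift_path (T w) w)) = (\<integral>\<^sup>+w. indicator A w * ennreal (h (shift_path (T w) w)) \<partial>P x)"
      unfolding set_lebesgue_integral_def
      by (subst nn_integral_eq_integral[symmetric])
         (use x bd shs C0 in \<open>auto intro!: nn_integral_cong integrable_bounded[of x _ C] split: split_indicator\<close>)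
  also have "\<dots> = (\<integral>\<^sup>+v. ennreal (h v) \<partial>?L)"
    by (subst nn_integral_distr) (use x in \<open>auto simp: nn_integral_density\<close>)
  also have "\<dots> = (\<integral>\<^sup>+w. (\<integral>\<^sup>+v. ennreal (h v) \<partial>P (w (T w))) \<partial>density (P x) (indicator A))"
    unfolding eq by (rule nn_integral_bind[OF _ K']) auto
  also have "\<dots> = (\<integral>\<^sup>+w. indicator A w * (\<integral>\<^sup>+v. ennreal (h v) \<partial>P (w (T w))) \<partial>P x)"
    by (subst nn_integral_density) (use x in \<open>auto intro!: measurable_compose[OF K nn_integral_measurable_subprob_algebra]\<close>)
  also have "\<dots> = (\<integral>\<^sup>+w. indicator A w * ennreal (LINT v|P (w (T w)). h v) \<partial>P x)"
  proof (intro nn_integral_cong)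
    fix w assume w: "w \<in> space (P x)"
    have "(\<integral>\<^sup>+v. ennreal (h v) \<partial>P (w (T w))) = ennreal (LINT v|P (w (T w)). h v)"
      by (rule nn_integral_eq_integral) (use w x bd evpos in \<open>auto intro!: integrable_bounded[of _ _ C]\<close>)
    then show "indicator A w * (\<integral>\<^sup>+v. ennreal (h v) \<partial>P (w (T w))) = indicator A w * ennreal (LINT v|P (w (T w)). h v)"
      by simp
  qed
  also have "\<dots> = ennreal (LINT w:A|P x. (LINT v|P (w (T w)). h v))"
      unfolding set_lebesgue_integral_def
      by (subst nn_integral_eq_integral[symmetric])
         (use x h0 hC bd shs in \<open>auto intro!: nn_integral_cong integrable_bounded[of x _ "max C 0"] split: split_indicator simp: le_max_iff_disj\<close>)
  finally show ?thesis
    by (subst (asm) ennreal_inj)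
       (use x bd shs h0 in \<open>auto simp: set_lebesgue_integral_def intro!: integral_nonneg_AE AE_I2 split: split_indicator\<close>)
qed

text \<open>Adding the bound \<open>C\<close> makes \<open>h\<close> nonnegative; the constant
  cancels because every \<open>P y\<close> with y \<ge> 0 has mass one.\<close>

lemma strong_markov_integral:
  fixes h :: "(real \<Rightarrow> real) \<Rightarrow> real"
  assumes x: "0 \<le> x" and T: "stopping_time path_filtration T"
    and pos: "\<And>w. w \<in> paths \<Longrightarrow> 0 \<le> T w"
    and A: "A \<in> sets (path_pre_sigma T)"
    and h[measurable]: "h \<in> borel_measurable path_space"
    and bd: "\<And>w. w \<in> paths \<Longrightarrow> \<bar>h w\<bar> \<le> C"
  shows "(LINT w:A|P x. h (shift_path (T w) w)) = (LINT w:A|P x. (LINT v|P (w (T w)). h v))"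
proof -
  interpret P: prob_space "P x" using x by (rule prob_P)
  have Am[measurable]: "A \<in> sets path_space" using sets_pre_sigma_le[OF T] A by auto
  note [measurable] = measurable_stopping[OF T]
  have sh[measurable]: "(\<lambda>w. shift_path (T w) w) \<in> path_space \<rightarrow>\<^sub>M path_space"
    by (rule measurable_shift) (use pos in auto)
  have ev[measurable]: "(\<lambda>w. w (T w)) \<in> borel_measurable path_space"
    by (rule measurable_eval[where g="\<lambda>w. w"]) (use pos in auto)
  have evpos: "0 \<le> w (T w)" if "w \<in> paths" for w
    using that pos path_spaceD(2) by auto
  have mI[measurable]: "(\<lambda>w. LINT v|P (w (T w)). h v) \<in> borel_measurable path_space"
    by (rule measurable_kernel_integral) (use evpos in auto)
  have shs: "shift_path (T w) w \<in> paths" if "w \<in> paths" for w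
    using measurable_space[OF sh that] .
  have i1: "set_integrable (P x) A (\<lambda>w. h (shift_path (T w) w))"
    unfolding set_integrable_def
  proof (rule integrable_bounded[of _ _ "\<bar>C\<bar>"])
    show "\<bar>indicator A w *\<^sub>R h (shift_path (T w) w)\<bar> \<le> \<bar>C\<bar>" if "w \<in> paths" for w
      using bd[OF shs[OF that]] by (auto split: split_indicator)
  qed (use x in auto)
  have i2: "set_integrable (P x) A (\<lambda>w. LINT v|P (w (T w)). h v)"
    unfolding set_integrable_def
  proof (rule integrable_bounded[of _ _ "\<bar>C\<bar>"])
    show "\<bar>indicator A w *\<^sub>R (LINT v|P (w (T w)). h v)\<bar> \<le> \<bar>C\<bar>" if "w \<in> paths" for w
      using abs_integral_le[OF evpos[OF that] h bd] by (auto split: split_indicator)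
  qed (use x in auto)
  have i3: "set_integrable (P x) A (\<lambda>w. C)"
    unfolding set_integrable_def by (rule integrable_bounded[of _ _ "\<bar>C\<bar>"]) (use x in \<open>auto split: split_indicator\<close>)
  have "(LINT w:A|P x. h (shift_path (T w) w) + C) = (LINT w:A|P x. (LINT v|P (w (T w)). h v + C))"
    using strong_markov_nonneg[OF x T pos A, of "\<lambda>v. h v + C" "2 * C"] bd by fastforce
  also have "\<dots> = (LINT w:A|P x. (LINT v|P (w (T w)). h v) + C)"
    unfolding set_lebesgue_integral_def
  proof (rule Bochner_Integration.integral_cong[OF refl])
    fix w assume w: "w \<in> space (P x)"
    interpret Q: prob_space "P (w (T w))" using prob_P[OF evpos] w x by auto
    have "integrable (P (w (T w))) h" using integrable_bounded[OF evpos h bd] w x by auto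
    then have "(LINT v|P (w (T w)). h v + C) = (LINT v|P (w (T w)). h v) + C"
      using Q.prob_space by (simp add: Bochner_Integration.integral_add)
    then show "indicat_real A w *\<^sub>R (LINT v|P (w (T w)). h v + C) =
           indicat_real A w *\<^sub>R ((LINT v|P (w (T w)). h v) + C)" by simp
  qed
  finally show ?thesis
    using set_integral_add(2)[OF i1 i3] set_integral_add(2)[OF i2 i3] by simp
qed

end

subsection \<open>The time change\<close>

definition clock :: "(real \<Rightarrow> real) \<Rightarrow> real \<Rightarrow> real" where
  "clock w t = 4 * integral {0..t} (\<lambda>u. (w u)\<^sup>2)"

definition clock_unbounded :: "(real \<Rightarrow> real) \<Rightarrow> bool" where
  "clock_unbounded w \<longleftrightarrow> (\<forall>u. \<exists>t\<ge>0. u < clock w t)"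

text \<open>The right-continuous inverse: the strict inequality selects the right end of a flat
  stretch of the clock.\<close>

definition inverse_clock :: "(real \<Rightarrow> real) \<Rightarrow> real \<Rightarrow> real" where
  "inverse_clock w u = Inf {t. 0 \<le> t \<and> u < clock w t}"

definition time_change :: "(real \<Rightarrow> real) \<Rightarrow> (real \<Rightarrow> real)" where
  "time_change w = (\<lambda>u\<in>{0..}. (w (inverse_clock w u))\<^sup>2)"

lemma clock_0 [simp]: "clock w 0 = 0"
  by (simp add: clock_def)

lemma clock_cong: "(\<And>s. 0 \<le> s \<Longrightarrow> s \<le> t \<Longrightarrow> w s = v s) \<Longrightarrow> clock w t = clock v t"
  unfolding clock_def by (intro arg_cong[where f="(*) 4"] integral_cong) auto

lemma clock_shift:
  assumes w: "w \<in> paths" and s: "0 \<le> s" "0 \<le> t"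
  shows "clock w (s + t) = clock w s + clock (shift_path s w) t"
proof -
  have c: "continuous_on {0..s + t} (\<lambda>u. (w u)\<^sup>2)"
    by (intro continuous_intros continuous_on_subset[OF path_spaceD(1)[OF w]]) auto
  have "integral {0..s} (\<lambda>u. (w u)\<^sup>2) + integral {s..s + t} (\<lambda>u. (w u)\<^sup>2) = integral {0..s + t} (\<lambda>u. (w u)\<^sup>2)"
    by (rule Henstock_Kurzweil_Integration.integral_combine) (use s c in \<open>auto intro: integrable_continuous_interval\<close>)
  moreover have "integral {s..s + t} (\<lambda>u. (w u)\<^sup>2) = integral {0..t} (\<lambda>u. (w (u + s))\<^sup>2)"
    using integral_shift_Icc_real[of 0 t "\<lambda>u. (w u)\<^sup>2" s] by (simp add: add.commute o_def)
  moreover have "integral {0..t} (\<lambda>u. (w (u + s))\<^sup>2) = integral {0..t} (\<lambda>u. (shift_path s w u)\<^sup>2)"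
    by (rule integral_cong) (auto simp: shift_path_def add.commute)
  ultimately show ?thesis by (simp add: clock_def)
qed

lemma clock_nonneg: "0 \<le> clock w t"
proof -
  have "0 \<le> integral {0..t} (\<lambda>u. (w u)\<^sup>2)"
    \<comment> \<open>For an arbitrary function \<open>w\<close> the integral may be the default
      value 0, which is nonnegative too.\<close>
    by (cases "(\<lambda>u. (w u)\<^sup>2) integrable_on {0..t}")
       (auto intro: integral_nonneg simp: not_integrable_integral)
  then show ?thesis by (simp add: clock_def)
qed

context
  fixes w :: "real \<Rightarrow> real"
  assumes w: "w \<in> paths"
begin

lemma clock_mono: "0 \<le> s \<Longrightarrow> s \<le> t \<Longrightarrow> clock w s \<le> clock w t"
  using clock_shift[OF w, of s "t - s"] clock_nonneg[of "shift_path s w" "t - s"] by simp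

lemma clock_deriv:
  assumes "0 \<le> t" "t \<le> T"
  shows "(clock w has_real_derivative 4 * (w t)\<^sup>2) (at t within {0..T})"
proof -
  have "((\<lambda>t. integral {0..t} (\<lambda>u. (w u)\<^sup>2)) has_real_derivative (w t)\<^sup>2) (at t within {0..T})"
    by (rule integral_has_real_derivative)
       (use assms in \<open>auto intro!: continuous_intros continuous_on_subset[OF path_spaceD(1)[OF w]]\<close>)
  then show ?thesis unfolding clock_def [abs_def] by (intro DERIV_cmult)
qed

lemma clock_continuous_interval: "continuous_on {0..T} (clock w)"
  using clock_deriv by (intro DERIV_continuous_on) auto

lemma clock_surj:
  assumes "0 \<le> u" "u \<le> clock w T" "0 \<le> T"
  obtains t where "0 \<le> t" "t \<le> T" "clock w t = u"
  using IVT'[of "clock w" 0 u T] assms clock_continuous_interval by auto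

text \<open>The nonnegative continuous function \<open>(w u)\<^sup>2\<close> has integral 0 over
  [s,t], so it vanishes there.\<close>

lemma path_zero_of_clock_eq:
  assumes eq: "clock w s = clock w t" and st: "0 \<le> s" "s < t"  and r: "s \<le> r" "r \<le> t"
  shows "w r = 0"
proof -
  have c: "continuous_on (cbox s t) (\<lambda>u. (w u)\<^sup>2)"
    by (auto intro!: continuous_intros continuous_on_subset[OF path_spaceD(1)[OF w]] simp: cbox_interval) (use st in auto)
  have "integral {0..s} (\<lambda>u. (w u)\<^sup>2) + integral {s..t} (\<lambda>u. (w u)\<^sup>2) = integral {0..t} (\<lambda>u. (w u)\<^sup>2)"
    by (rule Henstock_Kurzweil_Integration.integral_combine)
       (use st in \<open>auto intro!: integrable_continuous_interval continuous_intros continuous_on_subset[OF path_spaceD(1)[OF w]]\<close>)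
  with eq have "integral {s..t} (\<lambda>u. (w u)\<^sup>2) = 0" by (simp add: clock_def)
  then have "((\<lambda>u. (w u)\<^sup>2) has_integral 0) (cbox s t)"
    using integrable_integral[OF integrable_continuous[OF c]] by simp
  then have "(w r)\<^sup>2 = 0"
    by (rule has_integral_0_cbox_imp_0[OF c, rotated]) (use st r in auto)
  then show ?thesis by simp
qed

context
  assumes ub: "clock_unbounded w"
begin

lemma inverse_clock_nonneg: "0 \<le> inverse_clock w u"
  unfolding inverse_clock_def
  by (rule cInf_greatest) (use ub in \<open>auto simp: clock_unbounded_def\<close>)

text \<open>The Galois connection between the clock and its inverse; measurability and stopping
  properties of the inverse are read off the clock through it.\<close>

lemma inverse_clock_less_iff:
  assumes "0 \<le> u" "0 \<le> t"
  shows "inverse_clock w u < t \<longleftrightarrow> u < clock w t"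
proof
  have bdd: "bdd_below {t. 0 \<le> t \<and> u < clock w t}" by (rule bdd_belowI[of _ 0]) auto
  {
    assume "inverse_clock w u < t"
    then obtain s where "0 \<le> s" "u < clock w s" "s < t"
      unfolding inverse_clock_def using ub bdd by (subst (asm) cInf_less_iff) (auto simp: clock_unbounded_def)
    then show "u < clock w t" using clock_mono[of s t] by auto
  next
    assume u: "u < clock w t"
    \<comment> \<open>A time at which the clock equals this midpoint lies strictly before t and
      already belongs to the set whose infimum is taken.\<close>
    define m where "m = (u + clock w t) / 2"
    obtain s where s: "0 \<le> s" "s \<le> t" "clock w s = m"
      by (rule clock_surj[of m t]) (use assms u in \<open>auto simp: m_def\<close>)
    then have "s < t" "u < clock w s" using u by (auto simp: m_def less_le)
    then show "inverse_clock w u < t"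
      unfolding inverse_clock_def using bdd s by (subst cInf_less_iff) auto
  }
qed

text \<open>The continuous clock attains u at some t; the Galois connection puts the inverse at or
  beyond t but does not let the clock exceed u there.\<close>

lemma clock_inverse_clock:
  assumes "0 \<le> u"
  shows "clock w (inverse_clock w u) = u"
proof -
  obtain T where T: "0 \<le> T" "u \<le> clock w T" using ub unfolding clock_unbounded_def by (meson less_imp_le)
  obtain t where t: "0 \<le> t" "clock w t = u" using clock_surj[OF assms T(2,1)] by auto
  have le: "clock w (inverse_clock w u) \<le> u"
    using inverse_clock_less_iff[OF assms inverse_clock_nonneg, of u] by auto
  have "t \<le> inverse_clock w u" using inverse_clock_less_iff[OF assms t(1)] t(2) by auto
  then show ?thesis using clock_mono[OF t(1), of "inverse_clock w u"] t le by auto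
qed

text \<open>The inverse may overshoot t, but only across a flat stretch of the clock, where the path
  is identically 0.\<close>

lemma path_inverse_clock_clock:
  assumes "0 \<le> t"
  shows "w (inverse_clock w (clock w t)) = w t"
proof -
  let ?s = "inverse_clock w (clock w t)"
  have "t \<le> ?s" using inverse_clock_less_iff[OF clock_nonneg assms, of w t] by auto
  moreover have "clock w t = clock w ?s" using clock_inverse_clock[OF clock_nonneg, of w t] by simp
  ultimately show ?thesis
    using path_zero_of_clock_eq[of t ?s t] path_zero_of_clock_eq[of t ?s ?s] assms
    by (cases "t = ?s") auto
qed

lemma time_change_clock: "0 \<le> t \<Longrightarrow> time_change w (clock w t) = (w t)\<^sup>2"
  by (simp add: time_change_def clock_nonneg path_inverse_clock_clock)

lemma time_change_0: "time_change w 0 = (w 0)\<^sup>2"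
  using time_change_clock[of 0] by simp

text \<open>The inverse clock may jump, so continuity does not come by composition. Instead,
  preimages of closed sets are images under the clock of compact sets of times: the clock acts as a
  quotient map.\<close>

lemma time_change_continuous_interval:
  assumes "0 \<le> T"
  shows "continuous_on {0..clock w T} (time_change w)"
proof -
  have "closed (time_change w -` B \<inter> {0..clock w T})" if B: "closed B" for B
  proof -
    have "time_change w -` B \<inter> {0..clock w T} = clock w ` ((\<lambda>t. (w t)\<^sup>2) -` B \<inter> {0..T})"
    proof (intro set_eqI iffI)
      fix u assume u: "u \<in> time_change w -` B \<inter> {0..clock w T}"
      then obtain t where t: "0 \<le> t" "t \<le> T" "clock w t = u" using clock_surj[of u T] assms by auto
      then show "u \<in> clock w ` ((\<lambda>t. (w t)\<^sup>2) -` B \<inter> {0..T})"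
        using u time_change_clock[OF t(1)] by auto
    next
      fix u assume "u \<in> clock w ` ((\<lambda>t. (w t)\<^sup>2) -` B \<inter> {0..T})"
      then show "u \<in> time_change w -` B \<inter> {0..clock w T}"
        using clock_mono clock_nonneg time_change_clock by auto
    qed
    moreover have "closed ((\<lambda>t. (w t)\<^sup>2) -` B \<inter> {0..T})"
    proof -
      have "continuous_on {0..T} (\<lambda>t. (w t)\<^sup>2)"
        by (intro continuous_intros continuous_on_subset[OF path_spaceD(1)[OF w]]) auto
      then show ?thesis using B by (simp add: continuous_on_closed_vimage)
    qed
    then have "compact ((\<lambda>t. (w t)\<^sup>2) -` B \<inter> {0..T})"
      using compact_Int_closed[of "{0..T}" "(\<lambda>t. (w t)\<^sup>2) -` B \<inter> {0..T}"] by (simp add: Int_commute inf.left_commute)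
    then have "compact (clock w ` ((\<lambda>t. (w t)\<^sup>2) -` B \<inter> {0..T}))"
      by (intro compact_continuous_image continuous_on_subset[OF clock_continuous_interval[of T]]) auto
    ultimately show ?thesis by (simp add: compact_imp_closed)
  qed
  then show ?thesis by (subst continuous_on_closed_vimage) auto
qed

lemma time_change_in_space: "time_change w \<in> paths"
proof -
  have "continuous_on {0..} (time_change w)"
  proof (unfold continuous_on_eq_continuous_within, intro ballI)
    fix u :: real assume u: "u \<in> {0..}"
    obtain T where T: "0 \<le> T" "u < clock w T" using ub by (auto simp: clock_unbounded_def)
    have "at u within {0..} = at u within {0..clock w T}"
      by (rule at_within_nhd[of _ "{..<clock w T}"]) (use T in auto)
    then show "continuous (at u within {0..}) (time_change w)"
      using time_change_continuous_interval[OF T(1)] u T by (auto simp: continuous_on_eq_continuous_within)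
  qed
  then show ?thesis by (auto simp: space_path_space time_change_def)
qed

lemma clock_unbounded_shift:
  assumes s: "0 \<le> s"
  shows "clock_unbounded (shift_path s w)"
  unfolding clock_unbounded_def
proof
  fix u
  obtain t where t: "0 \<le> t" "clock w s + u < clock w t" using ub unfolding clock_unbounded_def by blast
  have "u < clock (shift_path s w) t"
    using clock_mono[OF t(1), of "s + t"] clock_shift[OF w s t(1)] t(2) s by simp
  then show "\<exists>t\<ge>0. u < clock (shift_path s w) t" using t(1) by auto
qed

end

end

text \<open>Every u is a clock value of the shifted path, and there both sides are the square of
  \<open>w\<close> at the same time because the clock is additive. This matches restarts in the two
  time scales.\<close>

lemma time_change_shift:
  assumes w: "w \<in> paths" and ub: "clock_unbounded w" and s: "0 \<le> s"
  shows "time_change (shift_path s w) = shift_path (clock w s) (time_change w)"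
proof (rule path_eqI)
  note w' = shift_path_in_space[OF w s] and ub' = clock_unbounded_shift[OF w ub s]
  show "time_change (shift_path s w) \<in> paths" by (rule time_change_in_space[OF w' ub'])
  show "shift_path (clock w s) (time_change w) \<in> paths"
    by (rule shift_path_in_space[OF time_change_in_space[OF w ub] clock_nonneg])
  fix u :: real assume u: "0 \<le> u"
  define t where "t = inverse_clock (shift_path s w) u"
  have t: "0 \<le> t" "clock (shift_path s w) t = u"
    using inverse_clock_nonneg[OF w' ub'] clock_inverse_clock[OF w' ub' u] by (auto simp: t_def)
  have "time_change (shift_path s w) u = (w (s + t))\<^sup>2"
    using time_change_clock[OF w' ub' t(1)] t by (simp add: shift_path_def)
  also have "\<dots> = time_change w (clock w s + u)"
    using time_change_clock[OF w ub, of "s + t"] clock_shift[OF w s t(1)] t s by simp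
  finally show "time_change (shift_path s w) u = shift_path (clock w s) (time_change w) u"
    using u by (simp add: shift_path_def)
qed

text \<open>The changed path up to \<open>clock w t\<close> is a function of \<open>w\<close> up to
  t; this is how optional times of the changed path become optional times of
  \<open>w\<close>.\<close>

lemma time_change_agree:
  assumes w: "w \<in> paths" "clock_unbounded w" and v: "v \<in> paths" "clock_unbounded v"
    and agree: "\<And>s. 0 \<le> s \<Longrightarrow> s \<le> t \<Longrightarrow> w s = v s" and t: "0 \<le> t" and u: "0 \<le> u" "u \<le> clock w t"
  shows "time_change w u = time_change v u"
proof -
  obtain s where s: "0 \<le> s" "s \<le> t" "clock w s = u" using clock_surj[OF w(1) u t] by auto
  moreover have "clock v s = clock w s" by (rule clock_cong) (use agree s in auto)
  ultimately show ?thesis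
    using time_change_clock[OF w s(1)] time_change_clock[OF v s(1)] agree[of s] by simp
qed

lemma clock_unbounded_freeze:
  assumes w: "w \<in> paths" and t: "0 \<le> t"
  shows "clock_unbounded (freeze t w)"
  unfolding clock_unbounded_def
proof
  fix u :: real
  define z where "z = shift_path (t + 1) (freeze t w)"
  define s where "s = \<bar>u\<bar> + 1"
  have fz: "freeze t w \<in> paths" by (rule freeze_in_space[OF w t])
  have z: "z \<in> paths" unfolding z_def by (rule shift_path_in_space[OF fz]) (use t in auto)
  \<comment> \<open>From t + 1 on, the linear term of \<open>freeze\<close> contributes at least
    1.\<close>
  have "1 \<le> z r" if "0 \<le> r" for r
    using that t path_spaceD(2)[OF w, of t] by (simp add: z_def shift_path_def freeze_def min_def)
  then have *: "1 \<le> (z r)\<^sup>2" if "0 \<le> r" for r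
    using that by (simp add: one_le_power)
  have "integral {0..s} (\<lambda>_. 1) \<le> integral {0..s} (\<lambda>r. (z r)\<^sup>2)"
    by (rule integral_le)
       (auto intro!: * integrable_continuous_interval continuous_intros continuous_on_subset[OF path_spaceD(1)[OF z]])
  then have "u < clock z s" by (simp add: clock_def s_def)
  also have "clock z s \<le> clock (freeze t w) (t + 1 + s)"
    using clock_shift[OF fz, of "t + 1" s] clock_nonneg[of "freeze t w" "t + 1"] t by (simp add: z_def s_def)
  finally show "\<exists>r\<ge>0. u < clock (freeze t w) r" using t by (auto simp: s_def intro!: exI[of _ "t + 1 + s"])
qed

subsection \<open>Measurability of the time change\<close>

lemma path_integrand_continuous:
  fixes k :: "real \<Rightarrow> real"
  assumes w: "w \<in> paths" and k: "continuous_on UNIV k" and S: "S \<subseteq> {0..}"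
  shows "continuous_on S (\<lambda>s. k (w s))"
  by (rule continuous_on_compose2[OF k continuous_on_subset[OF path_spaceD(1)[OF w] S]]) simp

text \<open>Turns the gauge integral into a Lebesgue integral over the whole line whose integrand is
  jointly measurable in path and time, as Fubini's theorem requires.\<close>

lemma path_integral_eq_lebesgue:
  fixes k :: "real \<Rightarrow> real"
  assumes w: "w \<in> paths" and k: "continuous_on UNIV k"
  shows "integral {0..t} (\<lambda>s. k (w s)) = (LBINT s. indicator {0..t} s * k (w (max 0 s)))"
proof -
  have "set_integrable lborel {0..t} (\<lambda>s. k (w s))"
    by (rule borel_integrable_atLeastAtMost') (rule path_integrand_continuous[OF w k], simp)
  then have "(LBINT s:{0..t}. k (w s)) = integral {0..t} (\<lambda>s. k (w s))"
    by (rule set_borel_integral_eq_integral)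
  moreover have "(LBINT s:{0..t}. k (w s)) = (LBINT s. indicator {0..t} s * k (w (max 0 s)))"
    unfolding set_lebesgue_integral_def by (intro Bochner_Integration.integral_cong) (auto split: split_indicator)
  ultimately show ?thesis by simp
qed

lemma path_integrand_measurable:
  fixes k :: "real \<Rightarrow> real"
  assumes k: "continuous_on UNIV k" and f[measurable]: "f \<in> borel_measurable path_space"
  shows "(\<lambda>(w, s). indicator {0..f w} s * k (w (max 0 s))) \<in> borel_measurable (path_space \<Otimes>\<^sub>M lborel)"
proof -
  have k'[measurable]: "k \<in> borel_measurable borel" using k by (rule borel_measurable_continuous_onI)
  have e[measurable]: "(\<lambda>p. (fst p) (max 0 (snd p))) \<in> borel_measurable (path_space \<Otimes>\<^sub>M lborel)"
    by (rule measurable_eval[where g=fst and f="\<lambda>p. max 0 (snd p)"]) auto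
  have ff[measurable]: "(\<lambda>p. f (fst p)) \<in> borel_measurable (path_space \<Otimes>\<^sub>M lborel)"
    by (rule measurable_compose[OF measurable_fst f])
  have "(\<lambda>p. (if 0 \<le> snd p \<and> snd p \<le> f (fst p) then 1 else 0) * k ((fst p) (max 0 (snd p)))) \<in> borel_measurable (path_space \<Otimes>\<^sub>M lborel)"
    by (intro borel_measurable_times measurable_compose[OF e k'] measurable_If) measurable
  moreover have "(\<lambda>(w, s). indicator {0..f w} s * k (w (max 0 s))) =
      (\<lambda>p. (if 0 \<le> snd p \<and> snd p \<le> f (fst p) then 1 else 0) * k ((fst p) (max 0 (snd p))))"
    by (auto simp: fun_eq_iff indicator_def)
  ultimately show ?thesis by simp
qed

lemma measurable_path_integral:
  fixes k :: "real \<Rightarrow> real"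
  assumes k: "continuous_on UNIV k" and f: "f \<in> borel_measurable path_space"
  shows "(\<lambda>w. integral {0..f w} (\<lambda>s. k (w s))) \<in> borel_measurable path_space"
proof -
  have "(\<lambda>w. LBINT s. indicator {0..f w} s * k (w (max 0 s))) \<in> borel_measurable path_space"
    by (rule lborel.borel_measurable_lebesgue_integral) (rule path_integrand_measurable[OF k f])
  then show ?thesis
    by (rule measurable_cong[THEN iffD1, rotated]) (simp add: path_integral_eq_lebesgue k)
qed

lemma path_integral_bound:
  fixes k :: "real \<Rightarrow> real"
  assumes w: "w \<in> paths" and k: "continuous_on UNIV k" "\<And>x. \<bar>k x\<bar> \<le> C" and t: "0 \<le> t"
  shows "\<bar>integral {0..t} (\<lambda>s. k (w s))\<bar> \<le> C * t"
  using integral_bound[of 0 t "\<lambda>s. k (w s)" C] path_integrand_continuous[OF w k(1), of "{0..t}"] k(2) t by auto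

lemma measurable_clock: "0 \<le> t \<Longrightarrow> (\<lambda>w. clock w t) \<in> borel_measurable path_space"
  unfolding clock_def
  by (intro borel_measurable_times borel_measurable_const measurable_path_integral[where k="\<lambda>x. x\<^sup>2" and f="\<lambda>_. t"])
     (auto intro!: continuous_intros)

text \<open>The clock is monotone, so integer levels and integer times decide unboundedness.\<close>

lemma measurable_clock_unbounded: "Measurable.pred path_space clock_unbounded"
proof -
  have "clock_unbounded w \<longleftrightarrow> (\<forall>n::nat. \<exists>k::nat. real n < clock w (real k))" if w: "w \<in> paths" for w
  proof
    assume ub: "clock_unbounded w"
    show "\<forall>n::nat. \<exists>k::nat. real n < clock w (real k)"
    proof
      fix n :: nat
      obtain t where t: "0 \<le> t" "real n < clock w t" using ub by (auto simp: clock_unbounded_def)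
      obtain k :: nat where "t \<le> real k" using real_arch_simple by blast
      then show "\<exists>k::nat. real n < clock w (real k)" using clock_mono[OF w t(1)] t(2) by (metis less_le_trans)
    qed
  next
    assume *: "\<forall>n::nat. \<exists>k::nat. real n < clock w (real k)"
    show "clock_unbounded w"
      unfolding clock_unbounded_def
    proof
      fix u :: real
      obtain n :: nat where "u \<le> real n" using real_arch_simple by blast
      moreover obtain k :: nat where "real n < clock w (real k)" using * by blast
      ultimately show "\<exists>t\<ge>0. u < clock w t" by (intro exI[of _ "real k"]) auto
    qed
  qed
  moreover have "Measurable.pred path_space (\<lambda>w. \<forall>n::nat. \<exists>k::nat. real n < clock w (real k))"
    by (intro pred_intros_countable borel_measurable_pred_less borel_measurable_const measurable_clock) auto
  ultimately show ?thesis by (subst measurable_cong) auto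
qed

text \<open>On a path with bounded clock, \<^const>\<open>inverse_clock\<close> eventually is the infimum of the
  empty set.\<close>

definition regular_path :: "(real \<Rightarrow> real) \<Rightarrow> (real \<Rightarrow> real)" where
  "regular_path w = (if clock_unbounded w then w else freeze 0 w)"

lemma regular_path_in_space: "w \<in> paths \<Longrightarrow> regular_path w \<in> paths"
  by (simp add: regular_path_def freeze_in_space)

lemma clock_unbounded_regular_path: "w \<in> paths \<Longrightarrow> clock_unbounded (regular_path w)"
  by (simp add: regular_path_def clock_unbounded_freeze)

lemma measurable_regular_path: "regular_path \<in> path_space \<rightarrow>\<^sub>M path_space"
  unfolding regular_path_def[abs_def]
  by (intro measurable_If measurable_ident measurable_freeze) (use measurable_clock_unbounded in \<open>simp_all add: pred_def\<close>)

lemma measurable_inverse_clock: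
  assumes f: "f \<in> borel_measurable N" "\<And>x. x \<in> space N \<Longrightarrow> 0 \<le> f x"
    and g: "g \<in> N \<rightarrow>\<^sub>M path_space" "\<And>x. x \<in> space N \<Longrightarrow> clock_unbounded (g x)"
  shows "(\<lambda>x. inverse_clock (g x) (f x)) \<in> borel_measurable N"
proof (rule borel_measurable_iff_less[THEN iffD2], rule allI)
  fix t :: real
  have gs: "g x \<in> paths" if "x \<in> space N" for x using measurable_space[OF g(1) that] .
  show "{x \<in> space N. inverse_clock (g x) (f x) < t} \<in> sets N"
  proof (cases "0 \<le> t")
    case True
    have "{x \<in> space N. inverse_clock (g x) (f x) < t} = {x \<in> space N. f x < clock (g x) t}"
      using inverse_clock_less_iff[OF gs g(2) f(2) True] by auto
    moreover have "(\<lambda>x. clock (g x) t) \<in> borel_measurable N"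
      using measurable_compose[OF g(1) measurable_clock[OF True]] .
    ultimately show ?thesis using f(1) by simp
  next
    case False
    have "\<not> inverse_clock (g x) (f x) < t" if "x \<in> space N" for x
      using inverse_clock_nonneg[OF gs[OF that] g(2)[OF that], of "f x"] False by linarith
    then have "{x \<in> space N. inverse_clock (g x) (f x) < t} = {}" by auto
    then show ?thesis by (simp only: sets.empty_sets)
  qed
qed

lemma measurable_time_change:
  assumes g: "g \<in> N \<rightarrow>\<^sub>M path_space" "\<And>x. x \<in> space N \<Longrightarrow> clock_unbounded (g x)"
  shows "(\<lambda>x. time_change (g x)) \<in> N \<rightarrow>\<^sub>M path_space"
proof (rule measurable_path_spaceI)
  have gs: "g x \<in> paths" if "x \<in> space N" for x using measurable_space[OF g(1) that] .
  show "time_change (g x) \<in> paths" if "x \<in> space N" for x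
    using time_change_in_space[OF gs g(2)] that by auto
  fix u :: real assume u: "0 \<le> u"
  have "(\<lambda>x. inverse_clock (g x) u) \<in> borel_measurable N"
    by (rule measurable_inverse_clock) (use u g in auto)
  then have "(\<lambda>x. (g x (inverse_clock (g x) u))\<^sup>2) \<in> borel_measurable N"
    by (intro borel_measurable_power measurable_eval[where g=g and f="\<lambda>x. inverse_clock (g x) u"] inverse_clock_nonneg gs g)
  then show "(\<lambda>x. time_change (g x) u) \<in> borel_measurable N"
    using u by (simp add: time_change_def)
qed

subsection \<open>First passage times\<close>

text \<open>\<open>insert 1\<close> caps the time and keeps it finite when \<open>S\<close> is not
  hit; \<open>passage S w < 1\<close> then records a genuine hit.\<close>

definition passage :: "real set \<Rightarrow> (real \<Rightarrow> real) \<Rightarrow> real" where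
  "passage S w = Inf (insert 1 {t. 0 \<le> t \<and> t \<le> 1 \<and> w t \<in> S})"

lemma passage_bdd:
  fixes w :: "real \<Rightarrow> real"
  shows "bdd_below (insert 1 {t. 0 \<le> t \<and> t \<le> 1 \<and> w t \<in> S})"
  by (rule bdd_belowI[of _ 0]) auto

lemma passage_bounds: "0 \<le> passage S w" "passage S w \<le> 1"
  unfolding passage_def
  by (rule cInf_greatest, auto)[1] (rule cInf_lower[OF _ passage_bdd], simp)

lemma passage_less_iff:
  "passage S w < t \<longleftrightarrow> 1 < t \<or> (\<exists>s. 0 \<le> s \<and> s \<le> 1 \<and> s < t \<and> w s \<in> S)"
  unfolding passage_def by (subst cInf_less_iff[OF _ passage_bdd]) auto

lemma path_open_nbhd:
  assumes "w \<in> paths" "open S" "0 \<le> s" "w s \<in> S"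
  shows "\<exists>d>0. \<forall>r\<ge>0. \<bar>r - s\<bar> < d \<longrightarrow> w r \<in> S"
proof -
  obtain e where e: "e > 0" "ball (w s) e \<subseteq> S" using assms openE by blast
  obtain d where "0 < d" "\<forall>r\<in>{0..}. dist r s < d \<longrightarrow> dist (w r) (w s) < e"
    using path_spaceD(1)[OF assms(1)] assms(3) e(1) unfolding continuous_on_iff by blast
  then show ?thesis using e(2) by (intro exI[of _ d]) (auto simp: dist_real_def subset_iff abs_minus_commute)
qed

text \<open>A path that is in an open set stays there for a moment, so rational times detect a
  hit.\<close>

lemma measurable_passage:
  assumes S: "open S"
  shows "passage S \<in> borel_measurable path_space"
proof (rule borel_measurable_iff_less[THEN iffD2], rule allI)
  fix t :: real
  show "{w \<in> paths. passage S w < t} \<in> sets path_space"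
  proof (cases "1 < t")
    case True
    then have "{w \<in> paths. passage S w < t} = paths" by (auto simp: passage_less_iff)
    then show ?thesis by simp
  next
    case False
    have eq: "{w \<in> paths. passage S w < t}
        = (\<Union>q\<in>\<rat> \<inter> {0..<t}. (\<lambda>w. w q) -` S \<inter> paths)" (is "?L = ?R")
    proof (intro set_eqI iffI)
      fix w assume "w \<in> ?L"
      then have w: "w \<in> paths" and "passage S w < t" by auto
      then obtain s where s: "0 \<le> s" "s < t" "w s \<in> S" using False by (auto simp: passage_less_iff)
      obtain d where d: "0 < d" "\<And>r. 0 \<le> r \<Longrightarrow> \<bar>r - s\<bar> < d \<Longrightarrow> w r \<in> S"
        using path_open_nbhd[OF w S s(1,3)] by blast
      obtain q where "q \<in> \<rat>" "s < q" "q < min (s + d) t"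
        using Rats_dense_in_real[of s "min (s + d) t"] d(1) s(2) by auto
      then show "w \<in> ?R" using w s d(2)[of q] by auto
    next
      fix w assume "w \<in> ?R"
      then obtain q where "0 \<le> q" "q < t" "w q \<in> S" "w \<in> paths" by auto
      then show "w \<in> ?L" using False by (auto simp: passage_less_iff intro!: exI[of _ q])
    qed
    have "?R \<in> sets path_space"
      by (rule sets.countable_UN'')
         (use S in \<open>auto intro!: countable_Int1 countable_rat measurable_sets[OF measurable_coord]\<close>)
    then show ?thesis using eq by simp
  qed
qed

lemma stopping_time_passage:
  assumes S: "open S"
  shows "stopping_time path_filtration (passage S)"
proof (rule stopping_timeI_agree[OF measurable_passage[OF S] passage_bounds(1)])
  fix w v :: "real \<Rightarrow> real" and t :: real
  assume agree: "\<And>s. 0 \<le> s \<Longrightarrow> s \<le> t \<Longrightarrow> w s = v s" and "passage S w < t"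
  then consider "1 < t" | s where "0 \<le> s" "s \<le> 1" "s < t" "w s \<in> S"
    unfolding passage_less_iff by blast
  then show "passage S v < t"
  proof cases
    case 2
    then show ?thesis unfolding passage_less_iff using agree[of s] by (intro disjI2 exI[of _ s]) simp
  qed (simp add: passage_less_iff)
qed

text \<open>The passage time itself is included: by openness, a path in \<open>S\<close> at that
  time would have been in \<open>S\<close> slightly earlier. At time 0 there is no earlier time,
  hence the condition on \<open>w 0\<close>.\<close>

lemma passage_before:
  assumes w: "w \<in> paths" and S: "open S" "w 0 \<notin> S" and s: "0 \<le> s" "s \<le> passage S w"
  shows "w s \<notin> S"
proof
  assume ws: "w s \<in> S"
  obtain d where d: "0 < d" "\<And>r. 0 \<le> r \<Longrightarrow> \<bar>r - s\<bar> < d \<Longrightarrow> w r \<in> S"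
    using path_open_nbhd[OF w S(1) s(1) ws] by blast
  have "0 < s" using S(2) ws s by (cases "s = 0") auto
  define r where "r = max (s / 2) (s - d / 2)"
  have r: "0 \<le> r" "r < s" "\<bar>r - s\<bar> < d" using d(1) \<open>0 < s\<close> by (auto simp: r_def)
  have "s \<le> 1" using s(2) passage_bounds(2)[of S w] by linarith
  then have "passage S w < s" unfolding passage_less_iff using r d(2)[of r] by (intro disjI2 exI[of _ r]) simp
  with s show False by simp
qed

text \<open>Below the cap, the infimum is approached by times at which the path is in
  \<open>S\<close>, so by continuity the path cannot be at positive distance from \<open>S\<close>
  there.\<close>

lemma passage_closure:
  assumes w: "w \<in> paths" and T: "passage S w < 1"
  shows "w (passage S w) \<in> closure S"
proof (rule ccontr)
  let ?T = "passage S w"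
  assume "w ?T \<notin> closure S"
  then have T': "w ?T \<in> - closure S" by simp
  then obtain d where d: "0 < d" "\<And>r. 0 \<le> r \<Longrightarrow> \<bar>r - ?T\<bar> < d \<Longrightarrow> w r \<in> - closure S"
    using path_open_nbhd[OF w open_Compl[OF closed_closure] passage_bounds(1) T'] by blast
  have "passage S w < min 1 (?T + d)" using d(1) T by simp
  then obtain s where s: "0 \<le> s" "s \<le> 1" "s < ?T + d" "w s \<in> S" by (subst (asm) passage_less_iff) auto
  have "\<not> s < ?T"
  proof
    assume "s < ?T"
    moreover have "?T \<le> s" unfolding passage_def by (rule cInf_lower[OF _ passage_bdd]) (use s in auto)
    ultimately show False by simp
  qed
  then have "w s \<in> - closure S" using s d(2)[of s] by auto
  then show False using s(4) closure_subset by auto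
qed

lemma passage_lt_sets: "open S \<Longrightarrow> {w \<in> paths. passage S w < 1} \<in> sets path_space"
  using measurable_passage[of S] unfolding borel_measurable_iff_less by blast

lemma passage_in_pre_sigma:
  assumes S: "open S"
  shows "{w \<in> paths. passage S w < 1} \<in> sets (path_pre_sigma (passage S))" (is "?A \<in> _")
proof (rule pre_sigmaI_agree[OF stopping_time_passage[OF S] _ passage_bounds(1)])
  show "?A \<in> sets path_space" by (rule passage_lt_sets[OF S])
next
  fix w v t assume *: "w \<in> ?A" "v \<in> paths" "\<And>s. 0 \<le> s \<Longrightarrow> s \<le> t \<Longrightarrow> w s = v s" "passage S w < t"
  have "passage S v = passage S w"
    by (rule pre_sigma_agree(2)[OF stopping_time_passage[OF S] space_in_pre_sigma *(2,3) _ *(4)]) (use *(1) in simp_all)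
  then show "v \<in> ?A" using *(1,2) by simp
qed

lemma path_square_integrable:
  assumes w: "w \<in> paths"
  shows "(\<lambda>s. (w s)\<^sup>2) integrable_on {0..t}"
  by (auto intro!: integrable_continuous_interval continuous_intros continuous_on_subset[OF path_spaceD(1)[OF w]])

lemma clock_le:
  assumes w: "w \<in> paths" and t: "0 \<le> t" and le: "\<And>s. 0 \<le> s \<Longrightarrow> s \<le> t \<Longrightarrow> w s \<le> c"
  shows "clock w t \<le> 4 * c\<^sup>2 * t"
proof -
  have "(w s)\<^sup>2 \<le> c\<^sup>2" if "s \<in> {0..t}" for s
    using that path_spaceD(2)[OF w, of s] le[of s] by (intro power_mono) auto
  then have "integral {0..t} (\<lambda>s. (w s)\<^sup>2) \<le> integral {0..t} (\<lambda>_. c\<^sup>2)"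
    by (intro integral_le path_square_integrable[OF w]) auto
  then show ?thesis using t by (simp add: clock_def mult_ac)
qed

lemma clock_ge:
  assumes w: "w \<in> paths" and t: "0 \<le> t" and c: "0 \<le> c" and le: "\<And>s. 0 \<le> s \<Longrightarrow> s \<le> t \<Longrightarrow> c \<le> w s"
  shows "4 * c\<^sup>2 * t \<le> clock w t"
proof -
  have "c\<^sup>2 \<le> (w s)\<^sup>2" if "s \<in> {0..t}" for s
    using that c le[of s] by (intro power_mono) auto
  then have "integral {0..t} (\<lambda>_. c\<^sup>2) \<le> integral {0..t} (\<lambda>s. (w s)\<^sup>2)"
    by (intro integral_le path_square_integrable[OF w]) auto
  then show ?thesis using t by (simp add: clock_def mult_ac)
qed

subsection \<open>Divergence of the clock\<close>

locale instantaneous_family = strong_markov_family +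
  assumes instantaneous: "instantaneous_at_0 P"
begin

text \<open>A zero clock would make the path vanish on all of [0,1], a set of positive
  measure.\<close>

lemma AE_clock_pos:
  assumes x: "0 \<le> x"
  shows "AE w in P x. 0 < clock w 1"
proof -
  have "AE w in P x. {t. 0 \<le> t \<and> w t = 0} \<in> null_sets lborel"
    using instantaneous x by (simp add: instantaneous_at_0_def)
  then show ?thesis
  proof (rule AE_mp, intro AE_I2 impI)
    fix w assume w: "w \<in> space (P x)" and null: "{t. 0 \<le> t \<and> w t = 0} \<in> null_sets lborel"
    have w': "w \<in> paths" using w x by simp
    show "0 < clock w 1"
    proof (rule ccontr)
      assume "\<not> 0 < clock w 1"
      then have eq: "clock w 0 = clock w 1" using clock_nonneg[of w 1] by simp
      have "{0..1} \<subseteq> {t. 0 \<le> t \<and> w t = 0}"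
        using path_zero_of_clock_eq[OF w' eq] by auto
      then have "{0..1::real} \<in> null_sets lborel"
        using null null_sets_subset by (metis sets_lborel atLeastAtMost_borel)
      then show False by (simp add: null_sets_def)
    qed
  qed
qed

lemma clock_set: "0 \<le> t \<Longrightarrow> {w \<in> paths. e \<le> clock w t} \<in> sets path_space"
  using measurable_clock by measurable

text \<open>Otherwise the clock at time 1 would almost surely be below every 4/(n+1), against its
  positivity. The factor 4 leaves room for later use: at most 2e is spent before a small level is
  passed, and at least e must remain.\<close>

lemma clock_level_0: "\<exists>e>0. \<exists>p>0. p \<le> measure (P 0) {w \<in> paths. 4 * e \<le> clock w 1}"
proof (rule ccontr)
  interpret P: prob_space "P 0" by (rule prob_P) simp
  assume *: "\<not> ?thesis"
  have m: "measure (P 0) {w \<in> paths. 4 * e \<le> clock w 1} = 0" if "e > 0" for e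
  proof (rule ccontr)
    assume "measure (P 0) {w \<in> paths. 4 * e \<le> clock w 1} \<noteq> 0"
    then have "0 < measure (P 0) {w \<in> paths. 4 * e \<le> clock w 1}" by (simp add: zero_less_measure_iff)
    with * that show False by (meson order_refl)
  qed
  have "AE w in P 0. clock w 1 < 4 * (1 / real (Suc n))" for n
  proof (rule AE_I[of _ _ "{w \<in> paths. 4 * (1 / real (Suc n)) \<le> clock w 1}"])
    show "emeasure (P 0) {w \<in> paths. 4 * (1 / real (Suc n)) \<le> clock w 1} = 0"
      using m[of "1 / real (Suc n)"] by (simp add: P.emeasure_eq_measure)
  qed (use clock_set in auto)
  then have "AE w in P 0. \<forall>n. clock w 1 < 4 * (1 / real (Suc n))" by (simp add: AE_all_countable)
  moreover have "AE w in P 0. 0 < clock w 1" by (rule AE_clock_pos) simp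
  ultimately have "AE w in P 0. False"
  proof eventually_elim
    fix w assume 1: "\<forall>n. clock w 1 < 4 * (1 / real (Suc n))" "0 < clock w 1"
    then obtain m :: nat where "1 / real (Suc m) < clock w 1 / 4"
      using reals_Archimedean[of "clock w 1 / 4"] by (auto simp: inverse_eq_divide)
    with 1(1) show False by (metis less_divide_eq_numeral1(1) mult.commute not_less_iff_gr_or_eq)
  qed
  then show False using P.AE_False by simp
qed

text \<open>A path that starts outside \<open>S\<close> enters it through a point of the closure
  that is not in \<open>S\<close>, and \<open>c\<close> is the only candidate. The restarted path
  thus has law \<open>P c\<close> whatever the past, and the integral factors.\<close>

lemma passage_strong_markov:
  assumes x: "0 \<le> x" and S: "open S" "x \<notin> S" and c: "closure S - S \<subseteq> {c}" and W: "W \<in> sets path_space"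
  defines "A \<equiv> {w \<in> paths. passage S w < 1}"
  shows "{w \<in> A. shift_path (passage S w) w \<in> W} \<in> sets path_space"
    and "measure (P x) {w \<in> A. shift_path (passage S w) w \<in> W} = measure (P x) A * measure (P c) W"
proof -
  let ?T = "passage S"
  have A: "A \<in> sets path_space" unfolding A_def by (rule passage_lt_sets[OF S(1)])
  interpret prob_space "P x" by (rule prob_P[OF x])
  have "(\<lambda>w. shift_path (?T w) w) \<in> path_space \<rightarrow>\<^sub>M path_space"
    by (rule measurable_shift) (use measurable_passage[OF S(1)] passage_bounds in auto)
  from measurable_sets[OF this W]
  have "A \<inter> ((\<lambda>w. shift_path (?T w) w) -` W \<inter> paths) \<in> sets path_space" using A by auto
  also have "A \<inter> ((\<lambda>w. shift_path (?T w) w) -` W \<inter> paths) = {w \<in> A. shift_path (?T w) w \<in> W}"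
    by (auto simp: A_def)
  finally show "{w \<in> A. shift_path (?T w) w \<in> W} \<in> sets path_space" .
  have "measure (P x) {w \<in> A. shift_path (?T w) w \<in> W} = (LINT w:A|P x. measure (P (w (?T w))) W)"
    unfolding A_def
    by (rule strong_markov[OF x stopping_time_passage[OF S(1)] passage_bounds(1) passage_in_pre_sigma[OF S(1)] W])
  also have "\<dots> = (LINT w:A|P x. measure (P c) W)"
  proof (rule set_lebesgue_integral_cong_AE)
    have "AE w in P x. w \<in> space (P x) \<and> w 0 = x" using AE_start[OF x] by auto
    then show "AE w\<in>A in P x. measure (P (w (?T w))) W = measure (P c) W"
    proof (eventually_elim, intro impI)
      fix w assume w0: "w \<in> space (P x) \<and> w 0 = x" and wA: "w \<in> A"
      then have w: "w \<in> paths" using x by auto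
      have "w (?T w) \<in> closure S" by (rule passage_closure[OF w]) (use wA in \<open>auto simp: A_def\<close>)
      moreover have "w (?T w) \<notin> S" by (rule passage_before[OF w S(1) _ passage_bounds(1)]) (use w0 S in auto)
      ultimately have "w (?T w) = c" using c by auto
      then show "measure (P (w (?T w))) W = measure (P c) W" by simp
    qed
    have "(\<lambda>w. P (w (?T w))) \<in> path_space \<rightarrow>\<^sub>M subprob_algebra path_space"
      by (intro measurable_kernel_comp measurable_eval[where g="\<lambda>w. w" and f="?T"] measurable_passage S
           passage_bounds) (auto intro: path_spaceD(2) passage_bounds)
    from measurable_compose[OF this measurable_measure_subprob_algebra[OF W]]
    show "(\<lambda>w. measure (P (w (?T w))) W) \<in> borel_measurable (P x)" using x by simp
  qed (use A x in auto)
  also have "\<dots> = measure (P x) A * measure (P c) W"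
    using A x by (simp add: set_lebesgue_integral_def)
  finally show "measure (P x) {w \<in> A. shift_path (?T w) w \<in> W} = measure (P x) A * measure (P c) W" .
qed

text \<open>A path from 0 with a large clock must pass through every small level \<open>x\<close>, which bounds
  the probability of a large clock from below uniformly in \<open>x\<close>.\<close>

lemma clock_level:
  obtains e p where "0 < e" "0 < p" "p \<le> 1" "\<And>x. 0 \<le> x \<Longrightarrow> p \<le> measure (P x) {w \<in> paths. e \<le> clock w 2}"
proof -
  obtain e p where e: "0 < e" and p: "0 < p" "p \<le> measure (P 0) {w \<in> paths. 4 * e \<le> clock w 1}"
    using clock_level_0 by blast
  interpret P0: prob_space "P 0" by (rule prob_P) simp
  have p1: "p \<le> 1" by (rule order_trans[OF p(2) P0.prob_le_1])
  \<comment> \<open>This gives \<open>4 * c\<^sup>2 = 2 * e\<close>: a unit of time spent below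
    \<open>c\<close> adds at most 2e to the clock, one spent above \<open>c\<close> adds at least
    2e.\<close>
  define c where "c = sqrt (e / 2)"
  have c: "0 < c" "4 * c\<^sup>2 = 2 * e" using e by (auto simp: c_def)
  define W where "W = {w \<in> paths. e \<le> clock w 1}"
  define V where "V = {w \<in> paths. e \<le> clock w 2}"
  have W[measurable]: "W \<in> sets path_space" and V[measurable]: "V \<in> sets path_space"
    unfolding W_def V_def by (auto intro: clock_set)
  have WV: "W \<subseteq> V" using clock_mono[of _ 1 2] by (force simp: W_def V_def)
  have low: "p \<le> measure (P x) W" if x: "0 \<le> x" "x \<le> c" for x
  proof -
    let ?S = "{x<..}" and ?T = "passage {x<..}"
    let ?A = "{w \<in> paths. ?T w < 1}"
    have S: "open ?S" by simp
    note hit = passage_strong_markov[OF order_refl S _ _ W, of x]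
    have C: "{w \<in> ?A. shift_path (?T w) w \<in> W} \<in> sets path_space" by (rule hit(1)) (use x in auto)
    have "measure (P 0) {w \<in> paths. 4 * e \<le> clock w 1} \<le> measure (P 0) {w \<in> ?A. shift_path (?T w) w \<in> W}"
    proof (rule P0.finite_measure_mono_AE)
      show "{w \<in> ?A. shift_path (?T w) w \<in> W} \<in> P0.events" using C by simp
      have "AE w in P 0. w 0 = 0" by (rule AE_start) simp
      then show "AE w in P 0. w \<in> {w \<in> paths. 4 * e \<le> clock w 1} \<longrightarrow> w \<in> {w \<in> ?A. shift_path (?T w) w \<in> W}"
      proof (eventually_elim, intro impI)
        fix w assume w0: "w 0 = 0" and "w \<in> {w \<in> paths. 4 * e \<le> clock w 1}"
        then have w: "w \<in> paths" and 4: "4 * e \<le> clock w 1" by auto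
        have sw: "shift_path (?T w) w \<in> paths" by (rule shift_path_in_space[OF w passage_bounds(1)])
        have "clock w (?T w) \<le> 4 * x\<^sup>2 * ?T w"
          by (rule clock_le[OF w passage_bounds(1)]) (use passage_before[OF w S] w0 x in force)
        also have "\<dots> \<le> 4 * c\<^sup>2 * 1"
          by (intro mult_mono power_mono passage_bounds) (use x in auto)
        finally have T: "clock w (?T w) \<le> 2 * e" using c by simp
        \<comment> \<open>With no hit before time 1 the clock at 1 would be at most 2e, less than
          4e.\<close>
        have "?T w < 1" using T 4 e passage_bounds(2)[of ?S w] by (cases "?T w = 1") auto
        moreover have "clock w 1 \<le> clock w (?T w + 1)"
          by (rule clock_mono[OF w]) (use passage_bounds(1)[of ?S w] in auto)
        then have "e \<le> clock (shift_path (?T w) w) 1"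
          using clock_shift[OF w passage_bounds(1), of 1 ?S] T 4 e by simp
        ultimately show "w \<in> {w \<in> ?A. shift_path (?T w) w \<in> W}" using w sw by (auto simp: W_def)
      qed
    qed
    also have "\<dots> = measure (P 0) ?A * measure (P x) W" by (rule hit(2)) (use x in auto)
    also have "\<dots> \<le> 1 * measure (P x) W" by (intro mult_right_mono) auto
    finally show ?thesis using p by simp
  qed
  have "p \<le> measure (P x) V" if x: "0 \<le> x" for x
  proof (cases "x \<le> c")
    case True
    interpret Px: prob_space "P x" by (rule prob_P) (fact x)
    have "measure (P x) W \<le> measure (P x) V" by (rule Px.finite_measure_mono[OF WV]) (use x in simp)
    then show ?thesis using low[OF x True] by simp
  next
    \<comment> \<open>From x > c the path either stays at or above \<open>c\<close> up to time 1
      (\<open>?B\<close>) and collects 2e on the clock, or it reaches \<open>c\<close> earlier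
      (\<open>?A\<close>) and restarts there.\<close>
    case False
    let ?S = "{..<c}" and ?T = "passage {..<c}"
    let ?A = "{w \<in> paths. ?T w < 1}"
    let ?B = "{w \<in> paths. \<not> ?T w < 1}"
    have S: "open ?S" by simp
    have A[measurable]: "?A \<in> sets path_space" by (rule passage_lt_sets[OF S])
    have "?B = paths - ?A" by auto
    then have B[measurable]: "?B \<in> sets path_space" by (simp only: sets.compl_sets[OF A])
    interpret Px: prob_space "P x" by (rule prob_P) (fact x)
    let ?C = "{w \<in> ?A. shift_path (?T w) w \<in> W}"
    note hit = passage_strong_markov[OF x S _ _ W, of c]
    have C': "?C \<in> sets path_space" by (rule hit(1)) (use False in auto)
    then have C: "?C \<in> Px.events" using x by simp
    have "measure (P x) ?C = measure (P x) ?A * measure (P c) W" by (rule hit(2)) (use False in auto)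
    then have mC: "measure (P x) ?A * p \<le> measure (P x) ?C"
      using low[of c] c by (simp add: mult_left_mono)
    have "measure (P x) ?B + measure (P x) ?C = measure (P x) (?B \<union> ?C)"
      by (rule Px.finite_measure_Union[symmetric]) (use C A B x in auto)
    also have "\<dots> \<le> measure (P x) V"
    proof (rule Px.finite_measure_mono_AE)
      have "AE w in P x. w 0 = x" by (rule AE_start) fact
      then show "AE w in P x. w \<in> ?B \<union> ?C \<longrightarrow> w \<in> V"
      proof (eventually_elim, intro impI)
        fix w assume w0: "w 0 = x" and BC: "w \<in> ?B \<union> ?C"
        then have w: "w \<in> paths" by auto
        from BC show "w \<in> V"
        proof
          assume "w \<in> ?B"
          then have T: "?T w = 1" using passage_bounds(2)[of ?S w] by auto
          have "4 * c\<^sup>2 * ?T w \<le> clock w (?T w)"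
            by (rule clock_ge[OF w passage_bounds(1)]) (use passage_before[OF w S] w0 False c in force)+
          then have "e \<le> clock w 1" using T c e by simp
          then show "w \<in> V" using clock_mono[OF w, of 1 2] w by (simp add: V_def)
        next
          assume C: "w \<in> ?C"
          have "e \<le> clock (shift_path (?T w) w) 1" using C by (simp add: W_def)
          also have "\<dots> \<le> clock w (?T w + 1)"
            using clock_shift[OF w passage_bounds(1), of 1 ?S] clock_nonneg[of w "?T w"] by simp
          also have "\<dots> \<le> clock w 2"
            by (rule clock_mono[OF w]) (use passage_bounds[of ?S w] in auto)
          finally show "w \<in> V" using w by (simp add: V_def)
        qed
      qed
    qed (use x V in auto)
    finally have "measure (P x) ?B + measure (P x) ?A * p \<le> measure (P x) V" using mC by simp
    moreover have "measure (P x) ?A + measure (P x) ?B = 1"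
    proof -
      have "measure (P x) (?A \<union> ?B) = measure (P x) ?A + measure (P x) ?B"
        by (rule Px.finite_measure_Union) (use A B x in auto)
      moreover have "?A \<union> ?B = space (P x)" using x by auto
      ultimately show ?thesis using Px.prob_space by simp
    qed
    \<comment> \<open>As p is at most 1, the sure gain on \<open>?B\<close> is worth at least p
      times its probability, so both cases together give p.\<close>
    moreover have "measure (P x) ?B * p \<le> measure (P x) ?B"
      using p1 by (simp add: mult_left_le)
    moreover have "p = measure (P x) ?A * p + measure (P x) ?B * p"
      using calculation(2) by (simp add: distrib_right[symmetric])
    ultimately show ?thesis by linarith
  qed
  then show ?thesis using that[OF e p(1) p1] by (auto simp: V_def)
qed

text \<open>On each time block of length 2 the clock grows by at least \<open>e\<close> with
  conditional probability at least \<open>p\<close>, so smaller growth on all blocks from the m-th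
  on is a null event. A bounded clock, being monotone, has increments tending to 0 and falls into
  one of these events.\<close>

lemma clock_unbounded_AE:
  assumes x: "0 \<le> x"
  shows "AE w in P x. clock_unbounded w"
proof -
  interpret P: prob_space "P x" by (rule prob_P) (fact x)
  obtain e p where e: "0 < e" and p: "0 < p" "p \<le> 1"
      and lev: "\<And>x. 0 \<le> x \<Longrightarrow> p \<le> measure (P x) {w \<in> paths. e \<le> clock w 2}"
    using clock_level by metis
  define V where "V = {w \<in> paths. clock w 2 < e}"
  have V[measurable]: "V \<in> sets path_space" unfolding V_def using measurable_clock[of 2] by measurable
  have mV: "measure (P y) V \<le> 1 - p" if y: "0 \<le> y" for y
  proof -
    interpret Py: prob_space "P y" by (rule prob_P) (fact y)
    have "measure (P y) (space (P y) - {w \<in> paths. e \<le> clock w 2}) = 1 - measure (P y) {w \<in> paths. e \<le> clock w 2}"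
      by (rule Py.prob_compl) (use y clock_set in auto)
    moreover have "space (P y) - {w \<in> paths. e \<le> clock w 2} = V" using y by (auto simp: V_def)
    ultimately show ?thesis using lev[OF y] by simp
  qed
  define D where "D m n = {w \<in> paths. \<forall>k\<in>{m..<m+n}. clock w (2 * real k + 2) - clock w (2 * real k) < e}" for m n :: nat
  have D[measurable]: "D m n \<in> sets path_space" for m n
  proof -
    have *: "(\<lambda>w. clock w (2 * real k + 2) - clock w (2 * real k)) \<in> borel_measurable path_space" for k :: nat
      by (intro borel_measurable_diff measurable_clock) auto
    show ?thesis unfolding D_def using * by measurable
  qed
  have mD: "measure (P x) (D m n) \<le> (1 - p) ^ n" for m n
  proof (induction n)
    case (Suc n)
    define s where "s = 2 * real (m + n)"
    have s: "0 \<le> s" by (simp add: s_def)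
    have st: "stopping_time path_filtration (\<lambda>_. s)" by (rule stopping_time_const)
    \<comment> \<open>The blocks counted in \<open>D m n\<close> end at or before s, so the event is
      decided by the path up to s.\<close>
    have Dpre: "D m n \<in> sets (path_pre_sigma (\<lambda>_. s))"
    proof (rule pre_sigmaI_agree[OF st D s])
      fix w v t assume *: "w \<in> D m n" "v \<in> paths" "\<And>r. 0 \<le> r \<Longrightarrow> r \<le> t \<Longrightarrow> w r = v r" "s < t"
      have "clock v r = clock w r" if "r \<le> s" for r
        by (rule clock_cong) (use * that in auto)
      moreover have "2 * real k + 2 \<le> s" "2 * real k \<le> s" if "k \<in> {m..<m+n}" for k
        using that by (auto simp: s_def)
      ultimately show "v \<in> D m n" using *(1,2) by (auto simp: D_def)
    qed
    have "D m (Suc n) = {w \<in> D m n. shift_path s w \<in> V}"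
    proof -
      have "clock (shift_path s w) 2 = clock w (2 * real (m + n) + 2) - clock w (2 * real (m + n))"
        if "w \<in> paths" for w
        using clock_shift[OF that s, of 2] by (simp add: s_def)
      moreover have "{m..<m + Suc n} = insert (m + n) {m..<m + n}" by auto
      ultimately show ?thesis
        using shift_path_in_space[OF _ s] by (auto simp: D_def V_def simp del: of_nat_add)
    qed
    then have "measure (P x) (D m (Suc n)) = (LINT w:D m n|P x. measure (P (w s)) V)"
      using strong_markov[OF x st s Dpre V] by simp
    also have "\<dots> \<le> (LINT w:D m n|P x. 1 - p)"
      unfolding set_lebesgue_integral_def
    proof (rule integral_mono)
      have "(\<lambda>w. P (w s)) \<in> path_space \<rightarrow>\<^sub>M subprob_algebra path_space"
        using s by (intro measurable_kernel_comp measurable_coord) (auto intro: path_spaceD(2))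
      from measurable_compose[OF this measurable_measure_subprob_algebra[OF V]]
      have m: "(\<lambda>w. measure (P (w s)) V) \<in> borel_measurable path_space" .
      show "integrable (P x) (\<lambda>w. indicat_real (D m n) w *\<^sub>R measure (P (w s)) V)"
      proof (rule integrable_bounded[OF x, of _ 1])
        show "(\<lambda>w. indicat_real (D m n) w *\<^sub>R measure (P (w s)) V) \<in> borel_measurable path_space"
          using m by measurable
        fix w assume "w \<in> paths"
        then have "measure (P (w s)) V \<le> 1" using prob_space.prob_le_1[OF prob_P] path_spaceD(2) s by auto
        then show "\<bar>indicat_real (D m n) w *\<^sub>R measure (P (w s)) V\<bar> \<le> 1" by (auto split: split_indicator)
      qed
      show "integrable (P x) (\<lambda>w. indicat_real (D m n) w *\<^sub>R (1 - p))"
        by (rule integrable_bounded[OF x, of _ 1]) (use p in \<open>auto split: split_indicator\<close>)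
      show "indicat_real (D m n) w *\<^sub>R measure (P (w s)) V \<le> indicat_real (D m n) w *\<^sub>R (1 - p)" if "w \<in> space (P x)" for w
        using that mV path_spaceD(2) s x by (auto split: split_indicator)
    qed
    also have "\<dots> = measure (P x) (D m n) * (1 - p)"
      using x by (simp add: set_lebesgue_integral_def)
    also have "\<dots> \<le> (1 - p) ^ n * (1 - p)" using Suc p by (intro mult_right_mono) auto
    finally show ?case by (simp add: mult.commute)
  qed (use P.prob_le_1 in simp)
  have null: "AE w in P x. \<not> (\<forall>n. w \<in> D m n)" for m
  proof (rule AE_I[of _ _ "\<Inter>n. D m n"])
    have I: "(\<Inter>n. D m n) \<in> sets path_space" by measurable
    have "measure (P x) (\<Inter>n. D m n) \<le> (1 - p) ^ n" for n
      by (rule order_trans[OF P.finite_measure_mono mD[of m n]]) (use x in auto)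
    moreover have "(\<lambda>n. (1 - p) ^ n) \<longlonglongrightarrow> 0" using p by (intro LIMSEQ_realpow_zero) auto
    ultimately have "measure (P x) (\<Inter>n. D m n) \<le> 0"
      by (intro LIMSEQ_le_const) auto
    then show "emeasure (P x) (\<Inter>n. D m n) = 0"
      by (simp add: P.emeasure_eq_measure measure_le_0_iff)
    show "(\<Inter>n. D m n) \<in> sets (P x)" using I x by simp
  qed auto
  have "AE w in P x. w \<in> space (P x) \<and> (\<forall>m. \<not> (\<forall>n. w \<in> D m n))"
    using null by (auto simp: AE_all_countable)
  then show ?thesis
  proof eventually_elim
    fix w assume w: "w \<in> space (P x) \<and> (\<forall>m. \<not> (\<forall>n. w \<in> D m n))"
    then have w': "w \<in> paths" using x by simp
    show "clock_unbounded w"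
    proof (rule ccontr)
      assume "\<not> clock_unbounded w"
      then obtain u where u: "\<And>t. 0 \<le> t \<Longrightarrow> clock w t \<le> u" by (auto simp: clock_unbounded_def not_less)
      define a where "a k = clock w (2 * real k)" for k
      have "incseq a" unfolding a_def incseq_def using clock_mono[OF w'] by auto
      moreover have "\<forall>k. a k \<le> u" using u by (simp add: a_def)
      ultimately obtain L where "a \<longlonglongrightarrow> L" using incseq_convergent[of a u] by blast
      then have "(\<lambda>k. a (Suc k) - a k) \<longlonglongrightarrow> L - L" by (intro tendsto_diff LIMSEQ_Suc)
      then have "\<forall>\<^sub>F k in sequentially. a (Suc k) - a k < e" using e by (intro order_tendstoD(2)) auto
      then obtain m where "\<And>k. k \<ge> m \<Longrightarrow> a (Suc k) - a k < e" by (auto simp: eventually_sequentially)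
      then have "\<forall>n. w \<in> D m n" using w' by (auto simp: D_def a_def algebra_simps)
      with w show False by auto
    qed
  qed
qed

end

subsection \<open>The time-changed family\<close>

text \<open>\<open>regular_path\<close> makes the map total and measurable; it alters only paths
  with bounded clock.\<close>

definition changed_path :: "(real \<Rightarrow> real) \<Rightarrow> (real \<Rightarrow> real)" where
  "changed_path w = time_change (regular_path w)"

lemma changed_path_eq: "clock_unbounded w \<Longrightarrow> changed_path w = time_change w"
  by (simp add: changed_path_def regular_path_def)

lemma measurable_changed_path: "changed_path \<in> path_space \<rightarrow>\<^sub>M path_space"
  unfolding changed_path_def[abs_def]
  by (intro measurable_time_change measurable_regular_path clock_unbounded_regular_path)

lemma changed_path_in_space: "w \<in> paths \<Longrightarrow> changed_path w \<in> paths"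
  by (rule measurable_space[OF measurable_changed_path])

text \<open>The time \<open>T\<close> of the time-changed path, in the original time scale. Freezing the path at
  \<open>n\<close> makes this a stopping time of the filtration, which contains no null sets.\<close>

definition frozen_change :: "nat \<Rightarrow> (real \<Rightarrow> real) \<Rightarrow> (real \<Rightarrow> real)" where
  "frozen_change n w = time_change (freeze (real n) w)"

definition original_time :: "((real \<Rightarrow> real) \<Rightarrow> real) \<Rightarrow> nat \<Rightarrow> (real \<Rightarrow> real) \<Rightarrow> real" where
  "original_time T n w = min (real n) (inverse_clock (freeze (real n) w) (T (frozen_change n w)))"

lemma frozen_path:
  assumes "w \<in> paths"
  shows "freeze (real n) w \<in> paths" "clock_unbounded (freeze (real n) w)"
  using assms by (auto simp: freeze_in_space clock_unbounded_freeze)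

lemma clock_freeze: "t \<le> r \<Longrightarrow> clock (freeze r w) t = clock w t"
  by (rule clock_cong) (auto simp: freeze_eq)

lemma measurable_frozen_change: "frozen_change n \<in> path_space \<rightarrow>\<^sub>M path_space"
  unfolding frozen_change_def[abs_def]
  by (rule measurable_time_change[OF measurable_freeze frozen_path(2)]) simp_all

lemma frozen_change_in_space: "w \<in> paths \<Longrightarrow> frozen_change n w \<in> paths"
  by (rule measurable_space[OF measurable_frozen_change])

lemma frozen_change_agree:
  assumes "w \<in> paths" "v \<in> paths" "\<And>s. 0 \<le> s \<Longrightarrow> s \<le> t \<Longrightarrow> w s = v s"
    "0 \<le> t" "t \<le> real n" "0 \<le> u" "u \<le> clock w t"
  shows "frozen_change n w u = frozen_change n v u"
  unfolding frozen_change_def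
  by (rule time_change_agree[OF frozen_path[OF assms(1)] frozen_path[OF assms(2)] _ assms(4,6)])
     (use assms in \<open>auto simp: freeze_eq clock_freeze\<close>)

lemma original_time_nonneg: "w \<in> paths \<Longrightarrow> 0 \<le> original_time T n w"
  using inverse_clock_nonneg[OF frozen_path] by (simp add: original_time_def)

context
  fixes T :: "(real \<Rightarrow> real) \<Rightarrow> real"
  assumes T: "stopping_time path_filtration T" and pos: "\<forall>w\<in>paths. 0 \<le> T w"
begin

lemma measurable_frozen_stopping: "(\<lambda>w. T (frozen_change n w)) \<in> borel_measurable path_space"
  by (rule measurable_compose[OF measurable_frozen_change measurable_stopping[OF T]])

lemma measurable_original_time: "original_time T n \<in> borel_measurable path_space"
  unfolding original_time_def[abs_def]
  by (intro borel_measurable_min borel_measurable_const measurable_inverse_clock measurable_frozen_stopping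
      pos[rule_format] frozen_change_in_space measurable_freeze frozen_path) simp_all

text \<open>Up to time n the freezing is invisible: frozen and true clock agree there, and the cap
  at n does not interfere.\<close>

lemma original_time_less_iff:
  assumes w: "w \<in> paths" and t: "0 \<le> t" "t \<le> real n"
  shows "original_time T n w < t \<longleftrightarrow> T (frozen_change n w) < clock w t"
  using inverse_clock_less_iff[OF frozen_path[OF w] pos[rule_format, OF frozen_change_in_space[OF w]] t(1), of n n] t clock_freeze[OF t(2), of w]
  by (auto simp: original_time_def min_less_iff_disj)

text \<open>If \<open>T\<close> of the changed path is below \<open>clock w t\<close>, it is
  determined by the changed path up to that clock value, hence by \<open>w\<close> up to t. For t >
  n the cap makes the strict inequality automatic.\<close>

lemma stopping_time_original_time: "stopping_time path_filtration (original_time T n)"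
proof (rule stopping_timeI_agree[OF measurable_original_time original_time_nonneg])
  fix w v t assume w: "w \<in> paths" and v: "v \<in> paths"
    and ag: "\<And>s. 0 \<le> s \<Longrightarrow> s \<le> t \<Longrightarrow> w s = v s" and less: "original_time T n w < t"
  show "original_time T n v < t"
  proof (cases "t \<le> real n")
    case False
    then show ?thesis by (simp add: original_time_def min_less_iff_disj)
  next
    case True
    have t: "0 \<le> t" using original_time_nonneg[OF w, of T n] less by simp
    have lt: "T (frozen_change n w) < clock w t" using original_time_less_iff[OF w t True] less by simp
    have "T (frozen_change n v) = T (frozen_change n w)"
    proof (rule pre_sigma_agree(2)[OF T space_in_pre_sigma, where t="clock w t"])
      show "frozen_change n w s = frozen_change n v s" if "0 \<le> s" "s \<le> clock w t" for s
        by (rule frozen_change_agree[OF w v ag t True that])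
    qed (use frozen_change_in_space w v lt in auto)
    moreover have "clock v t = clock w t" by (rule clock_cong) (simp add: ag)
    ultimately show ?thesis using original_time_less_iff[OF v t True] lt by simp
  qed
qed

end

context instantaneous_family
begin

definition changed_law :: "real \<Rightarrow> (real \<Rightarrow> real) measure" where
  "changed_law y = distr (P (sqrt y)) path_space changed_path"

lemma kernel_changed_law: "changed_law \<in> restrict_space borel {0..} \<rightarrow>\<^sub>M prob_algebra path_space"
proof -
  have "sqrt \<in> restrict_space borel {0..} \<rightarrow>\<^sub>M restrict_space borel {0..}"
    by (intro measurable_restrict_space2 measurable_restrict_space1) (auto simp: space_restrict_space)
  from measurable_compose[OF measurable_compose[OF this kernel] measurable_distr_prob_space[OF measurable_changed_path]]
  show ?thesis by (simp add: changed_law_def[abs_def])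
qed

lemma changed_law_square: "0 \<le> x \<Longrightarrow> changed_law (x\<^sup>2) = distr (P x) path_space changed_path"
  by (simp add: changed_law_def)

lemma measure_changed_law:
  assumes "0 \<le> y" "B \<in> sets path_space"
  shows "measure (changed_law y) B = measure (P (sqrt y)) (changed_path -` B \<inter> paths)"
  unfolding changed_law_def by (subst measure_distr) (use assms measurable_changed_path in auto)

lemma AE_changed_law_iff:
  assumes "0 \<le> y" "{w \<in> paths. R w} \<in> sets path_space"
  shows "(AE w in changed_law y. R w) \<longleftrightarrow> (AE w in P (sqrt y). R (changed_path w))"
  unfolding changed_law_def by (rule AE_distr_iff) (use assms measurable_changed_path in auto)

lemma changed_law_start: "0 \<le> y \<Longrightarrow> AE w in changed_law y. w 0 = y"
proof -
  assume y: "0 \<le> y"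
  have "{w \<in> paths. w 0 = y} \<in> sets path_space"
    using measurable_coord[of 0] by measurable
  moreover have sy: "0 \<le> sqrt y" using y by simp
  have "AE w in P (sqrt y). changed_path w 0 = y"
    using AE_start[OF sy] AE_space clock_unbounded_AE[OF sy]
  proof eventually_elim
    fix w assume "w 0 = sqrt y" "w \<in> space (P (sqrt y))" "clock_unbounded w"
    then show "changed_path w 0 = y" using time_change_0[of w] y by (simp add: changed_path_eq)
  qed
  ultimately show ?thesis using AE_changed_law_iff[OF y] by simp
qed

text \<open>The strong Markov property of \<open>P\<close> at \<open>S n\<close> covers the part of
  \<open>A\<close> on which \<open>T\<close> comes before the clock value at n. Since the clock is
  almost surely unbounded, these parts exhaust \<open>A\<close> as n grows.\<close>

lemma changed_strong_markov:
  assumes y: "0 \<le> y" and T: "stopping_time path_filtration T"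
    and pos: "\<And>w. w \<in> paths \<Longrightarrow> 0 \<le> T w"
    and A: "A \<in> sets (path_pre_sigma T)" and B: "B \<in> sets path_space"
  shows "measure (changed_law y) {w \<in> A. shift_path (T w) w \<in> B} =
    (LINT w:A|changed_law y. measure (changed_law (w (T w))) B)"
proof -
  define x where "x = sqrt y"
  have x: "0 \<le> x" using y by (simp add: x_def)
  interpret P: prob_space "P x" by (rule prob_P) (fact x)
  have Am[measurable]: "A \<in> sets path_space" using sets_pre_sigma_le[OF T] A by auto
  then have Asp: "A \<subseteq> paths" by (rule sets.sets_into_space)
  note Tm[measurable] = measurable_stopping[OF T]
  note agree = pre_sigma_agree[OF T]
  define B' where "B' = changed_path -` B \<inter> paths"
  have B': "B' \<in> sets path_space" unfolding B'_def by (rule measurable_sets[OF measurable_changed_path B])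
  have pos': "\<forall>w\<in>paths. 0 \<le> T w" using pos by blast
  define \<theta> where "\<theta> = frozen_change"
  define S where "S = original_time T"
  define A' where "A' n = {w \<in> paths. \<theta> n w \<in> A \<and> T (\<theta> n w) < clock w (real n)}" for n
  note \<theta> = frozen_change_in_space[folded \<theta>_def] and \<theta>m = measurable_frozen_change[folded \<theta>_def]
    and T\<theta>m = measurable_frozen_stopping[OF T pos', folded \<theta>_def] and \<theta>agree = frozen_change_agree[folded \<theta>_def]
  note S0 = original_time_nonneg[of _ T, folded S_def] and Sm = measurable_original_time[OF T pos', folded S_def]
    and Sless = original_time_less_iff[OF T pos', folded S_def \<theta>_def]
    and Sst = stopping_time_original_time[OF T pos', folded S_def]
  have \<theta>cong: "\<theta> n w = \<theta> n v" if "\<And>s. 0 \<le> s \<Longrightarrow> s \<le> real n \<Longrightarrow> w s = v s" for n w v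
    using freeze_cong[of "real n" w v] that by (simp add: \<theta>_def frozen_change_def)
  have A'm: "A' n \<in> sets path_space" for n
  proof -
    have "A' n = (\<theta> n -` A \<inter> paths) \<inter> {w \<in> paths. T (\<theta> n w) < clock w (real n)}"
      by (auto simp: A'_def)
    moreover have "{w \<in> paths. T (\<theta> n w) < clock w (real n)} \<in> sets path_space"
      by (rule borel_measurable_less[OF T\<theta>m measurable_clock]) simp
    ultimately show ?thesis using measurable_sets[OF \<theta>m Am] by simp
  qed
  have A'pre: "A' n \<in> sets (path_pre_sigma (S n))" for n
  proof (rule pre_sigmaI_agree[OF Sst A'm S0])
    fix w v t assume wA: "w \<in> A' n" and v: "v \<in> paths"
      and ag: "\<And>s. 0 \<le> s \<Longrightarrow> s \<le> t \<Longrightarrow> w s = v s" and less: "S n w < t"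
    have w: "w \<in> paths" and wA': "\<theta> n w \<in> A" "T (\<theta> n w) < clock w (real n)" using wA by (auto simp: A'_def)
    show "v \<in> A' n"
    proof (cases "t \<le> real n")
      case False
      then have "\<theta> n w = \<theta> n v" by (intro \<theta>cong ag) auto
      moreover have "clock w (real n) = clock v (real n)" using False by (intro clock_cong ag) auto
      ultimately show ?thesis using wA' v by (simp add: A'_def)
    next
      case True
      have t: "0 \<le> t" using S0[OF w, of n] less by simp
      have lt: "T (\<theta> n w) < clock w t" using Sless[OF w t True] less by simp
      have "\<theta> n v \<in> A" "T (\<theta> n v) = T (\<theta> n w)"
        using agree[OF A \<theta>[OF v] \<theta>agree[OF w v ag t True] wA'(1) lt] by blast+
      moreover have "clock v t = clock w t" by (rule clock_cong) (simp add: ag)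
      moreover have "clock v t \<le> clock v (real n)" by (rule clock_mono[OF v t True])
      ultimately show ?thesis using lt v by (simp add: A'_def)
    qed
  qed
  let ?\<Phi> = changed_path
  define E where "E n = {w \<in> paths. ?\<Phi> w \<in> A \<and> T (?\<Phi> w) < clock w (real n)}" for n
  \<comment> \<open>For an unbounded clock, frozen and true changed path coincide up to the clock
    value at n, so on \<open>E n\<close> the stopping time, the shift and the restart law correspond
    in the two time scales.\<close>
  have good: "(w \<in> A' n \<longleftrightarrow> w \<in> E n) \<and> (w \<in> E n \<longrightarrow>
      (shift_path (S n w) w \<in> B' \<longleftrightarrow> shift_path (T (?\<Phi> w)) (?\<Phi> w) \<in> B) \<and>
      measure (P (w (S n w))) B' = measure (changed_law (?\<Phi> w (T (?\<Phi> w)))) B)"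
    if w: "w \<in> paths" and ub: "clock_unbounded w" for w n
  proof -
    define \<psi> where "\<psi> = time_change w"
    have \<Phi>: "?\<Phi> w = \<psi>" using ub by (simp add: changed_path_eq \<psi>_def)
    have \<psi>: "\<psi> \<in> paths" unfolding \<psi>_def by (rule time_change_in_space[OF w ub])
    have ag: "\<psi> u = \<theta> n w u" if "0 \<le> u" "u \<le> clock w (real n)" for u
      unfolding \<psi>_def \<theta>_def frozen_change_def
      by (rule time_change_agree[OF w ub frozen_path[OF w] _ _ that]) (auto simp: freeze_eq)
    have 1: "w \<in> A' n \<longleftrightarrow> w \<in> E n" and 2: "w \<in> E n \<longrightarrow> T (\<theta> n w) = T \<psi>"
    proof -
      have "w \<in> E n \<Longrightarrow> w \<in> A' n \<and> T (\<theta> n w) = T \<psi>"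
        using agree[OF A \<theta>[OF w] ag] by (auto simp: E_def A'_def \<Phi>)
      moreover have "w \<in> A' n \<Longrightarrow> w \<in> E n"
        using agree[OF A \<psi> ag[symmetric]] by (auto simp: E_def A'_def \<Phi>)
      ultimately show "w \<in> A' n \<longleftrightarrow> w \<in> E n" "w \<in> E n \<longrightarrow> T (\<theta> n w) = T \<psi>" by auto
    qed
    moreover have "(shift_path (S n w) w \<in> B' \<longleftrightarrow> shift_path (T \<psi>) \<psi> \<in> B) \<and>
      measure (P (w (S n w))) B' = measure (changed_law (\<psi> (T \<psi>))) B" if wE: "w \<in> E n"
    proof -
      define \<sigma> where "\<sigma> = inverse_clock w (T \<psi>)"
      have T\<psi>: "0 \<le> T \<psi>" "T \<psi> < clock w (real n)" using pos[OF \<psi>] wE by (auto simp: E_def \<Phi>)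
      have \<sigma>0: "0 \<le> \<sigma>" unfolding \<sigma>_def by (rule inverse_clock_nonneg[OF w ub])
      have \<sigma>c: "clock w \<sigma> = T \<psi>" unfolding \<sigma>_def by (rule clock_inverse_clock[OF w ub T\<psi>(1)])
      \<comment> \<open>Both times are below n and lie below the same thresholds in [0,n], hence
        they are equal.\<close>
      have "S n w < t \<longleftrightarrow> \<sigma> < t" if "0 \<le> t" "t \<le> real n" for t
        using Sless[OF w that] 2 wE inverse_clock_less_iff[OF w ub T\<psi>(1) that(1)] by (simp add: \<sigma>_def)
      moreover from this[of "real n"] have "S n w < real n" "\<sigma> < real n"
        using Sless[OF w, of "real n" n] 2 wE T\<psi> by auto
      ultimately have S: "S n w = \<sigma>"
        using S0[OF w, of n] \<sigma>0 by (metis less_imp_le linorder_neqE_linordered_idom order_less_irrefl)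
      have sw: "shift_path \<sigma> w \<in> paths" by (rule shift_path_in_space[OF w \<sigma>0])
      have "changed_path (shift_path \<sigma> w) = shift_path (T \<psi>) \<psi>"
        using time_change_shift[OF w ub \<sigma>0] clock_unbounded_shift[OF w ub \<sigma>0] \<sigma>c
        by (simp add: changed_path_eq \<psi>_def)
      moreover have "\<psi> (T \<psi>) = (w \<sigma>)\<^sup>2"
        using time_change_clock[OF w ub \<sigma>0] \<sigma>c by (simp add: \<psi>_def)
      moreover have "0 \<le> w \<sigma>" using path_spaceD(2)[OF w \<sigma>0] .
      ultimately show ?thesis
        using measure_changed_law[OF _ B, of "(w \<sigma>)\<^sup>2"] sw by (simp add: S B'_def)
    qed
    ultimately show ?thesis by (simp add: \<Phi>)
  qed
  define q where "q v = measure (changed_law (v (T v))) B" for v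
  have qm[measurable]: "q \<in> borel_measurable path_space"
  proof -
    have "(\<lambda>v. v (T v)) \<in> borel_measurable path_space"
      by (rule measurable_eval[where g="\<lambda>v. v"]) (use pos in auto)
    then have "(\<lambda>v. v (T v)) \<in> path_space \<rightarrow>\<^sub>M restrict_space borel {0..}"
      by (rule measurable_restrict_space2[rotated]) (use pos path_spaceD(2) in auto)
    from measurable_compose[OF measurable_compose[OF this kernel_changed_law] measurable_measure_prob_algebra[OF B]]
    show ?thesis by (simp add: q_def[abs_def])
  qed
  have qb: "\<bar>q v\<bar> \<le> 1" if "v \<in> paths" for v
  proof -
    have "prob_space (changed_law (v (T v)))"
      using measurable_space[OF kernel_changed_law, of "v (T v)"] that pos path_spaceD(2)
      by (auto simp: space_restrict_space space_prob_algebra)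
    then show ?thesis by (simp add: q_def prob_space.prob_le_1)
  qed
  have \<Phi>A: "?\<Phi> -` A \<inter> paths \<in> sets path_space" by (rule measurable_sets[OF measurable_changed_path Am])
  have T\<Phi>m: "(\<lambda>w. T (?\<Phi> w)) \<in> borel_measurable path_space" by (rule measurable_compose[OF measurable_changed_path Tm])
  have Em[measurable]: "E n \<in> sets path_space" for n
  proof -
    have "E n = (?\<Phi> -` A \<inter> paths) \<inter> {w \<in> paths. T (?\<Phi> w) < clock w (real n)}"
      by (auto simp: E_def)
    moreover have "{w \<in> paths. T (?\<Phi> w) < clock w (real n)} \<in> sets path_space"
      by (rule borel_measurable_less[OF T\<Phi>m measurable_clock]) simp
    ultimately show ?thesis using \<Phi>A by simp
  qed
  define G where "G = {v \<in> A. shift_path (T v) v \<in> B}"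
  have shm: "(\<lambda>v. shift_path (T v) v) \<in> path_space \<rightarrow>\<^sub>M path_space"
    by (rule measurable_shift) (use pos in auto)
  have Gm[measurable]: "G \<in> sets path_space"
  proof -
    have "G = A \<inter> ((\<lambda>v. shift_path (T v) v) -` B \<inter> paths)" using Asp by (auto simp: G_def)
    then show ?thesis using measurable_sets[OF shm B] by simp
  qed
  define F where "F n = {w \<in> E n. ?\<Phi> w \<in> G}" for n
  have \<Phi>G: "?\<Phi> -` G \<inter> paths \<in> sets path_space" by (rule measurable_sets[OF measurable_changed_path Gm])
  have Fm: "F n \<in> sets path_space" for n
  proof -
    have "F n = E n \<inter> (?\<Phi> -` G \<inter> paths)" by (auto simp: F_def E_def)
    then show ?thesis using \<Phi>G by simp
  qed
  have ubAE: "AE w in P x. w \<in> space (P x) \<and> clock_unbounded w" using clock_unbounded_AE[OF x] by auto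
  have step: "measure (P x) (F n) = (LINT w|P x. indicator (E n) w * q (?\<Phi> w))" for n
  proof -
    have "measure (P x) (F n) = measure (P x) {w \<in> A' n. shift_path (S n w) w \<in> B'}"
    proof (rule P.finite_measure_eq_AE)
      show "AE w in P x. (w \<in> F n) = (w \<in> {w \<in> A' n. shift_path (S n w) w \<in> B'})"
        using ubAE
      proof eventually_elim
        fix w assume *: "w \<in> space (P x) \<and> clock_unbounded w"
        then have "w \<in> paths" "clock_unbounded w" using x by auto
        from good[OF this, of n] show "(w \<in> F n) = (w \<in> {w \<in> A' n. shift_path (S n w) w \<in> B'})"
          by (auto simp: F_def G_def E_def)
      qed
      have "(\<lambda>w. shift_path (S n w) w) \<in> path_space \<rightarrow>\<^sub>M path_space"
        by (rule measurable_shift[OF Sm _ S0]) auto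
      from measurable_sets[OF this B']
      have "A' n \<inter> ((\<lambda>w. shift_path (S n w) w) -` B' \<inter> paths) \<in> sets path_space" using A'm by simp
      also have "A' n \<inter> ((\<lambda>w. shift_path (S n w) w) -` B' \<inter> paths) = {w \<in> A' n. shift_path (S n w) w \<in> B'}"
        by (auto simp: A'_def)
      finally show "{w \<in> A' n. shift_path (S n w) w \<in> B'} \<in> P.events" using x by simp
    qed (use Fm x in simp)
    also have "\<dots> = (LINT w:A' n|P x. measure (P (w (S n w))) B')"
      by (rule strong_markov[OF x Sst S0 A'pre B'])
    also have "\<dots> = (LINT w|P x. indicator (E n) w * q (?\<Phi> w))"
      unfolding set_lebesgue_integral_def
    proof (rule integral_cong_AE)
      have "(\<lambda>w. w (S n w)) \<in> borel_measurable path_space"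
        by (rule measurable_eval[where g="\<lambda>v. v", OF Sm _ S0]) auto
      then have "(\<lambda>w. P (w (S n w))) \<in> path_space \<rightarrow>\<^sub>M subprob_algebra path_space"
        by (rule measurable_kernel_comp) (use S0 path_spaceD(2) in auto)
      from measurable_compose[OF this measurable_measure_subprob_algebra[OF B']]
      have m: "(\<lambda>w. measure (P (w (S n w))) B') \<in> borel_measurable path_space" .
      show "(\<lambda>w. indicat_real (A' n) w *\<^sub>R measure (P (w (S n w))) B') \<in> borel_measurable (P x)"
        using m A'm x by simp
      show "(\<lambda>w. indicator (E n) w * q (?\<Phi> w)) \<in> borel_measurable (P x)"
        using measurable_compose[OF measurable_changed_path qm] x by simp
      show "AE w in P x. indicat_real (A' n) w *\<^sub>R measure (P (w (S n w))) B' = indicator (E n) w * q (?\<Phi> w)"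
        using ubAE
      proof eventually_elim
        fix w assume *: "w \<in> space (P x) \<and> clock_unbounded w"
        then have "w \<in> paths" "clock_unbounded w" using x by auto
        from good[OF this, of n]
        show "indicat_real (A' n) w *\<^sub>R measure (P (w (S n w))) B' = indicator (E n) w * q (?\<Phi> w)"
          by (auto simp: q_def split: split_indicator)
      qed
    qed
    finally show ?thesis .
  qed
  have Emono: "E m \<subseteq> E n" if "m \<le> n" for m n
    using that clock_mono[of _ "real m" "real n"] by (force simp: E_def)
  have Ulim: "\<exists>n0. \<forall>n\<ge>n0. T (?\<Phi> w) < clock w (real n)" if w: "w \<in> paths" and ub: "clock_unbounded w" for w
  proof -
    obtain t where t: "0 \<le> t" "T (?\<Phi> w) < clock w t" using ub by (auto simp: clock_unbounded_def)
    obtain n0 :: nat where "t \<le> real n0" using real_arch_simple by blast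
    then have "T (?\<Phi> w) < clock w (real n)" if "n0 \<le> n" for n
      using clock_mono[OF w t(1), of "real n"] t(2) that by linarith
    then show ?thesis by blast
  qed
  \<comment> \<open>Passage to the limit in \<open>step\<close>: continuity of measure along the
    increasing \<open>F n\<close> on the left, dominated convergence on the right.\<close>
  have "(\<lambda>n. measure (P x) (F n)) \<longlonglongrightarrow> measure (P x) (\<Union>n. F n)"
    by (rule P.finite_Lim_measure_incseq) (use Fm x Emono in \<open>auto simp: incseq_def F_def\<close>)
  moreover have "measure (P x) (\<Union>n. F n) = measure (P x) (?\<Phi> -` G \<inter> paths)"
  proof (rule P.finite_measure_eq_AE)
    show "AE w in P x. (w \<in> (\<Union>n. F n)) = (w \<in> ?\<Phi> -` G \<inter> paths)"
      using ubAE
    proof eventually_elim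
      fix w assume *: "w \<in> space (P x) \<and> clock_unbounded w"
      then have w: "w \<in> paths" "clock_unbounded w" using x by auto
      obtain n0 where "\<forall>n\<ge>n0. T (?\<Phi> w) < clock w (real n)" using Ulim[OF w] by auto
      then show "(w \<in> (\<Union>n. F n)) = (w \<in> ?\<Phi> -` G \<inter> paths)"
        using w by (auto simp: F_def G_def E_def)
    qed
  qed (use Fm \<Phi>G x in auto)
  ultimately have L: "(\<lambda>n. measure (P x) (F n)) \<longlonglongrightarrow> measure (P x) (?\<Phi> -` G \<inter> paths)" by simp
  have R: "(\<lambda>n. LINT w|P x. indicator (E n) w * q (?\<Phi> w)) \<longlonglongrightarrow> (LINT w|P x. indicator A (?\<Phi> w) * q (?\<Phi> w))"
  proof (rule integral_dominated_convergence[where w="\<lambda>_. 1"])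
    show "(\<lambda>w. indicator (E n) w * q (?\<Phi> w)) \<in> borel_measurable (P x)" for n
      using measurable_compose[OF measurable_changed_path qm] x by simp
    have "(\<lambda>w. indicator A (?\<Phi> w) * q (?\<Phi> w)) \<in> borel_measurable path_space"
      using measurable_compose[OF measurable_changed_path, of "\<lambda>v. indicator A v * q v" borel] by simp
    then show "(\<lambda>w. indicator A (?\<Phi> w) * q (?\<Phi> w)) \<in> borel_measurable (P x)" using x by simp
    show "AE w in P x. (\<lambda>n. indicator (E n) w * q (?\<Phi> w)) \<longlonglongrightarrow> indicator A (?\<Phi> w) * q (?\<Phi> w)"
      using ubAE
    proof eventually_elim
      fix w assume *: "w \<in> space (P x) \<and> clock_unbounded w"
      then have w: "w \<in> paths" "clock_unbounded w" using x by auto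
      obtain n0 where n0: "\<forall>n\<ge>n0. T (?\<Phi> w) < clock w (real n)" using Ulim[OF w] by auto
      have "\<forall>\<^sub>F n in sequentially. indicator (E n) w * q (?\<Phi> w) = indicator A (?\<Phi> w) * q (?\<Phi> w)"
        using eventually_ge_at_top[of n0]
        by eventually_elim (use n0 w in \<open>auto simp: E_def split: split_indicator\<close>)
      then show "(\<lambda>n. indicator (E n) w * q (?\<Phi> w)) \<longlonglongrightarrow> indicator A (?\<Phi> w) * q (?\<Phi> w)"
        by (rule tendsto_eventually)
    qed
    show "AE w in P x. norm (indicator (E n) w * q (?\<Phi> w)) \<le> 1" for n
      using qb[OF changed_path_in_space] x by (intro AE_I2) (auto split: split_indicator)
  qed (simp add: P.integrable_const)
  have "measure (changed_law y) G = measure (P x) (?\<Phi> -` G \<inter> paths)"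
    unfolding x_def by (rule measure_changed_law[OF y Gm])
  also have "\<dots> = (LINT w|P x. indicator A (?\<Phi> w) * q (?\<Phi> w))"
    by (rule LIMSEQ_unique[OF L]) (simp add: step R)
  also have "\<dots> = (LINT v|changed_law y. indicator A v * q v)"
    unfolding changed_law_def x_def[symmetric]
    by (rule integral_distr[symmetric]) (use x measurable_changed_path in auto)
  finally show ?thesis by (simp add: G_def q_def set_lebesgue_integral_def)
qed

lemma changed_strong_markov_laws: "strong_markov_laws changed_law"
  unfolding strong_markov_laws_def
  using kernel_changed_law changed_law_start changed_strong_markov by blast

text \<open>The measure of a section of a product set is measurable in the path. Transferring the
  almost sure statement through \<open>distr\<close> requires this.\<close>

lemma null_zeros_measurable:
  "{w \<in> paths. {t. 0 \<le> t \<and> w t = 0} \<in> null_sets lborel} \<in> sets path_space"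
proof -
  have Z: "{t. 0 \<le> t \<and> w t = 0} \<in> sets lborel" if "w \<in> paths" for w
  proof -
    have "closed ({0..} \<inter> w -` {0})"
      using continuous_closed_preimage[OF path_spaceD(1)[OF that], of "{0}"] by auto
    moreover have "{t. 0 \<le> t \<and> w t = 0} = {0..} \<inter> w -` {0}" by auto
    ultimately show ?thesis by simp
  qed
  let ?Q = "{p \<in> space (path_space \<Otimes>\<^sub>M lborel). 0 \<le> snd p \<and> (fst p) (max 0 (snd p)) = 0}"
  have "(\<lambda>p. (fst p) (max 0 (snd p))) \<in> borel_measurable (path_space \<Otimes>\<^sub>M lborel)"
    by (rule measurable_eval[where g=fst and f="\<lambda>p. max 0 (snd p)"]) auto
  then have "?Q \<in> sets (path_space \<Otimes>\<^sub>M lborel)" by measurable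
  from lborel.measurable_emeasure_Pair[OF this]
  have m: "(\<lambda>w. emeasure lborel (Pair w -` ?Q)) \<in> borel_measurable path_space" .
  have eq: "Pair w -` ?Q = {t. 0 \<le> t \<and> w t = 0}" if "w \<in> paths" for w
    using that by (auto simp: space_pair_measure max_def)
  have "{w \<in> paths. {t. 0 \<le> t \<and> w t = 0} \<in> null_sets lborel}
      = {w \<in> paths. emeasure lborel (Pair w -` ?Q) = 0}"
    using Z eq by (auto simp: null_sets_def)
  also have "\<dots> \<in> sets path_space" using m by measurable
  finally show ?thesis .
qed

text \<open>The differentiable clock maps the zeros of the original path onto the zeros of the
  changed path, and a differentiable image of a null set of reals is null.\<close>

lemma changed_instantaneous: "instantaneous_at_0 changed_law"
  unfolding instantaneous_at_0_def
proof (intro allI impI)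
  fix y :: real assume y: "0 \<le> y"
  have "AE w in P (sqrt y). {t. 0 \<le> t \<and> w t = 0} \<in> null_sets lborel"
    using instantaneous y by (simp add: instantaneous_at_0_def)
  then have "AE w in P (sqrt y). {t. 0 \<le> t \<and> changed_path w t = 0} \<in> null_sets lborel"
    using AE_space clock_unbounded_AE[OF real_sqrt_ge_zero[OF y]]
  proof eventually_elim
    fix w assume null: "{t. 0 \<le> t \<and> w t = 0} \<in> null_sets lborel"
      and "w \<in> space (P (sqrt y))" and ub: "clock_unbounded w"
    then have w: "w \<in> paths" using y by simp
    have sub: "{u. 0 \<le> u \<and> time_change w u = 0} = clock w ` {t. 0 \<le> t \<and> w t = 0}"
    proof (intro set_eqI iffI)
      fix u assume u: "u \<in> {u. 0 \<le> u \<and> time_change w u = 0}"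
      define t where "t = inverse_clock w u"
      have t: "0 \<le> t" "clock w t = u"
        using inverse_clock_nonneg[OF w ub] clock_inverse_clock[OF w ub] u by (auto simp: t_def)
      then show "u \<in> clock w ` {t. 0 \<le> t \<and> w t = 0}" using time_change_clock[OF w ub t(1)] u by auto
    qed (auto simp: time_change_clock[OF w ub] clock_nonneg)
    have "negligible {t. 0 \<le> t \<and> w t = 0}"
      using null by (simp add: negligible_iff_null_sets null_sets_completionI)
    then have "negligible (clock w ` {t. 0 \<le> t \<and> w t = 0})"
    proof (rule negligible_differentiable_image_negligible[rotated])
      show "clock w differentiable_on {t. 0 \<le> t \<and> w t = 0}"
        unfolding differentiable_on_def
      proof
        fix t assume t: "t \<in> {t. 0 \<le> t \<and> w t = 0}"
        have "at t within {0..t+1} = at t within {0..}"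
          by (rule at_within_nhd[of _ "{..<t+1}"]) auto
        then have "(clock w has_real_derivative 4 * (w t)\<^sup>2) (at t within {0..})"
          using clock_deriv[OF w, of t "t + 1"] t by simp
        then have "(clock w has_real_derivative 4 * (w t)\<^sup>2) (at t within {t. 0 \<le> t \<and> w t = 0})"
          by (rule DERIV_subset) auto
        then show "clock w differentiable at t within {t. 0 \<le> t \<and> w t = 0}"
          unfolding real_differentiable_def by blast
      qed
    qed simp
    then have "negligible {u. 0 \<le> u \<and> time_change w u = 0}" by (simp add: sub)
    moreover have "{u. 0 \<le> u \<and> time_change w u = 0} \<in> sets lborel"
    proof -
      have "closed ({0..} \<inter> time_change w -` {0})"
        using continuous_closed_preimage[OF path_spaceD(1)[OF time_change_in_space[OF w ub]], of "{0}"] by auto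
      moreover have "{u. 0 \<le> u \<and> time_change w u = 0} = {0..} \<inter> time_change w -` {0}" by auto
      ultimately show ?thesis by simp
    qed
    ultimately show "{t. 0 \<le> t \<and> changed_path w t = 0} \<in> null_sets lborel"
      using ub by (simp add: changed_path_eq negligible_iff_null_sets null_sets_completion_iff)
  qed
  then show "AE w in changed_law y. {t. 0 \<le> t \<and> w t = 0} \<in> null_sets lborel"
    using AE_changed_law_iff[OF y null_zeros_measurable] by simp
qed

end

subsection \<open>Test functions\<close>

text \<open>As \<open>g\<close> vanishes below a > 0, the integral from 0 also serves for negative
  x, where its interval is empty.\<close>

lemma antiderivative_exists:
  fixes g :: "real \<Rightarrow> real"
  assumes g: "continuous_on UNIV g" and a: "0 < a" "\<And>x. x < a \<Longrightarrow> g x = 0"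
  obtains G where "\<And>x. (G has_real_derivative g x) (at x)" "\<And>x. x < a \<Longrightarrow> G x = 0"
proof -
  define G where "G x = integral {0..x} g" for x
  have zero: "G x = 0" if "x < a" for x
  proof -
    have "G x = integral {0..x} (\<lambda>_. 0)"
      unfolding G_def by (rule integral_cong) (use a that in auto)
    then show ?thesis by simp
  qed
  have "(G has_real_derivative g x) (at x)" for x
  proof (cases "x < a")
    case True
    have "((\<lambda>_. 0) has_real_derivative g x) (at x)" using a(2)[OF True] by simp
    then show ?thesis
      by (rule has_field_derivative_transform_within_open[of _ _ _ "{..<a}"]) (use True zero in auto)
  next
    case False
    have "(G has_real_derivative g x) (at x within {0..x + 1})"
      unfolding G_def[abs_def]
      by (rule integral_has_real_derivative) (use False a g in \<open>auto intro: continuous_on_subset\<close>)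
    moreover have "at x within {0..x + 1} = at x"
      by (rule at_within_Icc_at) (use False a in auto)
    ultimately show ?thesis by simp
  qed
  with zero that show ?thesis by blast
qed

text \<open>The approximation is the second difference quotient of a second antiderivative.\<close>

lemma C2_approximation:
  fixes h :: "real \<Rightarrow> real"
  assumes h: "continuous_on UNIV h" and a: "0 < a" and supp: "\<And>x. x \<notin> {a..b} \<Longrightarrow> h x = 0" and e: "0 < e"
  shows "\<exists>f. C2_compact_support_pos f \<and> (\<forall>x. \<bar>f x - h x\<bar> \<le> e)"
proof -
  obtain H where H: "\<And>x. (H has_real_derivative h x) (at x)" "\<And>x. x < a \<Longrightarrow> H x = 0"
    by (rule antiderivative_exists[OF h a]) (use supp in auto)
  have "continuous_on UNIV H" using H(1) by (intro DERIV_continuous_on) (auto intro: has_field_derivative_at_within)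
  then obtain K where K: "\<And>x. (K has_real_derivative H x) (at x)"
    by (rule antiderivative_exists[OF _ a, of H]) (use H(2) in auto)
  \<comment> \<open>The margin a beyond b contains the window (x, x + 2d) for every x up to
    b.\<close>
  have "uniformly_continuous_on {0..b + a} h"
    by (rule compact_uniformly_continuous) (use h in \<open>auto intro: continuous_on_subset\<close>)
  then obtain r where r: "0 < r" "\<And>x y. x \<in> {0..b + a} \<Longrightarrow> y \<in> {0..b + a} \<Longrightarrow> dist y x < r \<Longrightarrow> dist (h y) (h x) < e"
    unfolding uniformly_continuous_on_def using e by blast
  \<comment> \<open>\<open>2 * d < r\<close> brings a window of length 2d under the uniform
    continuity, and \<open>2 * d < a\<close> keeps the support of the forward difference inside
    (0,oo).\<close>
  define d where "d = min (r / 4) (a / 4)"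
  have d: "0 < d" "2 * d < r" "2 * d < a" using r(1) a by (auto simp: d_def)
  have close: "\<bar>h y - h x\<bar> \<le> e" if "x < y" "y < x + 2 * d" for x y
  proof (cases "0 \<le> x \<and> x \<le> b")
    case True
    then show ?thesis using r(2)[of x y] that d by (force simp: dist_real_def)
  next
    case False
    then have "x \<notin> {a..b}" "y \<notin> {a..b}" using that d a by auto
    then show ?thesis using supp e by simp
  qed
  define f where "f x = (K (x + 2 * d) - 2 * K (x + d) + K x) / d\<^sup>2" for x
  define f1 where "f1 x = (H (x + 2 * d) - 2 * H (x + d) + H x) / d\<^sup>2" for x
  define f2 where "f2 x = (h (x + 2 * d) - 2 * h (x + d) + h x) / d\<^sup>2" for x
  have Kd: "((\<lambda>x. K (x + c)) has_real_derivative H (x + c)) (at x)" for x c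
    by (rule DERIV_shift[THEN iffD1, OF K])
  have Hd: "((\<lambda>x. H (x + c)) has_real_derivative h (x + c)) (at x)" for x c
    by (rule DERIV_shift[THEN iffD1, OF H(1)])
  have fd: "(f has_real_derivative f1 x) (at x)" for x
    unfolding f_def[abs_def] f1_def by (intro DERIV_cdivide DERIV_add DERIV_diff DERIV_cmult Kd K)
  have f1d: "(f1 has_real_derivative f2 x) (at x)" for x
    unfolding f1_def[abs_def] f2_def by (intro DERIV_cdivide DERIV_add DERIV_diff DERIV_cmult Hd H(1))
  \<comment> \<open>Two applications of the mean value theorem exhibit the second difference
    quotient as a value of \<open>h\<close> in the window; both the approximation and the support
    follow from this.\<close>
  have mv: "\<exists>y. x < y \<and> y < x + 2 * d \<and> f x = h y" for x
  proof -
    have "((\<lambda>x. K (x + d) - K x) has_real_derivative H (s + d) - H s) (at s)" for s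
      by (intro DERIV_diff Kd K)
    then obtain s where s: "x < s" "s < x + d"
        "(K (x + d + d) - K (x + d)) - (K (x + d) - K x) = (x + d - x) * (H (s + d) - H s)"
      using MVT2[of x "x + d" "\<lambda>x. K (x + d) - K x" "\<lambda>s. H (s + d) - H s"] d(1) by auto
    obtain y where y: "s < y" "y < s + d" "H (s + d) - H s = (s + d - s) * h y"
      using MVT2[of s "s + d" H h] H(1) d(1) by auto
    have "K (x + 2 * d) - 2 * K (x + d) + K x = d\<^sup>2 * h y"
      using s(3) y(3) by (simp add: power2_eq_square algebra_simps)
    then have "f x = h y" using d(1) by (simp add: f_def)
    with s y show ?thesis by (intro exI[of _ y]) auto
  qed
  have df: "deriv f = f1" using fd by (auto intro: DERIV_imp_deriv)
  have df1: "deriv f1 = f2" using f1d by (auto intro: DERIV_imp_deriv)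
  have "C2_compact_support_pos f"
    unfolding C2_compact_support_pos_def df df1
  proof (intro conjI allI exI impI)
    show "f differentiable at x" "f1 differentiable at x" for x
      using fd f1d unfolding real_differentiable_def by blast+
    have "continuous_on UNIV (\<lambda>x. h (x + c))" for c
      by (rule continuous_on_compose2[OF h]) (auto intro: continuous_intros)
    then show "continuous_on UNIV f2" unfolding f2_def[abs_def]
      using h d(1) by (intro continuous_intros) auto
    show "0 < a - 2 * d" using d by simp
    fix x assume "x \<notin> {a - 2 * d..b}"
    then show "f x = 0" using mv[of x] supp by fastforce
  qed
  moreover have "\<bar>f x - h x\<bar> \<le> e" for x using mv[of x] close[of x] by auto
  ultimately show ?thesis by blast
qed

lemma compact_support_bounded:
  fixes h :: "real \<Rightarrow> real"
  assumes h: "continuous_on UNIV h" and supp: "\<And>x. x \<notin> {a..b} \<Longrightarrow> h x = 0"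
  shows "\<exists>C\<ge>0. \<forall>x. \<bar>h x\<bar> \<le> C"
proof -
  have "compact (h ` {a..b})" by (intro compact_continuous_image continuous_on_subset[OF h]) auto
  from compact_imp_bounded[OF this] obtain C where C: "0 < C" "\<And>y. y \<in> h ` {a..b} \<Longrightarrow> norm y \<le> C"
    unfolding bounded_pos by blast
  have "\<bar>h x\<bar> \<le> C" for x using C supp[of x] by (cases "x \<in> {a..b}") auto
  with C(1) show ?thesis by (intro exI[of _ C]) auto
qed

definition generator :: "(real \<Rightarrow> real) \<Rightarrow> (real \<Rightarrow> real) \<Rightarrow> (real \<Rightarrow> real)" where
  "generator b f = (\<lambda>x. 1/2 * deriv (deriv f) x + b x * deriv f x)"

lemma C2_compact_support_posD:
  assumes "C2_compact_support_pos f"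
  shows "(f has_real_derivative deriv f x) (at x)" "(deriv f has_real_derivative deriv (deriv f) x) (at x)"
    "continuous_on UNIV f" "continuous_on UNIV (deriv f)" "continuous_on UNIV (deriv (deriv f))"
proof -
  show d: "(f has_real_derivative deriv f x) (at x)" "(deriv f has_real_derivative deriv (deriv f) x) (at x)" for x
    using assms unfolding C2_compact_support_pos_def real_differentiable_def by (auto dest: DERIV_imp_deriv)
  show "continuous_on UNIV f" "continuous_on UNIV (deriv f)"
    using d by (auto intro!: DERIV_continuous_on intro: has_field_derivative_at_within)
  show "continuous_on UNIV (deriv (deriv f))" using assms by (simp add: C2_compact_support_pos_def)
qed

text \<open>Outside the closed interval \<open>f\<close> vanishes on an open set, so its derivatives
  vanish there as well.\<close>

lemma C2_compact_support_pos_support: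
  assumes "C2_compact_support_pos f"
  shows "\<exists>a b. 0 < a \<and> (\<forall>x. x \<notin> {a..b} \<longrightarrow> f x = 0 \<and> deriv f x = 0 \<and> deriv (deriv f) x = 0)"
proof -
  obtain a b where ab: "0 < a" "\<And>x. x \<notin> {a..b} \<Longrightarrow> f x = 0"
    using assms unfolding C2_compact_support_pos_def by blast
  have o: "open (- {a..b})" by (intro open_Compl) simp
  have d0: "deriv k x = 0" if "\<And>x. x \<notin> {a..b} \<Longrightarrow> k x = 0" "x \<notin> {a..b}" for k :: "real \<Rightarrow> real" and x
  proof (rule DERIV_imp_deriv, rule has_field_derivative_transform_within_open)
    show "((\<lambda>_. 0) has_real_derivative 0) (at x)" by simp
  qed (use that o in auto)
  have d1: "deriv f x = 0" if "x \<notin> {a..b}" for x using d0[OF ab(2) that] .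
  have d2: "deriv (deriv f) x = 0" if "x \<notin> {a..b}" for x using d0[OF d1 that] .
  show ?thesis using ab d1 d2 by blast
qed

text \<open>The drift may be singular at 0, but \<open>f\<close> vanishes below some l > 0, so
  continuity can be glued from the open sets (0,oo) and (-oo,l).\<close>

lemma generator_continuous_support:
  assumes b: "continuous_on {0<..} b" and f: "C2_compact_support_pos f"
  shows "continuous_on UNIV (generator b f)" (is ?cont)
    and "\<exists>l r. 0 < l \<and> (\<forall>x. x \<notin> {l..r} \<longrightarrow> generator b f x = 0)" (is ?supp)
proof -
  obtain l r where lr: "0 < l" "\<And>x. x \<notin> {l..r} \<Longrightarrow> f x = 0" "\<And>x. x \<notin> {l..r} \<Longrightarrow> deriv f x = 0"
      "\<And>x. x \<notin> {l..r} \<Longrightarrow> deriv (deriv f) x = 0"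
    using C2_compact_support_pos_support[OF f] by blast
  have zero: "generator b f x = 0" if "x \<notin> {l..r}" for x using lr(3,4)[OF that] by (simp add: generator_def)
  have "continuous_on ({0<..} \<union> {..<l}) (generator b f)"
  proof (rule continuous_on_open_Un)
    show "continuous_on {0<..} (generator b f)" unfolding generator_def
      by (intro continuous_intros b continuous_on_subset[OF C2_compact_support_posD(4)[OF f]]
          continuous_on_subset[OF C2_compact_support_posD(5)[OF f]]) auto
    have "continuous_on {..<l} (\<lambda>_. 0 :: real)" by simp
    then show "continuous_on {..<l} (generator b f)"
      by (rule continuous_on_cong[THEN iffD1, rotated 2]) (use zero in auto)
  qed auto
  moreover have "{0<..} \<union> {..<l} = UNIV" using lr(1) by auto
  ultimately show ?cont by simp
  show ?supp using lr(1) zero by blast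
qed

lemma test_function_bounds:
  assumes b: "continuous_on {0<..} b" and f: "C2_compact_support_pos f"
  shows "\<exists>C\<ge>0. (\<forall>x. \<bar>f x\<bar> \<le> C) \<and> (\<forall>x. \<bar>generator b f x\<bar> \<le> C)"
proof -
  obtain l r where lr: "\<And>x. x \<notin> {l..r} \<Longrightarrow> f x = 0"
    using C2_compact_support_pos_support[OF f] by blast
  obtain C1 where C1: "0 \<le> C1" "\<And>x. \<bar>f x\<bar> \<le> C1"
    using compact_support_bounded[OF C2_compact_support_posD(3)[OF f] lr] by blast
  obtain l' r' where lr': "\<And>x. x \<notin> {l'..r'} \<Longrightarrow> generator b f x = 0"
    using generator_continuous_support(2)[OF b f] by blast
  obtain C2 where C2: "0 \<le> C2" "\<And>x. \<bar>generator b f x\<bar> \<le> C2"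
    using compact_support_bounded[OF generator_continuous_support(1)[OF b f] lr'] by blast
  show ?thesis
    by (rule exI[of _ "max C1 C2"]) (use C1 C2 in \<open>auto simp: le_max_iff_disj\<close>)
qed

text \<open>The time change turns the test function \<open>x \<mapsto> f (x\<^sup>2)\<close> of the original family into \<open>f\<close>.\<close>

definition square_pullback :: "(real \<Rightarrow> real) \<Rightarrow> (real \<Rightarrow> real)" where
  "square_pullback f x = (if 0 < x then f (x\<^sup>2) else 0)"

lemma square_pullback:
  assumes f: "C2_compact_support_pos f"
  shows "C2_compact_support_pos (square_pullback f)"
    and "0 < x \<Longrightarrow> deriv (square_pullback f) x = 2 * x * deriv f (x\<^sup>2)"
    and "0 < x \<Longrightarrow> deriv (deriv (square_pullback f)) x = 2 * deriv f (x\<^sup>2) + 4 * x\<^sup>2 * deriv (deriv f) (x\<^sup>2)"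
    and "0 \<le> x \<Longrightarrow> square_pullback f x = f (x\<^sup>2)"
proof -
  let ?g = "square_pullback f"
  obtain a b where ab: "0 < a" "\<And>x. x \<notin> {a..b} \<Longrightarrow> f x = 0" "\<And>x. x \<notin> {a..b} \<Longrightarrow> deriv f x = 0"
      "\<And>x. x \<notin> {a..b} \<Longrightarrow> deriv (deriv f) x = 0"
    using C2_compact_support_pos_support[OF f] by blast
  note D = C2_compact_support_posD[OF f]
  define g1 where "g1 x = (if 0 < x then 2 * x * deriv f (x\<^sup>2) else 0)" for x :: real
  define g2 where "g2 x = (if 0 < x then 2 * deriv f (x\<^sup>2) + 4 * x\<^sup>2 * deriv (deriv f) (x\<^sup>2) else 0)" for x :: real
  \<comment> \<open>This makes the three functions vanish below \<open>sqrt a\<close>, so that the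
    case distinction at 0 does not disturb smoothness.\<close>
  have small: "x\<^sup>2 \<notin> {a..b}" if "0 < x" "x < sqrt a" for x
  proof -
    have "x\<^sup>2 < (sqrt a)\<^sup>2" by (rule power_strict_mono) (use that in auto)
    then show ?thesis using ab(1) by simp
  qed
  have sa: "0 < sqrt a" using ab(1) by simp
  have zero: "?g x = 0" "g1 x = 0" "g2 x = 0" if "x < sqrt a" for x
    using small[OF _ that] ab by (auto simp: square_pullback_def g1_def g2_def)
  have sq: "((\<lambda>x. x\<^sup>2) has_real_derivative 2 * x) (at x)" for x :: real
    by (auto intro!: derivative_eq_intros)
  have gd: "(?g has_real_derivative g1 x) (at x)" for x
  proof (cases "x < sqrt a")
    case True
    have "((\<lambda>_. 0) has_real_derivative g1 x) (at x)" using zero(2)[OF True] by simp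
    then show ?thesis
      by (rule has_field_derivative_transform_within_open[of _ _ _ "{..<sqrt a}"]) (use True zero in auto)
  next
    case False
    then have x: "0 < x" using sa by linarith
    have "((\<lambda>x. f (x\<^sup>2)) has_real_derivative deriv f (x\<^sup>2) * (2 * x)) (at x)"
      by (rule DERIV_chain2[OF D(1) sq])
    then have "((\<lambda>x. f (x\<^sup>2)) has_real_derivative g1 x) (at x)" using x by (simp add: g1_def mult_ac)
    then show ?thesis
      by (rule has_field_derivative_transform_within_open[of _ _ _ "{0<..}"])
         (use x in \<open>auto simp: square_pullback_def\<close>)
  qed
  have g1d: "(g1 has_real_derivative g2 x) (at x)" for x
  proof (cases "x < sqrt a")
    case True
    have "((\<lambda>_. 0) has_real_derivative g2 x) (at x)" using zero(3)[OF True] by simp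
    then show ?thesis
      by (rule has_field_derivative_transform_within_open[of _ _ _ "{..<sqrt a}"]) (use True zero in auto)
  next
    case False
    then have x: "0 < x" using sa by linarith
    have "((\<lambda>x. 2 * x * deriv f (x\<^sup>2)) has_real_derivative 2 * x * (deriv (deriv f) (x\<^sup>2) * (2 * x)) + 2 * deriv f (x\<^sup>2)) (at x)"
      by (rule derivative_eq_intros DERIV_chain2[OF D(2) sq] refl | simp)+
    then have "((\<lambda>x. 2 * x * deriv f (x\<^sup>2)) has_real_derivative g2 x) (at x)"
      using x by (simp add: g2_def power2_eq_square algebra_simps)
    then show ?thesis
      by (rule has_field_derivative_transform_within_open[of _ _ _ "{0<..}"])
         (use x in \<open>auto simp: g1_def\<close>)
  qed
  have dg: "deriv ?g = g1" using gd by (auto intro: DERIV_imp_deriv)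
  have dg1: "deriv g1 = g2" using g1d by (auto intro: DERIV_imp_deriv)
  show "C2_compact_support_pos ?g"
    unfolding C2_compact_support_pos_def dg dg1
  proof (intro conjI allI exI impI)
    show "?g differentiable at x" "g1 differentiable at x" for x
      using gd g1d unfolding real_differentiable_def by blast+
    have "continuous_on ({0<..} \<union> {..<sqrt a}) g2"
    proof (rule continuous_on_open_Un)
      have "continuous_on {0<..} (\<lambda>x. 2 * deriv f (x\<^sup>2) + 4 * x\<^sup>2 * deriv (deriv f) (x\<^sup>2))"
        by (intro continuous_intros continuous_on_compose2[OF D(4)] continuous_on_compose2[OF D(5)]) auto
      then show "continuous_on {0<..} g2"
        by (rule continuous_on_cong[THEN iffD1, rotated 2]) (auto simp: g2_def)
      have "continuous_on {..<sqrt a} (\<lambda>_. 0 :: real)" by simp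
      then show "continuous_on {..<sqrt a} g2"
        by (rule continuous_on_cong[THEN iffD1, rotated 2]) (use zero in auto)
    qed auto
    moreover have "0 < x \<or> x < sqrt a" for x using sa by linarith
    then have "{0<..} \<union> {..<sqrt a} = UNIV" by auto
    ultimately show "continuous_on UNIV g2" by simp
    show "0 < sqrt a" by (rule sa)
    fix x assume x: "x \<notin> {sqrt a..sqrt \<bar>b\<bar>}"
    show "?g x = 0"
    proof (cases "x < sqrt a")
      case False
      then have "sqrt \<bar>b\<bar> < x" using x by auto
      then have "(sqrt \<bar>b\<bar>)\<^sup>2 < x\<^sup>2" by (intro power_strict_mono) auto
      then have "x\<^sup>2 \<notin> {a..b}" by auto
      then show ?thesis using ab(2) by (simp add: square_pullback_def)
    qed (rule zero)
  qed
  show "0 < x \<Longrightarrow> deriv ?g x = 2 * x * deriv f (x\<^sup>2)" by (simp add: dg g1_def)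
  show "0 < x \<Longrightarrow> deriv (deriv ?g) x = 2 * deriv f (x\<^sup>2) + 4 * x\<^sup>2 * deriv (deriv f) (x\<^sup>2)"
    by (simp add: dg dg1 g2_def)
  show "0 \<le> x \<Longrightarrow> ?g x = f (x\<^sup>2)" using ab(1) ab(2)[of 0] by (auto simp: square_pullback_def)
qed

text \<open>By the chain rule the coefficient of \<open>deriv f\<close> is
  \<open>1 + 2 * x * b x\<close>, and the drift hypothesis is its division by the speed
  \<open>4 * x\<^sup>2\<close>. At 0 the left side vanishes by its support, the right side by its
  factor.\<close>

lemma generator_square_pullback:
  assumes f: "C2_compact_support_pos f" and x: "0 \<le> x"
    and drift: "\<And>x. 0 < x \<Longrightarrow> b' (x\<^sup>2) = (1 + 2 * x * b x) / (4 * x\<^sup>2)"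
  shows "generator b (square_pullback f) x = 4 * x\<^sup>2 * generator b' f (x\<^sup>2)"
proof (cases "x = 0")
  case True
  obtain l r where "0 < l" "\<And>x. x \<notin> {l..r} \<Longrightarrow> square_pullback f x = 0"
    "\<And>x. x \<notin> {l..r} \<Longrightarrow> deriv (square_pullback f) x = 0"
    "\<And>x. x \<notin> {l..r} \<Longrightarrow> deriv (deriv (square_pullback f)) x = 0"
    using C2_compact_support_pos_support[OF square_pullback(1)[OF f]] by blast
  then show ?thesis using True by (simp add: generator_def)
next
  case False
  with x have x': "0 < x" by simp
  have d: "4 * x\<^sup>2 * b' (x\<^sup>2) = 1 + 2 * x * b x" using drift[OF x'] x' by simp
  have "generator b (square_pullback f) x = 2 * x\<^sup>2 * deriv (deriv f) (x\<^sup>2) + (1 + 2 * x * b x) * deriv f (x\<^sup>2)"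
    by (simp add: generator_def square_pullback[OF f] x' algebra_simps)
  also have "\<dots> = 4 * x\<^sup>2 * generator b' f (x\<^sup>2)"
    unfolding d[symmetric] generator_def by (simp add: algebra_simps)
  finally show ?thesis .
qed

subsection \<open>Dynkin's formula\<close>

context strong_markov_family
begin

text \<open>Dominated convergence along continuous paths; applied to the generator, it supplies the
  continuous derivative for the fundamental theorem of calculus.\<close>

lemma expectation_continuous:
  fixes k :: "real \<Rightarrow> real"
  assumes x: "0 \<le> x" and k: "continuous_on UNIV k" "\<And>x. \<bar>k x\<bar> \<le> C"
  shows "continuous_on {0..} (\<lambda>s. LINT w|P x. k (w s))"
  unfolding continuous_on_sequentially
proof (intro allI ballI impI, unfold o_def)
  interpret prob_space "P x" by (rule prob_P[OF x])
  have [measurable]: "k \<in> borel_measurable borel" using k(1) by (rule borel_measurable_continuous_onI)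
  fix s :: real and a assume s: "s \<in> {0..}" and a: "(\<forall>n. a n \<in> {0..}) \<and> a \<longlonglongrightarrow> s"
  show "(\<lambda>n. LINT w|P x. k (w (a n))) \<longlonglongrightarrow> (LINT w|P x. k (w s))"
  proof (rule integral_dominated_convergence[where w="\<lambda>_. C"])
    show "(\<lambda>w. k (w s)) \<in> borel_measurable (P x)" "(\<lambda>w. k (w (a n))) \<in> borel_measurable (P x)" for n
      using measurable_compose[OF measurable_coord, of _ k borel] s a x by auto
    show "AE w in P x. (\<lambda>n. k (w (a n))) \<longlonglongrightarrow> k (w s)"
    proof (rule AE_I2)
      fix w assume "w \<in> space (P x)"
      then have w: "w \<in> paths" using x by simp
      have "continuous_on {0..} (\<lambda>s. k (w s))" by (rule path_integrand_continuous[OF w k(1) order_refl])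
      then show "(\<lambda>n. k (w (a n))) \<longlonglongrightarrow> k (w s)"
        by (rule continuous_on_tendsto_compose) (use a s in auto)
    qed
  qed (use k(2) in auto)
qed

text \<open>Fubini's theorem, justified by the bound on \<open>k\<close> over a strip of finite
  measure.\<close>

lemma expectation_path_integral:
  fixes k :: "real \<Rightarrow> real"
  assumes x: "0 \<le> x" and k: "continuous_on UNIV k" "\<And>x. \<bar>k x\<bar> \<le> C" and t: "0 \<le> t"
  shows "(LINT w|P x. integral {0..t} (\<lambda>s. k (w s))) = integral {0..t} (\<lambda>s. LINT w|P x. k (w s))"
proof -
  interpret prob_space "P x" by (rule prob_P[OF x])
  interpret pair: pair_sigma_finite "P x" lborel by unfold_locales
  have sp: "sets (P x \<Otimes>\<^sub>M lborel) = sets (path_space \<Otimes>\<^sub>M lborel)"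
    using x by (intro sets_pair_measure_cong) auto
  have m: "(\<lambda>(w, s). indicator {0..t} s * k (w (max 0 s))) \<in> borel_measurable (P x \<Otimes>\<^sub>M lborel)"
    using path_integrand_measurable[OF k(1), of "\<lambda>_. t"] measurable_cong_sets[OF sp refl] by auto
  have int: "integrable (P x \<Otimes>\<^sub>M lborel) (\<lambda>(w, s). indicator {0..t} s * k (w (max 0 s)))"
  proof (rule integrableI_bounded_set[where A="space (P x) \<times> {0..t}" and B=C])
    show "space (P x) \<times> {0..t} \<in> sets (P x \<Otimes>\<^sub>M lborel)" by (intro pair_measureI) auto
    have "emeasure (P x \<Otimes>\<^sub>M lborel) (space (P x) \<times> {0..t}) = emeasure (P x) (space (P x)) * emeasure lborel {0..t}"
      by (rule lborel.emeasure_pair_measure_Times) auto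
    then show "emeasure (P x \<Otimes>\<^sub>M lborel) (space (P x) \<times> {0..t}) < \<infinity>"
      using t by (simp add: emeasure_space_1)
    show "AE p in P x \<Otimes>\<^sub>M lborel. p \<in> space (P x) \<times> {0..t} \<longrightarrow>
        norm (case p of (w, s) \<Rightarrow> indicator {0..t} s * k (w (max 0 s))) \<le> C"
      using k(2) by (intro AE_I2) (auto split: split_indicator)
    show "AE p in P x \<Otimes>\<^sub>M lborel. p \<notin> space (P x) \<times> {0..t} \<longrightarrow>
        (case p of (w, s) \<Rightarrow> indicator {0..t} s * k (w (max 0 s))) = 0"
      by (intro AE_I2) (auto simp: space_pair_measure indicator_def)
  qed (rule m)
  have "(LINT w|P x. integral {0..t} (\<lambda>s. k (w s))) = (LINT w|P x. (LBINT s. indicator {0..t} s * k (w (max 0 s))))"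
    by (intro Bochner_Integration.integral_cong refl path_integral_eq_lebesgue k(1)) (use x in auto)
  also have "\<dots> = (LBINT s. (LINT w|P x. indicator {0..t} s * k (w (max 0 s))))"
    using pair.Fubini_integral[OF int] by simp
  also have "\<dots> = (LBINT s:{0..t}. (LINT w|P x. k (w s)))"
    unfolding set_lebesgue_integral_def by (intro Bochner_Integration.integral_cong) (auto split: split_indicator)
  also have "\<dots> = integral {0..t} (\<lambda>s. LINT w|P x. k (w s))"
  proof (rule set_borel_integral_eq_integral)
    show "set_integrable lborel {0..t} (\<lambda>s. LINT w|P x. k (w s))"
      by (rule borel_integrable_atLeastAtMost')
         (auto intro: continuous_on_subset[OF expectation_continuous[OF x k]])
  qed
  finally show ?thesis .
qed

end

locale generated_family = instantaneous_family +
  fixes b :: "real \<Rightarrow> real"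
  assumes generated: "generated_on_pos b P" and drift_continuous: "continuous_on {0<..} b"
begin

text \<open>The candidate martingale of the martingale problem for
  \<open>generator b\<close>.\<close>

definition dynkin :: "(real \<Rightarrow> real) \<Rightarrow> (real \<Rightarrow> real) \<Rightarrow> real \<Rightarrow> real" where
  "dynkin g w t = g (w t) - g (w 0) - integral {0..t} (\<lambda>s. generator b g (w s))"

text \<open>The convergence is uniform in the starting point y, so the error bound can be integrated
  against the law of the path at any time.\<close>

lemma generator_limit:
  assumes g: "C2_compact_support_pos g" and e: "0 < e"
  shows "\<exists>d>0. \<forall>h y. 0 < h \<longrightarrow> h < d \<longrightarrow> 0 \<le> y \<longrightarrow>
    \<bar>(LINT w|P y. g (w h)) - g y - h * generator b g y\<bar> \<le> e * h"
proof -
  have "uniform_limit {0..} (\<lambda>t x. ((LINT w|P x. g (w t)) - g x) / t) (generator b g) (at_right 0)"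
    using generated g by (simp add: generated_on_pos_def generator_def)
  from uniform_limitD[OF this e] obtain d where d: "0 < d"
      "\<And>h. 0 < h \<Longrightarrow> h < d \<Longrightarrow> \<forall>y\<in>{0..}. dist (((LINT w|P y. g (w h)) - g y) / h) (generator b g y) < e"
    unfolding eventually_at_right_field by auto
  have "\<bar>(LINT w|P y. g (w h)) - g y - h * generator b g y\<bar> \<le> e * h" if "0 < h" "h < d" "0 \<le> y" for h y
  proof -
    have "\<bar>((LINT w|P y. g (w h)) - g y) / h - generator b g y\<bar> < e"
      using d(2)[OF that(1,2)] that(3) by (auto simp: dist_real_def)
    then have "\<bar>((LINT w|P y. g (w h)) - g y) / h - generator b g y\<bar> * \<bar>h\<bar> \<le> e * \<bar>h\<bar>"
      by (intro mult_right_mono) auto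
    moreover have "(((LINT w|P y. g (w h)) - g y) / h - generator b g y) * h = (LINT w|P y. g (w h)) - g y - h * generator b g y"
      using that(1) by (subst left_diff_distrib) simp
    ultimately have "\<bar>(LINT w|P y. g (w h)) - g y - h * generator b g y\<bar> \<le> e * \<bar>h\<bar>"
      by (simp only: abs_mult[symmetric])
    then show ?thesis using that(1) by simp
  qed
  with d(1) show ?thesis by blast
qed

text \<open>The Markov property and the uniform generator limit show that the expectation
  \<open>\<phi>\<close> of g along the path has derivative \<open>\<gamma>\<close>, the expectation
  of the generator; integrating gives the formula.\<close>

lemma dynkin_fixed:
  assumes g: "C2_compact_support_pos g" and x: "0 \<le> x" and t: "0 \<le> t"
  shows "(LINT w|P x. dynkin g w t) = 0"
proof -
  interpret prob_space "P x" by (rule prob_P[OF x])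
  obtain C where C: "0 \<le> C" "\<And>x. \<bar>g x\<bar> \<le> C" "\<And>x. \<bar>generator b g x\<bar> \<le> C"
    using test_function_bounds[OF drift_continuous g] by blast
  note cont = generator_continuous_support(1)[OF drift_continuous g]
  have gm[measurable]: "g \<in> borel_measurable borel"
    using C2_compact_support_posD(3)[OF g] by (rule borel_measurable_continuous_onI)
  have Gm[measurable]: "generator b g \<in> borel_measurable borel"
    using cont by (rule borel_measurable_continuous_onI)
  note gc = measurable_compose[OF measurable_coord gm] and Gc = measurable_compose[OF measurable_coord Gm]
  define \<phi> where "\<phi> s = (LINT w|P x. g (w s))" for s
  define \<gamma> where "\<gamma> s = (LINT w|P x. generator b g (w s))" for s
  have step: "\<bar>\<phi> (s + h) - \<phi> s - h * \<gamma> s\<bar> \<le> e * h"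
    if s: "0 \<le> s" and h: "0 < h" and d: "\<And>y. 0 \<le> y \<Longrightarrow> \<bar>(LINT w|P y. g (w h)) - g y - h * generator b g y\<bar> \<le> e * h" for s h e
  proof -
    have st: "stopping_time path_filtration (\<lambda>_. s)" by (rule stopping_time_const)
    have "(LINT w:paths|P x. g (shift_path s w h)) = (LINT w:paths|P x. (LINT v|P (w s). g (v h)))"
      by (rule strong_markov_integral[OF x st _ space_in_pre_sigma, of "\<lambda>w. g (w h)" C])
         (use s h C gc in auto)
    moreover have "(LINT w:paths|P x. k w) = (LINT w|P x. k w)" for k :: "_ \<Rightarrow> real"
      unfolding set_lebesgue_integral_def by (intro Bochner_Integration.integral_cong refl) (use x in simp)
    ultimately have m: "\<phi> (s + h) = (LINT w|P x. (LINT v|P (w s). g (v h)))"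
      using h by (simp add: \<phi>_def shift_path_def)
    have mP: "(\<lambda>w. LINT v|P (w s). g (v h)) \<in> borel_measurable path_space"
      by (rule measurable_kernel_integral) (use s h gc path_spaceD(2) measurable_coord in auto)
    have i: "integrable (P x) (\<lambda>w. LINT v|P (w s). g (v h))"
      by (rule integrable_bounded[OF x mP, of C]) (use abs_integral_le[of _ "\<lambda>v. g (v h)" C] C h s gc path_spaceD(2) in auto)
    have i2: "integrable (P x) (\<lambda>w. g (w s))" by (rule integrable_bounded[OF x, of _ C]) (use C gc s in auto)
    have i3: "integrable (P x) (\<lambda>w. generator b g (w s))" by (rule integrable_bounded[OF x, of _ C]) (use C Gc s in auto)
    have "\<phi> (s + h) - \<phi> s - h * \<gamma> s = (LINT w|P x. (LINT v|P (w s). g (v h)) - g (w s) - h * generator b g (w s))"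
      unfolding m \<phi>_def[of s] \<gamma>_def using i i2 i3 by simp
    also have "\<bar>\<dots>\<bar> \<le> e * h"
      by (rule abs_integral_le[OF x]) (use mP gc Gc s d path_spaceD(2) in auto)
    finally show ?thesis .
  qed
  have \<gamma>c: "continuous_on {0..t} \<gamma>"
    unfolding \<gamma>_def by (rule continuous_on_subset[OF expectation_continuous[OF x cont C(3)]]) auto
  have "(\<phi> has_vector_derivative \<gamma> s) (at s within {0..t})" if s: "s \<in> {0..t}" for s
    unfolding has_vector_derivative_def has_derivative_within_alt
  proof (intro conjI allI impI)
    show "bounded_linear (\<lambda>h. h *\<^sub>R \<gamma> s)" by (rule bounded_linear_scaleR_left)
    fix e :: real assume e: "0 < e"
    obtain d where d: "0 < d" "\<And>h y. 0 < h \<Longrightarrow> h < d \<Longrightarrow> 0 \<le> y \<Longrightarrow>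
        \<bar>(LINT w|P y. g (w h)) - g y - h * generator b g y\<bar> \<le> e / 2 * h"
      using generator_limit[OF g half_gt_zero[OF e]] by blast
    obtain d' where d': "0 < d'" "\<And>r. r \<in> {0..t} \<Longrightarrow> dist r s < d' \<Longrightarrow> dist (\<gamma> r) (\<gamma> s) < e / 2"
      using \<gamma>c s e unfolding continuous_on_iff by (meson half_gt_zero)
    show "\<exists>d>0. \<forall>y\<in>{0..t}. norm (y - s) < d \<longrightarrow> norm (\<phi> y - \<phi> s - (y - s) *\<^sub>R \<gamma> s) \<le> e * norm (y - s)"
    proof (intro exI conjI ballI impI)
      show "0 < min d d'" using d d' by simp
      fix y assume y: "y \<in> {0..t}" "norm (y - s) < min d d'"
      consider "y = s" | "s < y" | "y < s" by linarith
      then show "norm (\<phi> y - \<phi> s - (y - s) *\<^sub>R \<gamma> s) \<le> e * norm (y - s)"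
      proof cases
        case 2
        have "\<bar>\<phi> (s + (y - s)) - \<phi> s - (y - s) * \<gamma> s\<bar> \<le> e / 2 * (y - s)"
          by (rule step) (use s y 2 d in auto)
        also have "\<dots> \<le> e * (y - s)" using e 2 by (intro mult_right_mono) auto
        finally show ?thesis using 2 by simp
      next
        \<comment> \<open>For the left derivative the increment starts at y, so its slope is
          \<open>\<gamma> y\<close>; continuity of \<open>\<gamma>\<close> moves it to s at the cost
          of the other e/2.\<close>
        case 3
        have "\<bar>\<phi> (y + (s - y)) - \<phi> y - (s - y) * \<gamma> y\<bar> \<le> e / 2 * (s - y)"
          by (rule step) (use s y 3 d in auto)
        moreover have "\<bar>(s - y) * (\<gamma> y - \<gamma> s)\<bar> \<le> (s - y) * (e / 2)"
          unfolding abs_mult using d'(2)[OF y(1)] y 3 by (intro mult_mono) (auto simp: dist_real_def)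
        moreover have "\<phi> y - \<phi> s - (y - s) * \<gamma> s = - (\<phi> (y + (s - y)) - \<phi> y - (s - y) * \<gamma> y) - (s - y) * (\<gamma> y - \<gamma> s)"
          by (simp add: algebra_simps)
        ultimately have "\<bar>\<phi> y - \<phi> s - (y - s) * \<gamma> s\<bar> \<le> e / 2 * (s - y) + (s - y) * (e / 2)" by linarith
        then show ?thesis using 3 by (simp add: field_simps)
      qed simp
    qed
  qed
  then have "(\<gamma> has_integral \<phi> t - \<phi> 0) {0..t}"
    by (intro fundamental_theorem_of_calculus t)
  then have ftc: "integral {0..t} \<gamma> = \<phi> t - \<phi> 0" by (rule integral_unique)
  have i: "integrable (P x) (\<lambda>w. g (w s))" if "0 \<le> s" for s
    by (rule integrable_bounded[OF x, of _ C]) (use C gc that in auto)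
  have i2: "integrable (P x) (\<lambda>w. integral {0..t} (\<lambda>s. generator b g (w s)))"
    by (rule integrable_bounded[OF x, of _ "C * t"])
       (auto intro: measurable_path_integral cont path_integral_bound C t)
  have "(LINT w|P x. dynkin g w t) = \<phi> t - \<phi> 0 - (LINT w|P x. integral {0..t} (\<lambda>s. generator b g (w s)))"
    unfolding dynkin_def \<phi>_def using i[OF t] i[of 0] i2 by simp
  also have "\<dots> = 0"
    unfolding expectation_path_integral[OF x cont C(3) t] using ftc by (simp add: \<gamma>_def[abs_def])
  finally show ?thesis .
qed

text \<open>Additivity along shifts, which lets the Markov property reduce an increment after s to
  one that starts at time 0.\<close>

lemma dynkin_shift:
  assumes g: "C2_compact_support_pos g" and w: "w \<in> paths" and s: "0 \<le> s" "0 \<le> h"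
  shows "dynkin g w (s + h) - dynkin g w s = dynkin g (shift_path s w) h"
proof -
  note cont = generator_continuous_support(1)[OF drift_continuous g]
  let ?k = "\<lambda>u. generator b g (w u)"
  have "integral {0..s} ?k + integral {s..s + h} ?k = integral {0..s + h} ?k"
    by (rule Henstock_Kurzweil_Integration.integral_combine)
       (use s in \<open>auto intro!: integrable_continuous_interval path_integrand_continuous[OF w cont]\<close>)
  moreover have "integral {s..s + h} ?k = integral {0..h} (\<lambda>u. ?k (u + s))"
    using integral_shift_Icc_real[of 0 h ?k s] by (simp add: add.commute o_def)
  moreover have "integral {0..h} (\<lambda>u. ?k (u + s)) = integral {0..h} (\<lambda>u. generator b g (shift_path s w u))"
    by (rule integral_cong) (auto simp: shift_path_def add.commute)
  ultimately show ?thesis using s by (simp add: dynkin_def shift_path_def)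
qed

text \<open>Optional stopping, by approximating \<open>T\<close> from above on the grid of mesh \<open>1 / m\<close>.\<close>

lemma dynkin_stopping:
  assumes g: "C2_compact_support_pos g" and x: "0 \<le> x" and T: "stopping_time path_filtration T"
    and pos: "\<And>w. w \<in> paths \<Longrightarrow> 0 \<le> T w" and bd: "\<And>w. w \<in> paths \<Longrightarrow> T w \<le> real N"
  shows "(LINT w|P x. dynkin g w (T w)) = 0"
proof -
  interpret prob_space "P x" by (rule prob_P[OF x])
  obtain C where C: "0 \<le> C" "\<And>x. \<bar>g x\<bar> \<le> C" "\<And>x. \<bar>generator b g x\<bar> \<le> C"
    using test_function_bounds[OF drift_continuous g] by blast
  note cont = generator_continuous_support(1)[OF drift_continuous g]
  have gm: "g \<in> borel_measurable borel"
    using C2_compact_support_posD(3)[OF g] by (rule borel_measurable_continuous_onI)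
  note Tm[measurable] = measurable_stopping[OF T]
  have Dm: "(\<lambda>w. dynkin g w (f w)) \<in> borel_measurable path_space"
    if "f \<in> borel_measurable path_space" "\<And>w. w \<in> paths \<Longrightarrow> 0 \<le> f w" for f
    unfolding dynkin_def
    by (intro borel_measurable_diff measurable_path_integral cont that(1)
          measurable_compose[OF measurable_coord gm] measurable_compose[OF measurable_eval[where g="\<lambda>w. w", OF that(1)] gm])
       (use that in auto)
  have Db: "\<bar>dynkin g w t\<bar> \<le> 2 * C + C * t" if "w \<in> paths" "0 \<le> t" for w t
    unfolding dynkin_def using path_integral_bound[OF that(1) cont C(3) that(2)] C(2)[of "w t"] C(2)[of "w 0"] by linarith
  \<comment> \<open>The event \<open>s \<le> T w\<close> is already decided at time s, so by the
    Markov property the increment after s has mean zero on it.\<close>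
  have incr: "(LINT w:{w \<in> paths. s \<le> T w}|P x. dynkin g w (s + h) - dynkin g w s) = 0"
    if s: "0 \<le> s" and h: "0 \<le> h" for s h
  proof -
    let ?A = "{w \<in> paths. s \<le> T w}"
    have st: "stopping_time path_filtration (\<lambda>_. s)" by (rule stopping_time_const)
    have A: "?A \<in> sets (path_pre_sigma (\<lambda>_. s))"
    proof (rule pre_sigmaI_agree[OF st _ s])
      show "?A \<in> sets path_space" by measurable
      fix w v t assume *: "w \<in> ?A" "v \<in> paths" "\<And>r. 0 \<le> r \<Longrightarrow> r \<le> t \<Longrightarrow> w r = v r" "s < t"
      show "v \<in> ?A"
      proof (rule ccontr)
        assume "v \<notin> ?A"
        then have lt: "T v < s" using *(2) by simp
        have "T w = T v"
          by (rule pre_sigma_agree(2)[OF T space_in_pre_sigma, of w t v]) (use *(1,2,4) *(3)[symmetric] lt in auto)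
        then show False using lt *(1) by simp
      qed
    qed
    have "(LINT w:?A|P x. dynkin g w (s + h) - dynkin g w s) = (LINT w:?A|P x. dynkin g (shift_path s w) h)"
      unfolding set_lebesgue_integral_def
      by (intro Bochner_Integration.integral_cong refl) (use dynkin_shift[OF g _ s h] x in auto)
    also have "\<dots> = (LINT w:?A|P x. (LINT v|P (w s). dynkin g v h))"
      by (rule strong_markov_integral[OF x st s A, of "\<lambda>w. dynkin g w h" "2 * C + C * h"])
         (use Dm[of "\<lambda>_. h"] Db h in auto)
    also have "\<dots> = (LINT w:?A|P x. 0)"
      unfolding set_lebesgue_integral_def
      by (intro Bochner_Integration.integral_cong refl) (use dynkin_fixed[OF g _ h] path_spaceD(2) s x in auto)
    finally show ?thesis by (simp add: set_lebesgue_integral_def)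
  qed
  \<comment> \<open>The first grid point strictly above \<open>T\<close>; strictness makes the j-th
    increment count exactly when its left end is at most \<open>T\<close>.\<close>
  define T' where "T' m w = (of_int \<lfloor>real (Suc m) * T w\<rfloor> + 1) / real (Suc m)" for m :: nat and w
  have T'm: "T' m \<in> borel_measurable path_space" for m unfolding T'_def[abs_def] by measurable
  have T'less: "T w < T' m w" and T'le: "T' m w \<le> T w + 1 / real (Suc m)" for m w
  proof -
    have "real (Suc m) * T w < of_int \<lfloor>real (Suc m) * T w\<rfloor> + 1" "of_int \<lfloor>real (Suc m) * T w\<rfloor> + 1 \<le> real (Suc m) * T w + 1" by linarith+
    then show "T w < T' m w" "T' m w \<le> T w + 1 / real (Suc m)"
      unfolding T'_def by (simp_all only: pos_less_divide_eq pos_divide_le_eq of_nat_0_less_iff zero_less_Suc)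
         (simp_all add: field_simps del: of_nat_Suc)
  qed
  have zero: "(LINT w|P x. dynkin g w (T' m w)) = 0" for m
  proof -
    let ?q = "\<lambda>j::nat. real j / real (Suc m)"
    \<comment> \<open>The bound \<open>T w \<le> real N\<close> keeps the grid index of
      \<open>T' m w\<close> at most \<open>?J\<close>, so one finite sum serves all paths.\<close>
    let ?J = "Suc m * N + 1"
    let ?I = "\<lambda>j w. indicator {w \<in> paths. ?q j \<le> T w} w * (dynkin g w (?q j + 1 / real (Suc m)) - dynkin g w (?q j))"
    have sum: "dynkin g w (T' m w) = (\<Sum>j<?J. ?I j w)" if w: "w \<in> paths" for w
    proof -
      define n where "n = nat \<lfloor>real (Suc m) * T w\<rfloor> + 1"
      have fl: "0 \<le> \<lfloor>real (Suc m) * T w\<rfloor>" using pos[OF w] by simp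
      have Tn: "T' m w = ?q n" using fl by (simp add: T'_def n_def)
      have "real (Suc m) * T w \<le> real (Suc m * N)" using bd[OF w] by (simp only: of_nat_mult) (rule mult_left_mono, auto)
      then have "nat \<lfloor>real (Suc m) * T w\<rfloor> \<le> Suc m * N" by linarith
      then have nJ: "n \<le> ?J" by (simp add: n_def)
      have ind: "?q j \<le> T w \<longleftrightarrow> j < n" for j
      proof -
        have "?q j \<le> T w \<longleftrightarrow> real j \<le> real (Suc m) * T w"
          by (subst pos_divide_le_eq) (auto simp: mult.commute)
        also have "\<dots> \<longleftrightarrow> int j \<le> \<lfloor>real (Suc m) * T w\<rfloor>" by (simp add: le_floor_iff)
        also have "\<dots> \<longleftrightarrow> j < n" unfolding n_def using fl by linarith
        finally show ?thesis .
      qed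
      have "?q j + 1 / real (Suc m) = ?q (Suc j)" for j by (simp add: add_divide_distrib)
      then have "(\<Sum>j<?J. ?I j w) = (\<Sum>j<?J. if j < n then dynkin g w (?q (Suc j)) - dynkin g w (?q j) else 0)"
        using w by (intro sum.cong) (auto simp: ind simp del: of_nat_Suc)
      also have "\<dots> = (\<Sum>j<n. dynkin g w (?q (Suc j)) - dynkin g w (?q j))"
        using nJ by (intro sum.mono_neutral_cong_right) auto
      also have "\<dots> = dynkin g w (?q n) - dynkin g w (?q 0)" by (rule sum_lessThan_telescope)
      finally show ?thesis by (simp add: Tn dynkin_def)
    qed
    have qm: "0 \<le> ?q j" for j by simp
    have int: "integrable (P x) (?I j)" for j
    proof (rule integrable_bounded[OF x])
      have [measurable]: "(\<lambda>w. dynkin g w (?q j + 1 / real (Suc m))) \<in> borel_measurable path_space"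
           "(\<lambda>w. dynkin g w (?q j)) \<in> borel_measurable path_space"
        by (intro Dm; simp)+
      show "?I j \<in> borel_measurable path_space" by measurable
      fix w assume w: "w \<in> paths"
      show "\<bar>?I j w\<bar> \<le> (2 * C + C * (?q j + 1 / real (Suc m))) + (2 * C + C * ?q j)"
        using Db[OF w, of "?q j + 1 / real (Suc m)"] Db[OF w qm, of j] C(1)
        by (auto split: split_indicator intro!: add_nonneg_nonneg)
    qed
    have "(LINT w|P x. dynkin g w (T' m w)) = (LINT w|P x. (\<Sum>j<?J. ?I j w))"
      by (rule Bochner_Integration.integral_cong) (use sum x in auto)
    also have "\<dots> = (\<Sum>j<?J. (LINT w|P x. ?I j w))"
      by (rule Bochner_Integration.integral_sum) (rule int)
    also have "\<dots> = 0"
      using incr[OF qm, of "1 / real (Suc m)"] by (simp add: set_lebesgue_integral_def)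
    finally show ?thesis .
  qed
  have "(\<lambda>m. LINT w|P x. dynkin g w (T' m w)) \<longlonglongrightarrow> (LINT w|P x. dynkin g w (T w))"
  proof (rule integral_dominated_convergence[where w="\<lambda>_. 2 * C + C * (real N + 1)"])
    show "(\<lambda>w. dynkin g w (T w)) \<in> borel_measurable (P x)" using Dm[OF Tm pos] x by simp
    have p: "0 \<le> T' m w" if "w \<in> paths" for m w using pos[OF that] T'less[of w m] by simp
    show "(\<lambda>w. dynkin g w (T' m w)) \<in> borel_measurable (P x)" for m
      using Dm[OF T'm p] x by simp
    show "AE w in P x. norm (dynkin g w (T' m w)) \<le> 2 * C + C * (real N + 1)" for m
    proof (rule AE_I2)
      fix w assume "w \<in> space (P x)"
      then have w: "w \<in> paths" using x by simp
      have "1 / real (Suc m) \<le> 1" by simp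
      then have "T' m w \<le> real N + 1" using T'le[of m w] bd[OF w] by linarith
      then have "C * T' m w \<le> C * (real N + 1)" using C(1) by (rule mult_left_mono)
      then show "norm (dynkin g w (T' m w)) \<le> 2 * C + C * (real N + 1)" using Db[OF w p[OF w], of m] by simp
    qed
    show "AE w in P x. (\<lambda>m. dynkin g w (T' m w)) \<longlonglongrightarrow> dynkin g w (T w)"
    proof (rule AE_I2)
      fix w assume "w \<in> space (P x)"
      then have w: "w \<in> paths" using x by simp
      have "(\<lambda>m. T w + 1 / real (Suc m)) \<longlonglongrightarrow> T w + 0"
        using LIMSEQ_inverse_real_of_nat by (intro tendsto_add tendsto_const) (simp add: inverse_eq_divide)
      then have "(\<lambda>m. T' m w) \<longlonglongrightarrow> T w"
        using T'less[of w] T'le[of _ w]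
        by (intro tendsto_sandwich[of "\<lambda>_. T w" "\<lambda>m. T' m w" sequentially "\<lambda>m. T w + 1 / real (Suc m)"])
           (auto intro!: always_eventually less_imp_le simp del: of_nat_Suc)
      moreover have "continuous_on {0..real N + 1} (dynkin g w)"
        unfolding dynkin_def
        by (intro continuous_on_diff continuous_on_const indefinite_integral_continuous_1 integrable_continuous_interval
             path_integrand_continuous[OF w] cont C2_compact_support_posD(3)[OF g]) auto
      moreover have "T' m w \<in> {0..real N + 1}" for m
      proof -
        have "1 / real (Suc m) \<le> 1" by simp
        then show ?thesis using p[OF w, of m] T'le[of m w] bd[OF w] unfolding atLeastAtMost_iff by linarith
      qed
      ultimately show "(\<lambda>m. dynkin g w (T' m w)) \<longlonglongrightarrow> dynkin g w (T w)"
        using pos[OF w] bd[OF w] by (intro continuous_on_tendsto_compose[of "{0..real N + 1}" "dynkin g w"]) auto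
    qed
  qed simp
  then show ?thesis by (simp add: zero LIMSEQ_const_iff)
qed

end

subsection \<open>The generator of the time-changed family\<close>

locale time_changed_generator = generated_family +
  fixes b' :: "real \<Rightarrow> real"
  assumes changed_drift: "0 < x \<Longrightarrow> b' (x\<^sup>2) = (1 + 2 * x * b x) / (4 * x\<^sup>2)"
begin

lemma changed_drift_continuous: "continuous_on {0<..} b'"
proof -
  have eq: "b' y = (1 + 2 * sqrt y * b (sqrt y)) / (4 * y)" if "y \<in> {0<..}" for y
    using changed_drift[of "sqrt y"] that by simp
  have "continuous_on {0<..} (\<lambda>y. (1 + 2 * sqrt y * b (sqrt y)) / (4 * y))"
    by (intro continuous_intros continuous_on_compose2[OF drift_continuous]) auto
  then show ?thesis
    by (subst continuous_on_cong[of "{0<..}" "{0<..}" b' "\<lambda>y. (1 + 2 * sqrt y * b (sqrt y)) / (4 * y)"])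
       (simp_all add: eq)
qed

text \<open>Substitution along the clock, whose derivative \<open>4 * (w s)\<^sup>2\<close> is
  exactly the factor between the two generators.\<close>

lemma dynkin_time_change:
  assumes f: "C2_compact_support_pos f" and w: "w \<in> paths" and ub: "clock_unbounded w" and t: "0 \<le> t"
  shows "dynkin (square_pullback f) w t = f (time_change w (clock w t)) - f (time_change w 0)
     - integral {0..clock w t} (\<lambda>s. generator b' f (time_change w s))"
proof -
  note cont = generator_continuous_support(1)[OF changed_drift_continuous f]
  have "((\<lambda>s. (4 * (w s)\<^sup>2) *\<^sub>R generator b' f (time_change w (clock w s))) has_integral
     (integral {clock w 0..clock w t} (\<lambda>s. generator b' f (time_change w s)))) {0..t}"
  proof (rule has_integral_substitution[where c=0 and d="clock w t"])
    show "clock w ` {0..t} \<subseteq> {0..clock w t}" using clock_nonneg clock_mono[OF w] by auto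
    show "continuous_on {0..clock w t} (\<lambda>s. generator b' f (time_change w s))"
      by (rule path_integrand_continuous[OF time_change_in_space[OF w ub] cont]) auto
    show "(clock w has_real_derivative 4 * (w s)\<^sup>2) (at s within {0..t})" if "s \<in> {0..t}" for s
      by (rule clock_deriv[OF w]) (use that in auto)
  qed (use t clock_nonneg in auto)
  then have "integral {0..clock w t} (\<lambda>s. generator b' f (time_change w s))
      = integral {0..t} (\<lambda>s. (4 * (w s)\<^sup>2) *\<^sub>R generator b' f (time_change w (clock w s)))"
    by (simp add: integral_unique)
  also have "\<dots> = integral {0..t} (\<lambda>s. generator b (square_pullback f) (w s))"
  proof (rule integral_cong)
    fix s assume s: "s \<in> {0..t}"
    have "generator b (square_pullback f) (w s) = 4 * (w s)\<^sup>2 * generator b' f ((w s)\<^sup>2)"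
      by (rule generator_square_pullback[OF f _ changed_drift]) (use path_spaceD(2)[OF w] s in auto)
    then show "(4 * (w s)\<^sup>2) *\<^sub>R generator b' f (time_change w (clock w s)) = generator b (square_pullback f) (w s)"
      using time_change_clock[OF w ub, of s] s by simp
  qed
  finally show ?thesis
    using time_change_clock[OF w ub t] time_change_0[OF w ub] square_pullback(4)[OF f, of "w t"]
      square_pullback(4)[OF f, of "w 0"] path_spaceD(2)[OF w] t
    by (simp add: dynkin_def)
qed

text \<open>The inverse clock at u has no deterministic bound, so optional stopping is applied to
  its truncation \<open>S n\<close>. In the changed time scale the integral runs over at most [0,u],
  and \<open>2 * C + C * u\<close> dominates for all n.\<close>

lemma changed_dynkin:
  assumes f: "C2_compact_support_pos f" and y: "0 \<le> y" and u: "0 \<le> u"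
  shows "(LINT w|changed_law y. f (w u) - f (w 0) - integral {0..u} (\<lambda>s. generator b' f (w s))) = 0"
proof -
  define x where "x = sqrt y"
  have x: "0 \<le> x" using y by (simp add: x_def)
  interpret prob_space "P x" by (rule prob_P[OF x])
  note cont = generator_continuous_support(1)[OF changed_drift_continuous f]
  obtain C where C: "0 \<le> C" "\<And>x. \<bar>f x\<bar> \<le> C" "\<And>x. \<bar>generator b' f x\<bar> \<le> C"
    using test_function_bounds[OF changed_drift_continuous f] by blast
  let ?g = "square_pullback f"
  have u': "\<forall>w\<in>paths. 0 \<le> u" using u by simp
  define S where "S = original_time (\<lambda>_. u)"
  define D where "D v = f (v u) - f (v 0) - integral {0..u} (\<lambda>s. generator b' f (v s))" for v
  note S0 = original_time_nonneg[of _ "\<lambda>_. u", folded S_def] and Sm = measurable_original_time[OF stopping_time_const u', folded S_def]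
    and Sst = stopping_time_original_time[OF stopping_time_const u', folded S_def]
  have Sless: "S n w < t \<longleftrightarrow> real n < t \<or> u < clock w t" if "w \<in> paths" "0 \<le> t" for n w t
    using original_time_less_iff[OF stopping_time_const u' that, of n, folded S_def]
    by (cases "real n < t") (auto simp: S_def original_time_def min_less_iff_disj)
  have zero: "(LINT w|P x. dynkin ?g w (S n w)) = 0" for n
    by (rule dynkin_stopping[OF square_pullback(1)[OF f] x Sst S0, of n n]) (auto simp: S_def original_time_def)
  have fm: "f \<in> borel_measurable borel"
    using C2_compact_support_posD(3)[OF f] by (rule borel_measurable_continuous_onI)
  have Dm: "D \<in> borel_measurable path_space"
    unfolding D_def
    by (intro borel_measurable_diff measurable_compose[OF measurable_coord fm] measurable_path_integral cont) (use u in auto)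
  have gm: "?g \<in> borel_measurable borel"
    using C2_compact_support_posD(3)[OF square_pullback(1)[OF f]] by (rule borel_measurable_continuous_onI)
  have "(\<lambda>n. LINT w|P x. dynkin ?g w (S n w)) \<longlonglongrightarrow> (LINT w|P x. D (changed_path w))"
  proof (rule integral_dominated_convergence[where w="\<lambda>_. 2 * C + C * u"])
    show "(\<lambda>w. D (changed_path w)) \<in> borel_measurable (P x)"
      using measurable_compose[OF measurable_changed_path Dm] x by simp
    have "(\<lambda>w. dynkin ?g w (S n w)) \<in> borel_measurable path_space" for n
      unfolding dynkin_def
      by (intro borel_measurable_diff measurable_path_integral Sm measurable_compose[OF measurable_coord gm]
           generator_continuous_support(1)[OF drift_continuous square_pullback(1)[OF f]]
           measurable_compose[OF measurable_eval[where g="\<lambda>w. w", OF Sm] gm]) (use S0 in auto)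
    then show "(\<lambda>w. dynkin ?g w (S n w)) \<in> borel_measurable (P x)" for n using x by simp
    have ubAE: "AE w in P x. w \<in> space (P x) \<and> clock_unbounded w" using clock_unbounded_AE[OF x] by auto
    show "AE w in P x. (\<lambda>n. dynkin ?g w (S n w)) \<longlonglongrightarrow> D (changed_path w)"
      using ubAE
    proof eventually_elim
      fix w assume "w \<in> space (P x) \<and> clock_unbounded w"
      then have w: "w \<in> paths" and ub: "clock_unbounded w" using x by auto
      let ?t = "inverse_clock w u"
      have t: "0 \<le> ?t" by (rule inverse_clock_nonneg[OF w ub])
      obtain n0 :: nat where n0: "?t < real n0" using reals_Archimedean2 by blast
      have "S n w = ?t" if "n0 \<le> n" for n
      proof -
        have tn: "?t < real n" using n0 that by simp
        have "S n w < s \<longleftrightarrow> ?t < s" if "0 \<le> s" for s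
          using Sless[OF w that, of n] inverse_clock_less_iff[OF w ub u that] tn by auto
        from this[OF t] this[OF S0[OF w, of n]] show ?thesis by simp
      qed
      moreover have "dynkin ?g w ?t = D (changed_path w)"
        using dynkin_time_change[OF f w ub t] clock_inverse_clock[OF w ub u]
        by (simp add: D_def changed_path_eq[OF ub])
      ultimately have "\<forall>\<^sub>F n in sequentially. dynkin ?g w (S n w) = D (changed_path w)"
        unfolding eventually_sequentially by (intro exI[of _ n0]) simp
      then show "(\<lambda>n. dynkin ?g w (S n w)) \<longlonglongrightarrow> D (changed_path w)" by (rule tendsto_eventually)
    qed
    show "AE w in P x. norm (dynkin ?g w (S n w)) \<le> 2 * C + C * u" for n
      using ubAE
    proof eventually_elim
      fix w assume "w \<in> space (P x) \<and> clock_unbounded w"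
      then have w: "w \<in> paths" and ub: "clock_unbounded w" using x by auto
      have le: "clock w (S n w) \<le> u" using Sless[OF w S0[OF w], of n n] by auto
      have "\<bar>integral {0..clock w (S n w)} (\<lambda>s. generator b' f (time_change w s))\<bar> \<le> C * clock w (S n w)"
        by (rule path_integral_bound[OF time_change_in_space[OF w ub] cont C(3) clock_nonneg])
      also have "\<dots> \<le> C * u" using le C(1) by (rule mult_left_mono)
      finally show "norm (dynkin ?g w (S n w)) \<le> 2 * C + C * u"
        using C(2)[of "time_change w (clock w (S n w))"] C(2)[of "time_change w 0"]
        unfolding dynkin_time_change[OF f w ub S0[OF w]] real_norm_def by linarith
    qed
  qed simp
  then have "(LINT w|P x. D (changed_path w)) = 0" by (simp add: zero LIMSEQ_const_iff)
  moreover have "(LINT w|changed_law y. D w) = (LINT w|P x. D (changed_path w))"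
    unfolding changed_law_def x_def[symmetric]
    by (rule integral_distr) (use x measurable_changed_path Dm in auto)
  ultimately show ?thesis by (simp add: D_def)
qed

text \<open>\<open>generator b' f\<close> is continuous but in general not a test function, so the
  bound linear in u is available only for a test function \<open>k\<close> near it. Replacing one by
  the other twice and moving \<open>k\<close> costs three times e/6, the e/2 of
  \<open>close\<close>.\<close>

lemma changed_generated: "generated_on_pos b' changed_law"
proof -
  interpret Q: strong_markov_family changed_law by unfold_locales (rule changed_strong_markov_laws)
  have increment: "(LINT w|changed_law y. f (w u)) - f y = integral {0..u} (\<lambda>s. LINT w|changed_law y. generator b' f (w s))"
    and bound: "\<exists>C. \<forall>y\<ge>0. \<forall>u\<ge>0. \<bar>(LINT w|changed_law y. f (w u)) - f y\<bar> \<le> C * u"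
    if f: "C2_compact_support_pos f" and yu: "0 \<le> y" "0 \<le> u" for f y u
  proof -
    note cont = generator_continuous_support(1)[OF changed_drift_continuous f]
    obtain C where C: "0 \<le> C" "\<And>x. \<bar>f x\<bar> \<le> C" "\<And>x. \<bar>generator b' f x\<bar> \<le> C"
      using test_function_bounds[OF changed_drift_continuous f] by blast
    have fm: "f \<in> borel_measurable borel"
      using C2_compact_support_posD(3)[OF f] by (rule borel_measurable_continuous_onI)
    have *: "(LINT w|changed_law y. f (w u)) - f y = (LINT w|changed_law y. integral {0..u} (\<lambda>s. generator b' f (w s)))"
      if y: "0 \<le> y" and u: "0 \<le> u" for y u
    proof -
      interpret prob_space "changed_law y" by (rule Q.prob_P[OF y])
      have i1: "integrable (changed_law y) (\<lambda>w. f (w s))" if "0 \<le> s" for s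
        by (rule Q.integrable_bounded[OF y measurable_compose[OF measurable_coord fm]]) (use that C in auto)
      have i2: "integrable (changed_law y) (\<lambda>w. integral {0..u} (\<lambda>s. generator b' f (w s)))"
        by (rule Q.integrable_bounded[OF y measurable_path_integral[OF cont]]) (auto intro: path_integral_bound cont C u)
      have "(LINT w|changed_law y. f (w 0)) = (LINT w|changed_law y. f y)"
        by (rule integral_cong_AE)
           (use Q.AE_start[OF y] measurable_compose[OF measurable_coord[of 0] fm] y in \<open>auto elim!: eventually_mono\<close>)
      then show ?thesis
        using changed_dynkin[OF f y u] i1[OF u] i1[of 0] i2 by (simp add: prob_space)
    qed
    show "(LINT w|changed_law y. f (w u)) - f y = integral {0..u} (\<lambda>s. LINT w|changed_law y. generator b' f (w s))"
      unfolding *[OF yu] by (rule Q.expectation_path_integral[OF yu(1) cont C(3) yu(2)])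
    show "\<exists>C. \<forall>y\<ge>0. \<forall>u\<ge>0. \<bar>(LINT w|changed_law y. f (w u)) - f y\<bar> \<le> C * u"
    proof (intro exI allI impI)
      fix y u :: real assume y: "0 \<le> y" and u: "0 \<le> u"
      show "\<bar>(LINT w|changed_law y. f (w u)) - f y\<bar> \<le> C * u"
        unfolding *[OF y u]
        by (rule Q.abs_integral_le[OF y measurable_path_integral[OF cont]]) (auto intro: path_integral_bound cont C u)
    qed
  qed
  show ?thesis
    unfolding generated_on_pos_def
  proof (intro allI impI uniform_limitI)
    fix f and e :: real assume f: "C2_compact_support_pos f" and e: "0 < e"
    let ?h = "generator b' f"
    note cont = generator_continuous_support(1)[OF changed_drift_continuous f]
    obtain l r where lr: "0 < l" "\<And>x. x \<notin> {l..r} \<Longrightarrow> ?h x = 0"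
      using generator_continuous_support(2)[OF changed_drift_continuous f] by blast
    then obtain C where C: "0 \<le> C" "\<And>x. \<bar>?h x\<bar> \<le> C"
      using compact_support_bounded[OF cont] by blast
    have e6: "0 < e / 6" using e by simp
    obtain k where k: "C2_compact_support_pos k" "\<And>x. \<bar>k x - ?h x\<bar> \<le> e / 6"
      using C2_approximation[OF cont lr e6] by blast
    obtain K where K: "\<And>y u. 0 \<le> y \<Longrightarrow> 0 \<le> u \<Longrightarrow> \<bar>(LINT w|changed_law y. k (w u)) - k y\<bar> \<le> K * u"
      using bound[OF k(1), of 0 0] by auto
    \<comment> \<open>Up to time \<open>d\<close> the bound \<open>K * v\<close> is at most e/6;
      adding 1 keeps the denominator positive.\<close>
    define d where "d = e / (6 * (\<bar>K\<bar> + 1))"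
    have d: "0 < d" using e by (simp add: d_def)
    have close: "\<bar>(LINT w|changed_law y. ?h (w v)) - ?h y\<bar> \<le> e / 2" if y: "0 \<le> y" and v: "0 \<le> v" "v \<le> d" for y v
    proof -
      interpret prob_space "changed_law y" by (rule Q.prob_P[OF y])
      have km: "k \<in> borel_measurable borel" "?h \<in> borel_measurable borel"
        using C2_compact_support_posD(3)[OF k(1)] cont by (auto intro: borel_measurable_continuous_onI)
      note km' = measurable_compose[OF measurable_coord[OF v(1)] km(1)] measurable_compose[OF measurable_coord[OF v(1)] km(2)]
      have kb: "\<bar>k x\<bar> \<le> C + e / 6" for x using k(2)[of x] C(2)[of x] by linarith
      have i: "integrable (changed_law y) (\<lambda>w. k (w v))" "integrable (changed_law y) (\<lambda>w. ?h (w v))"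
        by (rule Q.integrable_bounded[OF y km'(1) kb], rule Q.integrable_bounded[OF y km'(2) C(2)])
      have "\<bar>LINT w|changed_law y. ?h (w v) - k (w v)\<bar> \<le> e / 6"
        by (rule Q.abs_integral_le[OF y]) (use km' k(2) in \<open>auto simp: abs_minus_commute\<close>)
      then have "\<bar>(LINT w|changed_law y. ?h (w v)) - (LINT w|changed_law y. k (w v))\<bar> \<le> e / 6"
        using i by simp
      moreover have "\<bar>(LINT w|changed_law y. k (w v)) - k y\<bar> \<le> e / 6"
      proof -
        have "K * v \<le> (\<bar>K\<bar> + 1) * d" using v d by (intro mult_mono) auto
        also have "\<dots> = e / 6"
        proof -
          have "c * (e / (6 * c)) = e / 6" if "0 < c" for c :: real using that by simp
          from this[of "\<bar>K\<bar> + 1"] show ?thesis unfolding d_def by linarith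
        qed
        finally show ?thesis using K[OF y v(1)] by linarith
      qed
      ultimately show ?thesis using k(2)[of y] by linarith
    qed
    \<comment> \<open>The quotient is the average over [0,u] of expectations within e/2 of
      \<open>?h y\<close>; the other half of e gives the strict inequality.\<close>
    have main: "dist (((LINT w|changed_law y. f (w u)) - f y) / u) (?h y) < e" if u: "0 < u" "u < d" and y: "0 \<le> y" for u y
    proof -
      let ?\<gamma> = "\<lambda>s. LINT w|changed_law y. ?h (w s)"
      have c: "continuous_on {0..u} ?\<gamma>"
        by (rule continuous_on_subset[OF Q.expectation_continuous[OF y cont C(2)]]) auto
      have "norm (integral {0..u} (\<lambda>s. ?\<gamma> s - ?h y)) \<le> e / 2 * (u - 0)"
      proof (rule integral_bound)
        show "continuous_on {0..u} (\<lambda>s. ?\<gamma> s - ?h y)" by (intro continuous_on_diff c continuous_on_const)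
        show "norm (?\<gamma> s - ?h y) \<le> e / 2" if "s \<in> {0..u}" for s
          unfolding real_norm_def by (rule close[OF y]) (use that u in auto)
      qed (use u in simp)
      moreover have "integral {0..u} (\<lambda>s. ?\<gamma> s - ?h y) = integral {0..u} ?\<gamma> - integral {0..u} (\<lambda>_. ?h y)"
        by (rule Henstock_Kurzweil_Integration.integral_diff) (auto intro: integrable_continuous_interval c)
      ultimately have le: "\<bar>(LINT w|changed_law y. f (w u)) - f y - u * ?h y\<bar> \<le> e / 2 * u"
        using increment[OF f y, of u] u by simp
      have "((LINT w|changed_law y. f (w u)) - f y) / u - ?h y = ((LINT w|changed_law y. f (w u)) - f y - u * ?h y) / u"
        using u by (subst diff_divide_distrib) simp
      then have "\<bar>((LINT w|changed_law y. f (w u)) - f y) / u - ?h y\<bar> = \<bar>(LINT w|changed_law y. f (w u)) - f y - u * ?h y\<bar> / u"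
        using u by (simp only: abs_divide abs_of_pos)
      also have "\<dots> \<le> e / 2" using le u by (subst pos_divide_le_eq) auto
      finally show ?thesis using e by (simp add: dist_real_def)
    qed
    have "\<forall>\<^sub>F u in at_right 0. 0 < u \<and> u < d"
      unfolding eventually_at_right_field using d by auto
    then show "\<forall>\<^sub>F t in at_right 0. \<forall>x\<in>{0..}. dist (((LINT w|changed_law x. f (w t)) - f x) / t)
        (1 / 2 * deriv (deriv f) x + b' x * deriv f x) < e"
      by eventually_elim (use main in \<open>auto simp: generator_def\<close>)
  qed
qed

end

subsection \<open>Regularity of the drift\<close>

text \<open>A single term of the exponential series with nonnegative argument is at most the whole
  sum.\<close>

lemma exp_minus_times_power:
  fixes z :: real
  assumes z: "0 \<le> z"
  shows "exp (- z) * z ^ n \<le> fact n"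
proof -
  have "z ^ n /\<^sub>R fact n \<le> exp z"
    using sum_le_suminf[OF summable_exp_generic[of z], of "{n}"] z by (simp add: exp_def)
  then have "exp (- z) * (z ^ n /\<^sub>R fact n) \<le> exp (- z) * exp z"
    by (intro mult_left_mono) auto
  also have "\<dots> = 1" by (simp add: exp_add[symmetric])
  finally show ?thesis by (simp add: field_simps)
qed

text \<open>Up to the sign (-1)^j this is the j-th derivative of \<open>bessel_K\<close>, by
  differentiation under the integral.\<close>

definition bessel_moment :: "real \<Rightarrow> nat \<Rightarrow> real \<Rightarrow> real" where
  "bessel_moment \<beta> j y = (LBINT t:{0..}. exp (- y * cosh t) * cosh t ^ j * cosh (\<beta> * t))"

context
  fixes \<beta> :: real
  assumes \<beta>: "\<bar>\<beta>\<bar> \<le> 1"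
begin

text \<open>\<open>cosh (\<beta> * t)\<close> is at most \<open>cosh t\<close>, and the factor
  \<open>2 * exp (- t) * cosh t\<close>, which is at least 1, is inserted to produce decay in t. The
  resulting j + 2 powers of \<open>cosh t\<close> are absorbed by the exponential.\<close>

lemma bessel_integrand_bound:
  assumes y: "0 < y" and t: "0 \<le> t"
  shows "exp (- y * cosh t) * cosh t ^ j * cosh (\<beta> * t) \<le> 2 * fact (j + 2) / y ^ (j + 2) * exp (- t)"
proof -
  let ?c = "cosh t"
  have c: "1 \<le> ?c" by (rule cosh_real_ge_1)
  have "cosh \<bar>\<beta> * t\<bar> \<le> cosh \<bar>t\<bar>"
    by (subst cosh_real_nonneg_le_iff) (use \<beta> in \<open>auto simp: abs_mult intro: mult_left_le_one_le\<close>)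
  then have cb: "cosh (\<beta> * t) \<le> ?c" by simp
  have "2 * exp (- t) * ?c = exp (- t) * exp t + exp (- t) * exp (- t)"
    by (simp add: cosh_def algebra_simps)
  also have "exp (- t) * exp t = 1" by (simp add: exp_add[symmetric])
  finally have tc: "1 \<le> 2 * exp (- t) * ?c" by simp
  have "exp (- y * ?c) * ?c ^ j * cosh (\<beta> * t) \<le> exp (- (y * ?c)) * ?c ^ j * ?c"
    using c cb by (intro mult_mono) auto
  also have "\<dots> \<le> exp (- (y * ?c)) * ?c ^ j * ?c * (2 * exp (- t) * ?c)"
    using mult_left_mono[OF tc, of "exp (- (y * ?c)) * ?c ^ j * ?c"] c by simp
  also have "\<dots> = 2 * exp (- t) / y ^ (j + 2) * (exp (- (y * ?c)) * (y * ?c) ^ (j + 2))"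
    using y by (simp add: power_mult_distrib power2_eq_square)
  also have "\<dots> \<le> 2 * exp (- t) / y ^ (j + 2) * fact (j + 2)"
    by (intro mult_left_mono exp_minus_times_power) (use y c in auto)
  finally show ?thesis by (simp add: mult_ac)
qed

lemma bessel_integrable:
  assumes y: "0 < y"
  shows "set_integrable lborel {0..} (\<lambda>t. exp (- y * cosh t) * cosh t ^ j * cosh (\<beta> * t))"
proof -
  have "integrable lborel (\<lambda>t. exp (- t) * indicator {0..} t :: real)"
    using has_bochner_integral_I0i_power_exp_m'[of 0] by (simp add: has_bochner_integral_iff)
  then have "integrable lborel (\<lambda>t. 2 * fact (j + 2) / y ^ (j + 2) * (exp (- t) * indicator {0..} t))"
    by (rule integrable_mult_right)
  then show ?thesis
    unfolding set_integrable_def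
  proof (rule Bochner_Integration.integrable_bound)
    have "continuous_on UNIV (\<lambda>t. exp (- y * cosh t) * cosh t ^ j * cosh (\<beta> * t))"
      unfolding cosh_def by (intro continuous_intros)
    then have "(\<lambda>t. exp (- y * cosh t) * cosh t ^ j * cosh (\<beta> * t)) \<in> borel_measurable borel"
      by (rule borel_measurable_continuous_onI)
    then show "(\<lambda>t. indicat_real {0..} t *\<^sub>R (exp (- y * cosh t) * cosh t ^ j * cosh (\<beta> * t))) \<in> borel_measurable lborel"
      by measurable
    show "AE t in lborel. norm (indicat_real {0..} t *\<^sub>R (exp (- y * cosh t) * cosh t ^ j * cosh (\<beta> * t)))
        \<le> norm (2 * fact (j + 2) / y ^ (j + 2) * (exp (- t) * indicator {0..} t))"
      using bessel_integrand_bound[OF y, of _ j] y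
      by (intro AE_I2) (auto simp: abs_mult split: split_indicator)
  qed
qed

text \<open>The second-order Taylor remainder of the exponential. For |h| at most y/2 it costs no
  more than half of the decay, which leaves a moment at y/2.\<close>

lemma bessel_moment_diff_bound:
  assumes y: "0 < y" and h: "\<bar>h\<bar> \<le> y / 2"
  shows "\<bar>bessel_moment \<beta> j (y + h) - bessel_moment \<beta> j y + h * bessel_moment \<beta> (Suc j) y\<bar>
    \<le> h\<^sup>2 * bessel_moment \<beta> (j + 2) (y / 2)"
proof -
  have yh: "0 < y + h" and y2: "0 < y / 2" using y h by auto
  let ?k = "\<lambda>j y t. exp (- y * cosh t) * cosh t ^ j * cosh (\<beta> * t)"
  have iM: "set_integrable lborel {0..} (\<lambda>t. a * ?k j s t)" if "0 < s" for a j s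
    by (rule set_integrable_mult_right) (rule bessel_integrable[OF that])
  note ih = bessel_integrable[OF yh, of j] and iy = bessel_integrable[OF y, of j] and ihy = iM[OF y, of h "Suc j"]
  have est: "\<bar>exp (- h * c) - 1 + h * c\<bar> * exp (- y * c) \<le> h\<^sup>2 * c ^ 2 * exp (- (y / 2) * c)" if c: "1 \<le> c" for c :: real
  proof -
    obtain r where r: "\<bar>r\<bar> \<le> \<bar>- h * c\<bar>" "exp (- h * c) = (\<Sum>m<2. (- h * c) ^ m / fact m) + exp r / fact 2 * (- h * c) ^ 2"
      using Maclaurin_exp_le[of "- h * c" 2] by blast
    have "r \<le> \<bar>h\<bar> * c" using r(1) c by (simp add: abs_mult)
    also have "\<dots> \<le> y / 2 * c" using h c by (intro mult_right_mono) auto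
    finally have up: "exp r * exp (- y * c) \<le> exp (- (y / 2) * c)" by (simp add: exp_add[symmetric])
    have "\<bar>exp (- h * c) - 1 + h * c\<bar> * exp (- y * c) = h\<^sup>2 * c ^ 2 / 2 * (exp r * exp (- y * c))"
      unfolding r(2) using c by (simp add: abs_mult numeral_2_eq_2 power_mult_distrib)
    also have "\<dots> \<le> h\<^sup>2 * c ^ 2 / 2 * exp (- (y / 2) * c)" using up c by (intro mult_left_mono) auto
    also have "\<dots> \<le> h\<^sup>2 * c ^ 2 * exp (- (y / 2) * c)" by (intro mult_right_mono) auto
    finally show ?thesis .
  qed
  have split: "exp (- (y + h) * c) = exp (- h * c) * exp (- y * c)" for c :: real
    by (simp add: exp_add[symmetric] algebra_simps)
  have "\<bar>LBINT t:{0..}. ?k j (y + h) t - ?k j y t + h * ?k (Suc j) y t\<bar> \<le> (LBINT t:{0..}. h\<^sup>2 * ?k (j + 2) (y / 2) t)"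
    unfolding real_norm_def[symmetric] set_lebesgue_integral_def
  proof (rule Bochner_Integration.integral_norm_bound_integral)
    show "integrable lborel (\<lambda>t. indicat_real {0..} t *\<^sub>R (?k j (y + h) t - ?k j y t + h * ?k (Suc j) y t))"
      using set_integral_add(1)[OF set_integral_diff(1)[OF ih iy] ihy] by (simp add: set_integrable_def)
    show "integrable lborel (\<lambda>t. indicat_real {0..} t *\<^sub>R (h\<^sup>2 * ?k (j + 2) (y / 2) t))"
      using iM[OF y2, of "h\<^sup>2" "j + 2"] by (simp add: set_integrable_def)
    fix t :: real
    have c: "1 \<le> cosh t" by (rule cosh_real_ge_1)
    have "?k j (y + h) t - ?k j y t + h * ?k (Suc j) y t
        = (exp (- h * cosh t) - 1 + h * cosh t) * exp (- y * cosh t) * cosh t ^ j * cosh (\<beta> * t)"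
      unfolding split by (simp add: algebra_simps)
    then have "\<bar>?k j (y + h) t - ?k j y t + h * ?k (Suc j) y t\<bar>
        = \<bar>exp (- h * cosh t) - 1 + h * cosh t\<bar> * exp (- y * cosh t) * cosh t ^ j * cosh (\<beta> * t)"
      using c by (simp add: abs_mult)
    also have "\<dots> \<le> h\<^sup>2 * cosh t ^ 2 * exp (- (y / 2) * cosh t) * cosh t ^ j * cosh (\<beta> * t)"
      using est[OF c] c by (intro mult_right_mono) auto
    also have "\<dots> = h\<^sup>2 * ?k (j + 2) (y / 2) t" by (simp add: power_add power2_eq_square mult_ac)
    finally show "norm (indicat_real {0..} t *\<^sub>R (?k j (y + h) t - ?k j y t + h * ?k (Suc j) y t))
        \<le> indicat_real {0..} t *\<^sub>R (h\<^sup>2 * ?k (j + 2) (y / 2) t)"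
      by (auto split: split_indicator)
  qed
  moreover have "(LBINT t:{0..}. ?k j (y + h) t - ?k j y t + h * ?k (Suc j) y t)
      = bessel_moment \<beta> j (y + h) - bessel_moment \<beta> j y + h * bessel_moment \<beta> (Suc j) y"
    using set_integral_add(2)[OF set_integral_diff(1)[OF ih iy] ihy] set_integral_diff(2)[OF ih iy]
    by (simp add: bessel_moment_def)
  ultimately show ?thesis by (simp add: bessel_moment_def)
qed

lemma bessel_K_eq_moment: "bessel_K \<beta> = bessel_moment \<beta> 0"
  by (simp add: fun_eq_iff bessel_K_def bessel_moment_def)

text \<open>On [0,1] the integrand is at least \<open>exp (- y * cosh 1)\<close>. Positivity permits
  the division in the logarithmic derivative.\<close>

lemma bessel_K_pos: "0 < y \<Longrightarrow> 0 < bessel_K \<beta> y"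
proof -
  assume y: "0 < y"
  have "(LBINT t. indicator {0..1::real} t * exp (- y * cosh 1)) \<le> bessel_K \<beta> y"
    unfolding bessel_K_def set_lebesgue_integral_def
  proof (rule integral_mono)
    show "integrable lborel (\<lambda>t. indicat_real {0..} t *\<^sub>R (exp (- y * cosh t) * cosh (\<beta> * t)))"
      using bessel_integrable[OF y, of 0] by (simp add: set_integrable_def)
    show "integrable lborel (\<lambda>t. indicator {0..1::real} t * exp (- y * cosh 1) :: real)" by simp
    fix t :: real
    have "exp (- y * cosh 1) \<le> exp (- y * cosh t) * cosh (\<beta> * t)" if "0 \<le> t" "t \<le> 1"
    proof -
      have "cosh t \<le> cosh 1" using that by (subst cosh_real_nonneg_le_iff) auto
      then have "exp (- y * cosh 1) * 1 \<le> exp (- y * cosh t) * cosh (\<beta> * t)"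
        using y by (intro mult_mono cosh_real_ge_1) auto
      then show ?thesis by simp
    qed
    then show "indicator {0..1} t * exp (- y * cosh 1) \<le> indicat_real {0..} t *\<^sub>R (exp (- y * cosh t) * cosh (\<beta> * t))"
      by (auto split: split_indicator)
  qed
  moreover have "(LBINT t. indicator {0..1::real} t * exp (- y * cosh 1)) = exp (- y * cosh 1)" by simp
  ultimately show ?thesis by (smt (verit) exp_gt_zero)
qed

text \<open>Dividing the second-order bound by h leaves an error proportional to |h|.\<close>

lemma bessel_moment_deriv:
  assumes y: "0 < y"
  shows "(bessel_moment \<beta> j has_real_derivative - bessel_moment \<beta> (Suc j) y) (at y)"
  unfolding DERIV_def
proof (rule LIM_zero_cancel, rule Lim_null_comparison)
  let ?m = "bessel_moment \<beta> j" and ?m' = "bessel_moment \<beta> (Suc j)" and ?M = "bessel_moment \<beta> (j + 2) (y / 2)"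
  show "\<forall>\<^sub>F h in at 0. norm ((?m (y + h) - ?m y) / h - - ?m' y) \<le> \<bar>h\<bar> * ?M"
    unfolding eventually_at
  proof (intro exI conjI ballI impI)
    show "0 < y / 2" using y by simp
    fix h :: real assume h: "h \<noteq> 0 \<and> dist h 0 < y / 2"
    have "(?m (y + h) - ?m y) / h - - ?m' y = (?m (y + h) - ?m y + h * ?m' y) / h"
      using h by (simp add: add_divide_distrib)
    then have "norm ((?m (y + h) - ?m y) / h - - ?m' y) = \<bar>?m (y + h) - ?m y + h * ?m' y\<bar> / \<bar>h\<bar>"
      by (simp only: real_norm_def abs_divide)
    also have "\<dots> \<le> h\<^sup>2 * ?M / \<bar>h\<bar>"
      by (intro divide_right_mono bessel_moment_diff_bound y) (use h in auto)
    also have "h\<^sup>2 * ?M / \<bar>h\<bar> = \<bar>h\<bar> * ?M"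
      using h by (simp add: power2_eq_square abs_if)
    finally show "norm ((?m (y + h) - ?m y) / h - - ?m' y) \<le> \<bar>h\<bar> * ?M" .
  qed
  have "((\<lambda>h. \<bar>h\<bar> * ?M) \<longlongrightarrow> \<bar>0\<bar> * ?M) (at 0)" by (intro tendsto_intros)
  then show "((\<lambda>h. \<bar>h\<bar> * ?M) \<longlongrightarrow> 0) (at 0)" by simp
qed

lemma bessel_moment_continuous: "continuous_on {0<..} (bessel_moment \<beta> j)"
  by (rule DERIV_continuous_on[of _ _ "\<lambda>y. - bessel_moment \<beta> (Suc j) y"])
     (rule has_field_derivative_at_within, rule bessel_moment_deriv, simp)

text \<open>The product rule expresses the quotient through the moments 0 and 1, which are
  continuous, over a positive denominator.\<close>

lemma bessel_K_hat_logderiv_continuous: "continuous_on {0<..} (bessel_K_hat_logderiv \<beta>)"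
proof -
  have hat: "(bessel_K_hat \<beta> has_real_derivative
      y powr \<beta> * (- bessel_moment \<beta> (Suc 0) y) + \<beta> * y powr (\<beta> - 1) * bessel_K \<beta> y) (at y)" if y: "0 < y" for y
    unfolding bessel_K_hat_def [abs_def]
    by (rule DERIV_mult'[OF has_real_derivative_powr[OF y] bessel_moment_deriv[OF y, of 0, folded bessel_K_eq_moment]])
  have "continuous_on {0<..} (\<lambda>y. (y powr \<beta> * (- bessel_moment \<beta> (Suc 0) y) + \<beta> * y powr (\<beta> - 1) * bessel_K \<beta> y) / (y powr \<beta> * bessel_K \<beta> y))"
    by (intro continuous_intros bessel_moment_continuous bessel_moment_continuous[of 0, folded bessel_K_eq_moment]) (auto dest: bessel_K_pos)
  then show ?thesis
    by (subst continuous_on_cong[of "{0<..}" "{0<..}" _ "\<lambda>y. (y powr \<beta> * (- bessel_moment \<beta> (Suc 0) y) + \<beta> * y powr (\<beta> - 1) * bessel_K \<beta> y) / (y powr \<beta> * bessel_K \<beta> y)"])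
       (auto simp: bessel_K_hat_logderiv_def DERIV_imp_deriv[OF hat] bessel_K_hat_def)
qed

end

subsection \<open>The time change of a reflected diffusion\<close>

text \<open>\<open>Y\<close> is \<open>changed_path\<close> applied to the path of \<open>X\<close>
  on the same probability space. Its law has the required form because pushing forward commutes with
  mixing over the starting point, which is squared.\<close>

theorem reflected_diffusion_time_change:
  fixes M :: "'a measure" and X :: "real \<Rightarrow> 'a \<Rightarrow> real"
  assumes b: "continuous_on {0<..} b" and b': "\<And>x. 0 < x \<Longrightarrow> b' (x\<^sup>2) = (1 + 2 * x * b x) / (4 * x\<^sup>2)"
    and X: "reflected_diffusion b M X"
  shows "\<exists>Y :: real \<Rightarrow> 'a \<Rightarrow> real. reflected_diffusion b' M Y \<and>
    (AE \<omega> in M. \<forall>t\<ge>0. (X t \<omega>)\<^sup>2 = Y (4 * integral {0..t} (\<lambda>u. (X u \<omega>)\<^sup>2)) \<omega>)"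
proof -
  let ?R = "restrict_space borel {0..} :: real measure"
  define path where "path \<omega> = (\<lambda>t\<in>{0..}. X t \<omega>)" for \<omega>
  from X obtain P where M: "prob_space M" and path: "path \<in> M \<rightarrow>\<^sub>M path_space"
    and P: "strong_markov_laws P" "generated_on_pos b P" "instantaneous_at_0 P"
    and law: "distr M path_space path = distr M ?R (X 0) \<bind> P"
    unfolding reflected_diffusion_def path_def by blast
  interpret M: prob_space M by fact
  interpret time_changed_generator P b b'
    by unfold_locales (use P b b' in auto)
  have ps: "path \<omega> \<in> paths" if "\<omega> \<in> space M" for \<omega> using measurable_space[OF path that] .
  have X0: "X 0 \<in> M \<rightarrow>\<^sub>M ?R"
  proof (rule measurable_restrict_space2)
    have "(\<lambda>\<omega>. path \<omega> 0) \<in> borel_measurable M" by (rule measurable_compose[OF path measurable_coord]) simp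
    then show "X 0 \<in> borel_measurable M" by (simp add: path_def)
    show "X 0 \<in> space M \<rightarrow> {0..}" using path_spaceD(2)[OF ps, of _ 0] by (auto simp: path_def)
  qed
  have neM: "space M \<noteq> {}" by (rule M.not_empty)
  define Y where "Y t \<omega> = changed_path (path \<omega>) t" for t \<omega>
  have Ypath: "(\<lambda>t\<in>{0..}. Y t \<omega>) = changed_path (path \<omega>)" if "\<omega> \<in> space M" for \<omega>
    unfolding Y_def using path_spaceD(3)[OF changed_path_in_space[OF ps[OF that]]]
    by (simp add: extensional_restrict)
  have Ym: "(\<lambda>\<omega>. changed_path (path \<omega>)) \<in> M \<rightarrow>\<^sub>M path_space"
    by (rule measurable_compose[OF path measurable_changed_path])
  \<comment> \<open>This holds for every path, not just almost surely, because
    \<open>freeze 0\<close> keeps the initial value.\<close>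
  have Y0: "Y 0 \<omega> = (X 0 \<omega>)\<^sup>2" if "\<omega> \<in> space M" for \<omega>
    using time_change_0[OF regular_path_in_space clock_unbounded_regular_path, OF ps ps, OF that that]
    by (simp add: Y_def changed_path_def regular_path_def path_def freeze_def)
  have sq: "(\<lambda>x. x\<^sup>2) \<in> ?R \<rightarrow>\<^sub>M ?R"
    by (intro measurable_restrict_space2 measurable_restrict_space1) auto
  have "distr M path_space (\<lambda>\<omega>. \<lambda>t\<in>{0..}. Y t \<omega>) = distr M path_space (\<lambda>\<omega>. changed_path (path \<omega>))"
    by (rule distr_cong) (auto simp: Ypath)
  also have "\<dots> = distr (distr M path_space path) path_space changed_path"
    by (subst distr_distr[OF measurable_changed_path path]) (simp add: o_def)
  also have "\<dots> = distr M ?R (X 0) \<bind> (\<lambda>x. distr (P x) path_space changed_path)"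
    unfolding law by (rule distr_bind[OF _ _ measurable_changed_path]) (use kernel' X0 neM in \<open>auto simp: space_restrict_space\<close>)
  also have "\<dots> = distr M ?R (X 0) \<bind> (\<lambda>x. changed_law (x\<^sup>2))"
    by (rule bind_cong_simp) (auto simp: simp_implies_def space_restrict_space changed_law_square)
  also have "\<dots> = distr (distr M ?R (X 0)) ?R (\<lambda>x. x\<^sup>2) \<bind> changed_law"
    by (rule bind_distr[symmetric, where K=path_space])
       (use sq measurable_prob_algebraD[OF kernel_changed_law] in \<open>auto simp: space_restrict_space\<close>)
  also have "distr (distr M ?R (X 0)) ?R (\<lambda>x. x\<^sup>2) = distr M ?R (Y 0)"
    by (subst distr_distr[OF sq X0]) (auto intro!: distr_cong simp: Y0)
  finally have "distr M path_space (\<lambda>\<omega>. \<lambda>t\<in>{0..}. Y t \<omega>) = distr M ?R (Y 0) \<bind> changed_law" .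
  moreover have "(\<lambda>\<omega>. \<lambda>t\<in>{0..}. Y t \<omega>) \<in> M \<rightarrow>\<^sub>M path_space"
    by (rule measurable_cong[THEN iffD2, OF _ Ym]) (rule Ypath)
  ultimately have "reflected_diffusion b' M Y"
    unfolding reflected_diffusion_def
    using M changed_strong_markov_laws changed_generated changed_instantaneous by blast
  moreover have "AE \<omega> in M. \<forall>t\<ge>0. (X t \<omega>)\<^sup>2 = Y (4 * integral {0..t} (\<lambda>u. (X u \<omega>)\<^sup>2)) \<omega>"
  proof -
    \<comment> \<open>Unboundedness has probability one under each \<open>P x\<close> with x \<ge>
      0, hence under their mixture, which is the law of \<open>X\<close>.\<close>
    have "AE w in distr M ?R (X 0) \<bind> P. clock_unbounded w"
    proof (subst AE_bind[where B=path_space])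
      show "AE x in distr M ?R (X 0). AE w in P x. clock_unbounded w"
        by (rule AE_I2, rule clock_unbounded_AE) (simp add: space_restrict_space)
    qed (use kernel' measurable_clock_unbounded in auto)
    then have "AE w in distr M path_space path. clock_unbounded w" by (simp only: law)
    then have "AE \<omega> in M. clock_unbounded (path \<omega>)"
      by (subst (asm) AE_distr_iff) (use path measurable_clock_unbounded in \<open>auto simp: pred_def\<close>)
    then show ?thesis
    proof (rule AE_mp, intro AE_I2 impI allI)
      fix \<omega> t assume \<omega>: "\<omega> \<in> space M" and ub: "clock_unbounded (path \<omega>)" and t: "0 \<le> (t :: real)"
      have "clock (path \<omega>) t = 4 * integral {0..t} (\<lambda>u. (X u \<omega>)\<^sup>2)"
        unfolding clock_def by (intro arg_cong[where f="(*) 4"] integral_cong) (simp add: path_def)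
      moreover have "path \<omega> t = X t \<omega>" using t by (simp add: path_def)
      ultimately show "(X t \<omega>)\<^sup>2 = Y (4 * integral {0..t} (\<lambda>u. (X u \<omega>)\<^sup>2)) \<omega>"
        using time_change_clock[OF ps[OF \<omega>] ub t] by (simp add: Y_def changed_path_eq[OF ub])
    qed
  qed
  ultimately show ?thesis by blast
qed

theorem mainTheorem3:
  fixes \<alpha> \<mu> \<delta> \<theta> :: real
    and M :: "'a measure"
    and X :: "real \<Rightarrow> 'a \<Rightarrow> real"
  assumes "0 < \<alpha>" "\<alpha> < 1" and "0 < \<mu>"
    and "\<delta> = 2 * (1 - \<alpha>)" and "\<theta> = \<delta> * \<mu> / 2"
    and "reflected_diffusion
           (\<lambda>x. (\<delta> - 1) / (2 * x) + \<mu> * x * bessel_K_hat_logderiv (\<alpha> / 2) (\<mu> * (x\<^sup>2 / 2))) M X"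
  shows "\<exists>Y :: real \<Rightarrow> 'a \<Rightarrow> real.
           reflected_diffusion
             (\<lambda>x. (1 - \<alpha>) / (2 * x) + \<mu> / 2 * bessel_K_hat_logderiv (\<alpha> / 2) (\<mu> / 2 * x)) M Y \<and>
           (AE \<omega> in M. \<forall>t\<ge>0. (X t \<omega>)\<^sup>2 = Y (4 * integral {0..t} (\<lambda>u. (X u \<omega>)\<^sup>2)) \<omega>)"
proof (rule reflected_diffusion_time_change[OF _ _ assms(6)])
  have "\<bar>\<alpha> / 2\<bar> \<le> 1" using assms(1,2) by simp
  note R = bessel_K_hat_logderiv_continuous[OF this]
  have "continuous_on {0<..} (\<lambda>x. bessel_K_hat_logderiv (\<alpha> / 2) (\<mu> * (x\<^sup>2 / 2)))"
    by (rule continuous_on_compose2[OF R]) (use assms(3) in \<open>auto intro!: continuous_intros\<close>)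
  then show "continuous_on {0<..} (\<lambda>x. (\<delta> - 1) / (2 * x) + \<mu> * x * bessel_K_hat_logderiv (\<alpha> / 2) (\<mu> * (x\<^sup>2 / 2)))"
    by (intro continuous_on_add continuous_on_mult continuous_on_divide continuous_on_const continuous_on_id) auto
  fix x :: real assume x: "0 < x"
  define r where "r = bessel_K_hat_logderiv (\<alpha> / 2) (\<mu> / 2 * x\<^sup>2)"
  have "\<mu> * (x\<^sup>2 / 2) = \<mu> / 2 * x\<^sup>2" by simp
  then have r': "bessel_K_hat_logderiv (\<alpha> / 2) (\<mu> * (x\<^sup>2 / 2)) = r" by (simp only: r_def)
  \<comment> \<open>Since \<open>\<delta> = 2 * (1 - \<alpha>)\<close>, the numerator on the right
    is \<open>2 * (1 - \<alpha>) + 2 * \<mu> * x\<^sup>2 * r\<close>.\<close>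
  show "(1 - \<alpha>) / (2 * x\<^sup>2) + \<mu> / 2 * bessel_K_hat_logderiv (\<alpha> / 2) (\<mu> / 2 * x\<^sup>2) =
    (1 + 2 * x * ((\<delta> - 1) / (2 * x) + \<mu> * x * bessel_K_hat_logderiv (\<alpha> / 2) (\<mu> * (x\<^sup>2 / 2)))) / (4 * x\<^sup>2)"
    unfolding r' r_def[symmetric] assms(4) using x by (simp add: field_simps power2_eq_square)
qed

end
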